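(* For every $\varepsilon>0$ the following holds. Let $V$ be formed by sampling each vertex of $\{0,1\}^n$ independently with probability $p=p(n)$, and let $G$ be the graph of $\mathrm{conv}(V)$. Then with high probability: (a) $h(G)=\Theta(n)$ if $p\in(1/2+\varepsilon,1-\varepsilon)$; (b) $h(G)=n^{\Theta(\log\log n+\log(1/p))}$ if $p\in(n^{-0.05},1/2-\varepsilon)$. The constants hidden by $\Theta(\cdot)$ may depend on $\varepsilon$.
   Context: The graph (1-skeleton) of a polytope $P$ has as vertices the 0-dimensional faces of $P$ and as edges its 1-dimensional faces; for $V\subseteq\{0,1\}^n$ the vertices of $\mathrm{conv}(V)$ are exactly the points of $V$. For a graph $G$, the edge-expansion is $h(G)=\min\{|\partial(U)|/|U| : U\subseteq V(G),\ 1\le |U|\le |V(G)|/2\}$, where $\partial(U)$ is the set of edges with exactly one endpoint in $U$. An event (sequence of events $A_n$) holds with high probability if $\mathbb{P}(A_n)\to 1$ as $n\to\infty$. *)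

theory Defs
  imports "HOL-Analysis.Analysis" "HOL-Probability.Probability" "HOL-Analysis.Finite_Function_Topology"
begin

text \<open>
  The dimension \<open>n\<close> tends to infinity inside the statement, so all the spaces \<open>\<real>\<^sup>n\<close> are
  realised as the subspaces \<open>{x. Poly_Mapping.keys x \<subseteq> {..<n}}\<close> of the single real vector space
  of finitely supported sequences. Convex hulls and faces do not depend on the ambient space.
\<close>

definition cube :: "nat \<Rightarrow> (nat \<Rightarrow>\<^sub>0 real) set" where
  "cube n = {x. Poly_Mapping.keys x \<subseteq> {..<n} \<and> (\<forall>i<n. Poly_Mapping.lookup x i \<in> {0, 1})}"

text \<open>
  The library's \<open>aff_dim\<close> is restricted to Euclidean spaces; this is its defining condition, for
  arbitrary real vector spaces.
\<close>

definition has_aff_dim :: "'a::real_vector set \<Rightarrow> nat \<Rightarrow> bool" where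
  "has_aff_dim S d \<longleftrightarrow>
     (\<exists>B. affine hull B = affine hull S \<and> \<not> affine_dependent B \<and> card B = d + 1)"

lemma has_aff_dim_iff_aff_dim:
  fixes S :: "'a::euclidean_space set"
  shows "has_aff_dim S d \<longleftrightarrow> aff_dim S = int d"
proof
  assume "has_aff_dim S d"
  then obtain B where "affine hull B = affine hull S" "\<not> affine_dependent B" "card B = d + 1"
    unfolding has_aff_dim_def by blast
  then show "aff_dim S = int d"
    using aff_dim_unique[of B S] by simp
next
  assume *: "aff_dim S = int d"
  obtain B where "affine hull B = affine hull S" "\<not> affine_dependent B" "int (card B) = aff_dim S + 1"
    using aff_dim_basis_exists[of S] by auto
  with * show "has_aff_dim S d"
    unfolding has_aff_dim_def by (intro exI[of _ B]) auto
qed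

definition polytope_vertices :: "'a::real_vector set \<Rightarrow> 'a set" where
  "polytope_vertices P = {v. {v} face_of P}"

text \<open>A one-dimensional face is recorded as the set of its end vertices.\<close>

definition polytope_edges :: "'a::real_vector set \<Rightarrow> 'a set set" where
  "polytope_edges P = {F \<inter> polytope_vertices P | F. F face_of P \<and> has_aff_dim F 1}"

definition edge_boundary :: "'a set set \<Rightarrow> 'a set \<Rightarrow> 'a set set" where
  "edge_boundary E U = {e \<in> E. card (e \<inter> U) = 1}"

text \<open>
  For a graph with vertex set \<open>W\<close> and edge set \<open>E\<close>; the value is meaningful only if \<open>W\<close> is finite
  with at least two elements, as otherwise no set \<open>U\<close> is admissible.
\<close>

definition edge_expansion :: "'a set \<Rightarrow> 'a set set \<Rightarrow> real" where
  "edge_expansion W E =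
     Min {real (card (edge_boundary E U)) / real (card U) | U.
            U \<subseteq> W \<and> 1 \<le> card U \<and> real (card U) \<le> real (card W) / 2}"

definition polytope_expansion :: "'a::real_vector set \<Rightarrow> real" where
  "polytope_expansion P = edge_expansion (polytope_vertices P) (polytope_edges P)"

definition random_subset_pmf :: "'a set \<Rightarrow> real \<Rightarrow> 'a set pmf" where
  "random_subset_pmf A q = map_pmf (\<lambda>f. {x \<in> A. f x}) (Pi_pmf A False (\<lambda>_. bernoulli_pmf q))"

end

theory Submission
  imports Defs "HOL-Real_Asymp.Real_Asymp"
begin

text \<open>
  Vertices of the cube are identified with subsets of \<open>{..<n}\<close>, so that moving in the directions \<open>S\<close>
  is symmetric difference with \<open>S\<close>. Let \<open>H\<close> be the random family and \<open>G\<close> its graph.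

  \<^bold>\<open>Upper bounds.\<close> If \<open>p > 1/2\<close>, some vertex of \<open>H\<close> has all its \<open>n\<close> cube neighbours in \<open>H\<close>, and then it
  has no other neighbours in \<open>G\<close>. In general, an edge \<open>{u, w}\<close> of \<open>G\<close> excludes every other pair of \<open>H\<close>
  that is antipodal in the subcube spanned by \<open>u\<close> and \<open>w\<close>; the first moment of the number of such
  pairs \<open>{u, w}\<close> bounds the average degree by \<open>n\<close> to the power \<open>O(log log n + log (1/p))\<close>.

  \<^bold>\<open>Lower bounds.\<close> Fix a vertex \<open>z\<close> and a bounded set \<open>\<Delta>\<close> of directions. For a positive fraction (up to a power
  of \<open>n\<close>) of the pairs of disjoint \<open>d\<close>-sets \<open>K1, K2\<close> of directions, taken from any two linear-sized sets,
  the only points of \<open>H\<close> in the subcube at \<open>z\<close> in the directions \<open>K1, K2, \<Delta>\<close> that leave \<open>z\<close> in at least two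
  directions of \<open>K1 \<union> K2\<close> are \<open>z + K1\<close> and \<open>z + \<Delta> + K2\<close>; these two are then adjacent in \<open>G\<close>, and \<open>z + K1\<close> is
  adjacent to \<open>z\<close> or to neighbours of \<open>z\<close> in \<open>H\<close>. This yields very many paths of length three
  in \<open>G\<close>, made of long edges, between places that are close in the cube. Given a vertex set \<open>U\<close>
  of \<open>G\<close>, extend \<open>U\<close> to a set \<open>W\<close> of cube vertices, by majority among the neighbours if \<open>p > 1/2\<close> (then every
  vertex has linearly many neighbours in \<open>H\<close>), and by a nearby point of \<open>H\<close> if \<open>p < 1/2\<close> (then every
  vertex has linearly many neighbours outside \<open>H\<close>). By edge isoperimetry in the cube the edge boundary
  of \<open>W\<close> is large; each of its edges forces many boundary edges of \<open>U\<close> on the paths, and a long edge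
  of \<open>G\<close> is counted only few times.
\<close>

section \<open>Symmetric differences\<close>

text \<open>\<open>U\<close> may depend on the random family, and there are far too many vertex sets
  for a union bound. Randomness therefore enters only through local events, indexed by a vertex, a
  few directions or a grid, that hold for all indices at once; the rest is deterministic. The
  threshold 1/2 comes from the 2^n vertices: a vertex has few neighbours in \<open>H\<close> with
  probability about (1 - p)^n, which beats 2^n for p > 1/2; for p < 1/2 the same is true of
  neighbours outside \<open>H\<close>. The exponent comes from emptiness. A pattern in 2d directions
  needs about 2^(2d) points to be absent. This has probability at least an inverse power of n as
  long as p * 2^(2d) is of order log n, and then d is of order log log n + log (1/p). There are
  about n^(2d) patterns, while an outer edge of a path leaves one d-set free, so about n^d boundary
  edges are gained. Conversely, a subcube of dimension k has 2^(k-1) antipodal pairs, each inside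
  \<open>H\<close> with probability p^2, so edges rarely span more than a dimension of the same
  order. For p > 1/2 a fixed d = 3 already gives the factor n.\<close>

definition sdiff :: "'a set \<Rightarrow> 'a set \<Rightarrow> 'a set"  (infixl \<open>\<triangle>\<close> 65) where
  "x \<triangle> y = (x - y) \<union> (y - x)"

lemma in_sdiff [simp]: "i \<in> x \<triangle> y \<longleftrightarrow> (i \<in> x) \<noteq> (i \<in> y)"
  by (auto simp: sdiff_def)

lemma sdiff_assoc: "(x \<triangle> y) \<triangle> z = x \<triangle> (y \<triangle> z)"
  by (auto simp: set_eq_iff)

lemma sdiff_commute: "x \<triangle> y = y \<triangle> x"
  by (auto simp: set_eq_iff)

lemma sdiff_self [simp]: "x \<triangle> x = {}" "x \<triangle> (x \<triangle> y) = y" "(y \<triangle> x) \<triangle> x = y"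
    "(x \<triangle> y) \<triangle> x = y" "x \<triangle> (y \<triangle> x) = y"
  by (auto simp: set_eq_iff)

lemma sdiff_empty [simp]: "x \<triangle> {} = x" "{} \<triangle> x = x"
  by (auto simp: set_eq_iff)

lemma sdiff_cancel [simp]: "x \<triangle> y = x \<triangle> z \<longleftrightarrow> y = z" "y \<triangle> x = z \<triangle> x \<longleftrightarrow> y = z"
  by (auto simp: set_eq_iff)

lemma sdiff_eq_self [simp]: "x \<triangle> y = x \<longleftrightarrow> y = {}" "x \<triangle> y = y \<longleftrightarrow> x = {}" "x \<triangle> y = {} \<longleftrightarrow> x = y"
  unfolding sdiff_def by blast+

lemma sdiff_eqD: "x \<triangle> z = y \<Longrightarrow> x = z \<triangle> y"
  by auto

lemma sdiff_subset: "x \<subseteq> A \<Longrightarrow> y \<subseteq> A \<Longrightarrow> x \<triangle> y \<subseteq> A"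
  by (auto simp: sdiff_def)

lemma finite_sdiff [intro]: "finite x \<Longrightarrow> finite y \<Longrightarrow> finite (x \<triangle> y)"
  by (auto simp: sdiff_def)

section \<open>Faces of convex hulls of finite sets\<close>

text \<open>The gaps \<open>M - f v\<close> are nonnegative and average to zero under the weights of
  a point with value \<open>M\<close>, so only maximisers carry weight.\<close>

lemma convex_hull_Int_hyperplane_eq:
  fixes V :: "'a::real_vector set" and f :: "'a \<Rightarrow> real"
  assumes "linear f" "finite V" and le: "\<And>v. v \<in> V \<Longrightarrow> f v \<le> M"
  shows "convex hull {v \<in> V. f v = M} = {x \<in> convex hull V. f x = M}"
proof
  interpret f: linear f by fact
  have "convex {x. f x = M}"
    by (auto simp: convex_def f.add f.scale simp flip: distrib_right)
  then have "convex hull {v \<in> V. f v = M} \<subseteq> {x. f x = M}"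
    by (intro hull_minimal) auto
  moreover have "convex hull {v \<in> V. f v = M} \<subseteq> convex hull V"
    by (intro hull_mono) auto
  ultimately show "convex hull {v \<in> V. f v = M} \<subseteq> {x \<in> convex hull V. f x = M}"
    by auto
next
  interpret f: linear f by fact
  show "{x \<in> convex hull V. f x = M} \<subseteq> convex hull {v \<in> V. f v = M}"
  proof
    fix x assume "x \<in> {x \<in> convex hull V. f x = M}"
    then obtain u where u: "\<And>v. v \<in> V \<Longrightarrow> 0 \<le> u v" "sum u V = 1" "(\<Sum>v\<in>V. u v *\<^sub>R v) = x"
        and fx: "f x = M"
      by (auto simp: convex_hull_finite[OF \<open>finite V\<close>])
    have "(\<Sum>v\<in>V. u v * (M - f v)) = M * sum u V - f (\<Sum>v\<in>V. u v *\<^sub>R v)"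
      by (simp add: f.sum f.scale algebra_simps sum_subtractf sum_distrib_left)
    also have "\<dots> = 0"
      using u fx by simp
    finally have "\<forall>v\<in>V. u v * (M - f v) = 0"
      using u(1) le by (subst (asm) sum_nonneg_eq_0_iff) (auto simp: \<open>finite V\<close>)
    then have zero: "u v = 0" if "v \<in> V" "f v \<noteq> M" for v
      using that by auto
    let ?T = "{v \<in> V. f v = M}"
    have "sum u ?T = 1"
      using u(2) zero \<open>finite V\<close> by (subst sum.mono_neutral_left[of V]) auto
    moreover have "(\<Sum>v\<in>?T. u v *\<^sub>R v) = x"
      unfolding u(3)[symmetric] using zero \<open>finite V\<close> by (intro sum.mono_neutral_left) auto
    ultimately show "x \<in> convex hull ?T"
      using u(1) \<open>finite V\<close> by (auto simp: convex_hull_finite intro!: exI[of _ u])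
  qed
qed

text \<open>On a segment through a point of value \<open>M\<close> the gaps at both ends average to
  zero, hence vanish. All faces constructed below are exposed in this way.\<close>

lemma convex_hull_face_of_exposed:
  fixes V :: "'a::real_vector set" and f :: "'a \<Rightarrow> real"
  assumes "linear f" "finite V" and le: "\<And>v. v \<in> V \<Longrightarrow> f v \<le> M"
  shows "convex hull {v \<in> V. f v = M} face_of convex hull V"
proof -
  interpret f: linear f by fact
  have "convex {x. f x \<le> M}"
    by (auto simp: convex_def f.add f.scale intro!: convex_bound_le)
  then have le': "f x \<le> M" if "x \<in> convex hull V" for x
    using that le hull_minimal[of V "{x. f x \<le> M}" convex] by auto
  have key: "f a = M \<and> f b = M" if ab: "a \<in> convex hull V" "b \<in> convex hull V"
    and x: "f x = M" "x \<in> open_segment a b" for a b x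
  proof -
    obtain t where t: "0 < t" "t < 1" "x = (1 - t) *\<^sub>R a + t *\<^sub>R b"
      using x(2) by (auto simp: in_segment)
    have "f x = (1 - t) * f a + t * f b"
      unfolding t(3) by (simp add: f.add f.scale)
    then have "(1 - t) * (M - f a) + t * (M - f b) = 0"
      using x(1) by (simp add: algebra_simps)
    moreover have "0 \<le> (1 - t) * (M - f a)" "0 \<le> t * (M - f b)"
      using t le'[OF ab(1)] le'[OF ab(2)] by auto
    ultimately have "(1 - t) * (M - f a) = 0" "t * (M - f b) = 0"
      by linarith+
    then show ?thesis
      using t by auto
  qed
  note eq = convex_hull_Int_hyperplane_eq[OF assms]
  show ?thesis
    unfolding face_of_def
  proof (intro conjI ballI impI)
    fix a b x
    assume "a \<in> convex hull V" "b \<in> convex hull V" "x \<in> convex hull {v \<in> V. f v = M}" "x \<in> open_segment a b"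
    then show "a \<in> convex hull {v \<in> V. f v = M}" "b \<in> convex hull {v \<in> V. f v = M}"
      using key[of a b x] by (simp_all add: eq)
  qed (rule convex_convex_hull | rule hull_mono, blast)+
qed

text \<open>Split off a point \<open>v\<close> of positive weight: the combination lies strictly
  between \<open>v\<close> and the renormalised rest \<open>y\<close>, so the face property yields
  \<open>v\<close>. Weight 1, where \<open>y\<close> is undefined, and \<open>y = v\<close>, where
  the open segment is empty, are treated apart.\<close>

lemma face_of_convex_combination:
  fixes V :: "'a::real_vector set"
  assumes F: "F face_of convex hull V" and "finite V"
    and u: "\<And>v. v \<in> V \<Longrightarrow> 0 \<le> u v" "sum u V = 1" and x: "(\<Sum>v\<in>V. u v *\<^sub>R v) \<in> F"
    and v: "v \<in> V" "0 < u v"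
  shows "v \<in> F"
proof -
  have split: "sum g V = g v + sum g (V - {v})" for g :: "'a \<Rightarrow> 'b::comm_monoid_add"
    using v(1) \<open>finite V\<close> by (simp add: sum.remove)
  have s: "sum u (V - {v}) = 1 - u v"
    using split[of u] u(2) by simp
  have nn: "0 \<le> sum u (V - {v})"
    using u(1) by (intro sum_nonneg) auto
  show ?thesis
  proof (cases "u v = 1")
    case True
    then have "\<forall>w\<in>V - {v}. u w = 0"
      using s u(1) \<open>finite V\<close> sum_nonneg_eq_0_iff[of "V - {v}" u] by auto
    then have "(\<Sum>w\<in>V - {v}. u w *\<^sub>R w) = 0"
      by simp
    then show ?thesis
      using x split[of "\<lambda>w. u w *\<^sub>R w"] True by simp
  next
    case False
    then have lt: "u v < 1"
      using s nn by linarith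
    define y where "y = (\<Sum>w\<in>V - {v}. (u w / (1 - u v)) *\<^sub>R w)"
    have "y \<in> convex hull (V - {v})"
      unfolding y_def using u(1) lt \<open>finite V\<close> s
      by (auto simp: convex_hull_finite simp flip: sum_divide_distrib intro!: exI[of _ "\<lambda>w. u w / (1 - u v)"])
    then have y: "y \<in> convex hull V"
      using hull_mono[of "V - {v}" V convex] by auto
    have "(1 - u v) *\<^sub>R y = (\<Sum>w\<in>V - {v}. u w *\<^sub>R w)"
      unfolding y_def scaleR_sum_right using lt by (intro sum.cong) auto
    then have eq: "(\<Sum>v\<in>V. u v *\<^sub>R v) = (1 - u v) *\<^sub>R y + u v *\<^sub>R v"
      using split[of "\<lambda>w. u w *\<^sub>R w"] by simp
    show ?thesis
    proof (cases "y = v")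
      case True
      then show ?thesis using x eq by (simp flip: scaleR_add_left)
    next
      case False
      then have "(\<Sum>v\<in>V. u v *\<^sub>R v) \<in> open_segment y v"
        using eq v(2) lt by (auto simp: in_segment intro!: exI[of _ "u v"])
      then show ?thesis
        using face_ofD[OF F _ y _ x] hull_inc[of v V convex] v(1) by auto
    qed
  qed
qed

lemma face_of_convex_hull_finite_eq:
  fixes V :: "'a::real_vector set"
  assumes F: "F face_of convex hull V" and "finite V"
  shows "F = convex hull (F \<inter> V)"
proof
  show "convex hull (F \<inter> V) \<subseteq> F"
    using face_of_imp_convex[OF F] by (intro hull_minimal) auto
  show "F \<subseteq> convex hull (F \<inter> V)"
  proof
    fix x assume "x \<in> F"
    then have "x \<in> convex hull V"
      using face_of_imp_subset[OF F] by auto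
    then obtain u where u: "\<And>v. v \<in> V \<Longrightarrow> 0 \<le> u v" "sum u V = 1" "(\<Sum>v\<in>V. u v *\<^sub>R v) = x"
      by (auto simp: convex_hull_finite[OF \<open>finite V\<close>])
    have zero: "u v = 0" if "v \<in> V - F" for v
      using face_of_convex_combination[OF F \<open>finite V\<close> u(1,2), of v] u(1)[of v] u(3) that \<open>x \<in> F\<close>
      by force
    have "sum u (F \<inter> V) = 1"
      using u(2) zero \<open>finite V\<close> by (subst sum.mono_neutral_left[of V]) auto
    moreover have "(\<Sum>v\<in>F \<inter> V. u v *\<^sub>R v) = x"
      unfolding u(3)[symmetric] using zero \<open>finite V\<close> by (intro sum.mono_neutral_left) auto
    ultimately show "x \<in> convex hull (F \<inter> V)"
      using u(1) \<open>finite V\<close> by (auto simp: convex_hull_finite intro!: exI[of _ u])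
  qed
qed

section \<open>The graph of a 0/1-polytope in terms of set families\<close>

definition ind :: "nat set \<Rightarrow> (nat \<Rightarrow>\<^sub>0 real)" where
  "ind S = (\<Sum>i\<in>S. Poly_Mapping.single i 1)"

lemma lookup_ind: "finite S \<Longrightarrow> Poly_Mapping.lookup (ind S) i = (if i \<in> S then 1 else 0)"
  by (simp add: ind_def lookup_sum lookup_single when_def sum.delta)

lemma lookup_scaleR: "Poly_Mapping.lookup (a *\<^sub>R x) i = a * Poly_Mapping.lookup (x :: 'a \<Rightarrow>\<^sub>0 real) i"
  by (simp add: scaleR_poly_mapping_def Poly_Mapping.map.rep_eq when_def)

lemma inj_on_ind: "inj_on ind (Pow {..<n})"
proof (rule inj_onI)
  fix x y assume "x \<in> Pow {..<n}" "y \<in> Pow {..<n}" and eq: "ind x = ind y"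
  then have "finite x" "finite y"
    by (auto intro: finite_subset)
  then show "x = y"
    using eq by (metis lookup_ind one_neq_zero set_eqI)
qed

lemma cube_eq: "cube n = ind ` Pow {..<n}"
proof
  show "cube n \<subseteq> ind ` Pow {..<n}"
  proof
    fix x assume x: "x \<in> cube n"
    define S where "S = {i. i < n \<and> Poly_Mapping.lookup x i = 1}"
    have [simp]: "finite S"
      by (auto simp: S_def)
    have "Poly_Mapping.lookup x i = Poly_Mapping.lookup (ind S) i" for i
      using x by (cases "i < n") (auto simp: S_def lookup_ind cube_def in_keys_iff)
    then have "x = ind S"
      by (auto intro: poly_mapping_eqI)
    then show "x \<in> ind ` Pow {..<n}"
      by (auto simp: S_def)
  qed
  show "ind ` Pow {..<n} \<subseteq> cube n"
  proof clarify
    fix S assume S: "S \<subseteq> {..<n}"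
    then have "finite S" by (rule finite_subset) auto
    then show "ind S \<in> cube n"
      using S by (auto simp: cube_def in_keys_iff lookup_ind split: if_splits)
  qed
qed

definition wt :: "nat \<Rightarrow> (nat \<Rightarrow> real) \<Rightarrow> (nat \<Rightarrow>\<^sub>0 real) \<Rightarrow> real" where
  "wt n c x = (\<Sum>i<n. c i * Poly_Mapping.lookup x i)"

lemma linear_wt: "linear (wt n c)"
  by (rule linearI) (simp_all add: wt_def lookup_add lookup_scaleR algebra_simps sum.distrib sum_distrib_left)

lemma wt_ind: "S \<subseteq> {..<n} \<Longrightarrow> wt n c (ind S) = sum c S"
proof -
  assume S: "S \<subseteq> {..<n}"
  then have "finite S" by (rule finite_subset) auto
  then have "wt n c (ind S) = (\<Sum>i<n. if i \<in> S then c i else 0)"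
    unfolding wt_def by (intro sum.cong) (auto simp: lookup_ind)
  also have "\<dots> = sum c S"
    using S by (simp add: sum.inter_restrict[symmetric] Int_absorb1)
  finally show ?thesis .
qed

definition cube_edges :: "nat set set \<Rightarrow> nat set set set" where
  "cube_edges H = {e. e \<subseteq> H \<and> ind ` e \<in> polytope_edges (convex hull (ind ` H))}"

locale set_family =
  fixes n :: nat and H :: "nat set set"
  assumes H: "H \<subseteq> Pow {..<n}"
begin

lemma finite_H [simp, intro]: "finite H"
  using H finite_subset by fastforce

lemma inj_H: "inj_on ind H"
  using inj_on_ind H by (rule inj_on_subset)

lemma H_sub: "x \<in> H \<Longrightarrow> x \<subseteq> {..<n}"
  using H by auto

lemma H_finite: "x \<in> H \<Longrightarrow> finite x"
  using H_sub finite_subset by blast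

lemma vertices_eq: "polytope_vertices (convex hull (ind ` H)) = ind ` H"
proof
  show "polytope_vertices (convex hull (ind ` H)) \<subseteq> ind ` H"
  proof
    fix v assume "v \<in> polytope_vertices (convex hull (ind ` H))"
    then have f: "{v} face_of convex hull (ind ` H)"
      by (simp add: polytope_vertices_def)
    from face_of_convex_hull_finite_eq[OF f] show "v \<in> ind ` H"
      by (cases "v \<in> ind ` H") auto
  qed
  show "ind ` H \<subseteq> polytope_vertices (convex hull (ind ` H))"
  proof clarify
    fix S assume S: "S \<in> H"
    \<comment> \<open>The value at \<open>x\<close> is below the value at \<open>S\<close> by the
      number of coordinates in which they differ.\<close>
    define c where "c = (\<lambda>i. if i \<in> S then 1 else (-1::real))"
    have lt: "sum c x < sum c S" if "x \<in> H" "x \<noteq> S" for x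
    proof -
      have [simp]: "finite x" "finite S"
        using that S H_finite by auto
      have "sum c x = sum c (x \<inter> S) + sum c (x - S)"
        by (rule sum.Int_Diff) auto
      moreover have "sum c S = sum c (S \<inter> x) + sum c (S - x)"
        by (rule sum.Int_Diff) auto
      moreover have "sum c (x - S) = - real (card (x - S))" "sum c (S - x) = real (card (S - x))"
        by (simp_all add: c_def)
      moreover have "card (x - S) > 0 \<or> card (S - x) > 0"
        using that by (auto simp: card_gt_0_iff)
      ultimately show ?thesis
        by (auto simp: Int_commute)
    qed
    have wt_H: "wt n c (ind x) = sum c x" if "x \<in> H" for x
      using H_sub[OF that] by (rule wt_ind)
    have le_H: "sum c x \<le> sum c S" if "x \<in> H" for x
      using lt[OF that] by (cases "x = S") auto
    have "wt n c v \<le> sum c S" if "v \<in> ind ` H" for v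
      using that le_H wt_H by auto
    then have "convex hull {v \<in> ind ` H. wt n c v = sum c S} face_of convex hull (ind ` H)"
      by (intro convex_hull_face_of_exposed linear_wt) auto
    moreover have "{v \<in> ind ` H. wt n c v = sum c S} = {ind S}"
    proof -
      have "wt n c (ind x) = sum c S \<longleftrightarrow> x = S" if "x \<in> H" for x
        using lt[OF that] wt_H[OF that] by force
      then show ?thesis
        using S by blast
    qed
    ultimately show "ind S \<in> polytope_vertices (convex hull (ind ` H))"
      by (simp add: polytope_vertices_def)
  qed
qed

lemma cube_edgesI:
  assumes uw: "u \<in> H" "w \<in> H" "u \<noteq> w" and eq: "sum c u = sum c w"
    and lt: "\<And>x. x \<in> H \<Longrightarrow> x \<noteq> u \<Longrightarrow> x \<noteq> w \<Longrightarrow> sum c x < (sum c u :: real)"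
  shows "{u, w} \<in> cube_edges H"
proof -
  let ?F = "convex hull {ind u, ind w}"
  have wt_H: "wt n c (ind x) = sum c x" if "x \<in> H" for x
    using H_sub[OF that] by (rule wt_ind)
  have le_H: "sum c x \<le> sum c u" if "x \<in> H" for x
    using lt[OF that] eq by (cases "x = u \<or> x = w") auto
  have le: "wt n c v \<le> sum c u" if "v \<in> ind ` H" for v
    using that le_H wt_H by auto
  have "wt n c (ind x) = sum c u \<longleftrightarrow> x = u \<or> x = w" if "x \<in> H" for x
    using lt[OF that] wt_H[OF that] eq by force
  then have T: "{v \<in> ind ` H. wt n c v = sum c u} = {ind u, ind w}"
    using uw by blast
  have f: "?F face_of convex hull (ind ` H)"
    using convex_hull_face_of_exposed[of "wt n c" "ind ` H", OF linear_wt _ le] T by simp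
  have "?F = {x \<in> convex hull (ind ` H). wt n c x = sum c u}"
    using convex_hull_Int_hyperplane_eq[of "wt n c" "ind ` H", OF linear_wt _ le] T by simp
  then have "?F \<inter> ind ` H = {ind u, ind w}"
    using T hull_inc[of _ "ind ` H" convex] by auto
  moreover have "has_aff_dim ?F 1"
    unfolding has_aff_dim_def using uw inj_H
    by (intro exI[of _ "{ind u, ind w}"]) (auto simp: inj_on_eq_iff)
  ultimately have "ind ` {u, w} \<in> polytope_edges (convex hull (ind ` H))"
    using f unfolding polytope_edges_def vertices_eq by (intro CollectI exI[of _ ?F]) simp
  then show ?thesis
    using uw by (simp add: cube_edges_def)
qed

text \<open>A line contains at most two 0/1 points: some coordinate is injective along it and takes
  only the values 0 and 1. It contains at least two points of \<open>e\<close>, as otherwise the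
  affine hull would be a point.\<close>

lemma polytope_edgesE:
  assumes "e \<in> polytope_edges (convex hull (ind ` H))"
  obtains F u w where "F face_of convex hull (ind ` H)" "F \<inter> ind ` H = e" "e = ind ` {u, w}"
    "u \<in> H" "w \<in> H" "u \<noteq> w"
proof -
  obtain F where F: "F face_of convex hull (ind ` H)" "has_aff_dim F 1" "e = F \<inter> ind ` H"
    using assms by (auto simp: polytope_edges_def vertices_eq)
  have Fe: "F = convex hull e"
    using face_of_convex_hull_finite_eq[OF F(1)] F(3) by simp
  from F(2) obtain B where B: "affine hull B = affine hull F" "card B = 2"
    by (auto simp: has_aff_dim_def)
  then obtain b1 b2 where b: "B = {b1, b2}" "b1 \<noteq> b2"
    by (auto simp: card_2_iff)
  have aff: "affine hull e = affine hull {b1, b2}"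
    using B b Fe by simp
  have in_e: "x \<in> affine hull {b1, b2}" if "x \<in> e" for x
    using that aff hull_inc[of x e affine] by simp
  have b_in: "b1 \<in> affine hull e" "b2 \<in> affine hull e"
    unfolding aff by (auto intro: hull_inc)
  have "e \<noteq> {}"
    using b_in by auto
  then obtain a where a: "a \<in> e" by auto
  have "e \<noteq> {a}"
  proof
    assume "e = {a}"
    moreover have "affine hull {a} = {a}"
      by (rule hull_same) (rule affine_sing)
    ultimately have "affine hull e = {a}"
      by simp
    then show False
      using b_in b(2) by simp
  qed
  then obtain a' where a': "a' \<in> e" "a' \<noteq> a"
    using a by auto
  have "e \<subseteq> {a, a'}"
  proof (rule ccontr)
    assume "\<not> e \<subseteq> {a, a'}"
    then obtain a'' where a'': "a'' \<in> e" "a'' \<noteq> a" "a'' \<noteq> a'"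
      by auto
    have ex: "\<exists>t. x = b1 + t *\<^sub>R (b2 - b1)" if x: "x \<in> e" for x
    proof -
      obtain s t where "s + t = 1" "x = s *\<^sub>R b1 + t *\<^sub>R b2"
        using in_e[OF x] by (auto simp: affine_hull_2)
      then show ?thesis
        by (intro exI[of _ t]) (simp add: algebra_simps flip: scaleR_add_left)
    qed
    then obtain t t' t'' where t: "a = b1 + t *\<^sub>R (b2 - b1)" "a' = b1 + t' *\<^sub>R (b2 - b1)"
       "a'' = b1 + t'' *\<^sub>R (b2 - b1)"
      using a a' a'' by meson
    have ne: "t \<noteq> t'" "t \<noteq> t''" "t' \<noteq> t''"
      using a'(2) a''(2,3) t by auto
    define w where "w = Poly_Mapping.lookup (b2 - b1)"
    have l: "Poly_Mapping.lookup (b1 + s *\<^sub>R (b2 - b1)) i = Poly_Mapping.lookup b1 i + s * w i" for s i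
      by (simp add: lookup_add lookup_scaleR w_def)
    obtain i where i: "Poly_Mapping.lookup a i \<noteq> Poly_Mapping.lookup a' i"
      using a'(2) poly_mapping_eqI by metis
    have wi: "w i \<noteq> 0"
      using i unfolding t l by auto
    have 01: "Poly_Mapping.lookup x i \<in> {0, 1}" if "x \<in> e" for x
      using that F(3) H_finite by (auto simp: lookup_ind)
    have "Poly_Mapping.lookup a i \<noteq> Poly_Mapping.lookup a'' i" "Poly_Mapping.lookup a' i \<noteq> Poly_Mapping.lookup a'' i"
      using ne wi unfolding t l by auto
    then show False
      using 01[OF a] 01[OF a'(1)] 01[OF a''(1)] i by auto
  qed
  then have e: "e = {a, a'}"
    using a a' by auto
  obtain u w where "u \<in> H" "w \<in> H" "a = ind u" "a' = ind w"
    using a a' F(3) by auto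
  then show ?thesis
    using that[of F u w] F e a'(2) by auto
qed

text \<open>These are the facts about edges behind the upper bounds: the exclusion of antipodal
  pairs, and the absence of long edges at a vertex all of whose cube neighbours are in
  \<open>H\<close>. The latter is stated for both ends because \<open>e\<close> is
  unordered.\<close>

lemma cube_edges_obtain_ends:
  assumes "e \<in> cube_edges H"
  obtains u w where "e = {u, w}" "u \<in> H" "w \<in> H" "u \<noteq> w"
    "\<And>S. S \<subseteq> u \<triangle> w \<Longrightarrow> u \<triangle> S \<in> H \<Longrightarrow> w \<triangle> S \<in> H \<Longrightarrow> S = {} \<or> S = u \<triangle> w"
    "(\<And>i. i < n \<Longrightarrow> u \<triangle> {i} \<in> H) \<Longrightarrow> \<exists>i<n. w = u \<triangle> {i}"
    "(\<And>i. i < n \<Longrightarrow> w \<triangle> {i} \<in> H) \<Longrightarrow> \<exists>i<n. u = w \<triangle> {i}"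
proof -
  have e: "e \<subseteq> H" "ind ` e \<in> polytope_edges (convex hull (ind ` H))"
    using assms by (auto simp: cube_edges_def)
  obtain F u w where F: "F face_of convex hull (ind ` H)" "F \<inter> ind ` H = ind ` e" "ind ` e = ind ` {u, w}"
    "u \<in> H" "w \<in> H" "u \<noteq> w"
    using polytope_edgesE[OF e(2)] by metis
  have euw: "e = {u, w}"
    using F e(1) inj_H by (metis empty_subsetI inj_on_image_eq_iff insert_subset)
  have mem: "x = u \<or> x = w" if "x \<in> H" "ind x \<in> F" for x
  proof -
    have "ind x \<in> ind ` {u, w}"
      using that F(2,3) by auto
    then show ?thesis
      using inj_H that F(4,5) by (auto simp: inj_on_eq_iff)
  qed
  have indF: "ind u \<in> F" "ind w \<in> F"
    using F(2,3) by auto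
  have "convex F"
    using F(1) by (rule face_of_imp_convex)
  then have seg: "(1 - t) *\<^sub>R ind u + t *\<^sub>R ind w \<in> F" if "0 \<le> t" "t \<le> 1" for t
    using indF that by (simp add: convexD_alt)
  \<comment> \<open>The pairs \<open>u\<close>, \<open>w\<close> and \<open>u \<triangle> S\<close>,
    \<open>w \<triangle> S\<close> have the same midpoint, which lies in the face.\<close>
  have 1: "S = {} \<or> S = u \<triangle> w" if S: "S \<subseteq> u \<triangle> w" "u \<triangle> S \<in> H" "w \<triangle> S \<in> H" for S
  proof -
    have "Poly_Mapping.lookup (ind (u \<triangle> S) + ind (w \<triangle> S)) i = Poly_Mapping.lookup (ind u + ind w) i" for i
      using S(1) H_finite[OF S(2)] H_finite[OF S(3)] H_finite[OF F(4)] H_finite[OF F(5)]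
      by (auto simp: lookup_add lookup_ind)
    then have "ind (u \<triangle> S) + ind (w \<triangle> S) = ind u + ind w"
      by (rule poly_mapping_eqI)
    then have "(1/2) *\<^sub>R ind u + (1/2) *\<^sub>R ind w = (1 - 1/2) *\<^sub>R ind (u \<triangle> S) + (1/2) *\<^sub>R ind (w \<triangle> S)"
      by (simp flip: scaleR_add_right)
    moreover have "ind (u \<triangle> S) \<noteq> ind (w \<triangle> S)"
      using S inj_H F(6) by (simp add: inj_on_eq_iff)
    ultimately have "(1/2) *\<^sub>R ind u + (1/2) *\<^sub>R ind w \<in> open_segment (ind (u \<triangle> S)) (ind (w \<triangle> S))"
      by (auto simp: in_segment intro!: exI[of _ "1/2"])
    moreover have "(1/2) *\<^sub>R ind u + (1/2) *\<^sub>R ind w \<in> F"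
      using seg[of "1/2"] by simp
    ultimately have "ind (u \<triangle> S) \<in> F"
      using face_ofD[OF F(1)] S(2,3) hull_inc[of _ "ind ` H" convex] by blast
    then have "u \<triangle> S = u \<or> u \<triangle> S = w"
      using mem[of "u \<triangle> S"] S(2) by blast
    then show ?thesis
      by (metis sdiff_self(2) sdiff_eq_self(1))
  qed
  \<comment> \<open>With \<open>D = a \<triangle> b\<close>, going from \<open>a\<close> the
    fraction 1/|D| of the way towards \<open>b\<close> leads to the average of the neighbours of
    \<open>a\<close> in the directions of \<open>D\<close>. This average is in the face, so these
    neighbours are too, and each of them must be \<open>b\<close>.\<close>
  have 2: "\<exists>i<n. b = a \<triangle> {i}" if ab: "a \<in> H" "b \<in> H" "ind a \<in> F" "ind b \<in> F" "a \<noteq> b" "e = {a, b}"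
    and nb: "\<And>i. i < n \<Longrightarrow> a \<triangle> {i} \<in> H" for a b
  proof -
    define D where "D = a \<triangle> b"
    have D: "D \<subseteq> {..<n}" "finite D" "D \<noteq> {}"
      unfolding D_def using ab H_sub H_finite by (simp_all add: sdiff_subset finite_sdiff)
    define T where "T = (\<lambda>i. ind (a \<triangle> {i})) ` D"
    have inj: "inj_on (\<lambda>i. ind (a \<triangle> {i})) D"
      using D nb by (auto intro!: inj_onI simp: inj_on_eq_iff[OF inj_H] subset_iff)
    define g where "g = (\<lambda>v. if v \<in> T then 1 / real (card D) else 0)"
    have T: "T \<subseteq> ind ` H" "card T = card D"
      using D nb card_image[OF inj] by (auto simp: T_def)
    have s: "sum (\<lambda>v. g v *\<^sub>R h v) (ind ` H) = (1 / real (card D)) *\<^sub>R (\<Sum>i\<in>D. h (ind (a \<triangle> {i})))"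
      for h :: "(nat \<Rightarrow>\<^sub>0 real) \<Rightarrow> 'b::real_vector"
    proof -
      have "sum (\<lambda>v. g v *\<^sub>R h v) (ind ` H) = sum (\<lambda>v. g v *\<^sub>R h v) T"
        using T by (intro sum.mono_neutral_right) (auto simp: g_def)
      also have "\<dots> = (\<Sum>i\<in>D. (1 / real (card D)) *\<^sub>R h (ind (a \<triangle> {i})))"
        unfolding T_def by (subst sum.reindex[OF inj]) (auto simp: g_def T_def)
      finally show ?thesis by (simp add: scaleR_sum_right)
    qed
    have g1: "sum g (ind ` H) = 1"
      using s[of "\<lambda>_. 1 :: real"] D by simp
    have fa: "finite a" "finite b"
      using ab H_finite by auto
    have nz: "real (card D) \<noteq> 0"
      using D by simp
    have "Poly_Mapping.lookup (\<Sum>v\<in>ind ` H. g v *\<^sub>R v) k =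
        Poly_Mapping.lookup ((1 - 1 / real (card D)) *\<^sub>R ind a + (1 / real (card D)) *\<^sub>R ind b) k" for k
    proof -
      have fi: "finite (a \<triangle> {i})" for i
        using fa by auto
      have "(\<Sum>i\<in>D. Poly_Mapping.lookup (ind (a \<triangle> {i})) k) =
         (\<Sum>i\<in>D. Poly_Mapping.lookup (ind a) k + (if i = k then (if k \<in> a then -1 else 1) else 0))"
        by (intro sum.cong) (auto simp: lookup_ind fi fa)
      also have "\<dots> = real (card D) * Poly_Mapping.lookup (ind a) k + (if k \<in> D then (if k \<in> a then -1 else 1) else 0)"
        using D by (simp add: sum.distrib)
      finally have "(\<Sum>i\<in>D. Poly_Mapping.lookup (ind (a \<triangle> {i})) k) =
         real (card D) * Poly_Mapping.lookup (ind a) k + (if k \<in> D then (if k \<in> a then -1 else 1) else 0)" .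
      moreover have "Poly_Mapping.lookup (\<Sum>v\<in>ind ` H. g v *\<^sub>R v) k =
          (1 / real (card D)) * (\<Sum>i\<in>D. Poly_Mapping.lookup (ind (a \<triangle> {i})) k)"
        unfolding s[of "\<lambda>v. v"] by (simp only: lookup_scaleR lookup_sum)
      moreover have "k \<in> D \<longleftrightarrow> (k \<in> a) \<noteq> (k \<in> b)"
        by (simp add: D_def)
      ultimately show ?thesis
        using fa nz by (simp add: lookup_scaleR lookup_add lookup_ind)
          (cases "k \<in> a"; cases "k \<in> b"; simp add: field_simps)
    qed
    then have eq: "(\<Sum>v\<in>ind ` H. g v *\<^sub>R v) = (1 - 1 / real (card D)) *\<^sub>R ind a + (1 / real (card D)) *\<^sub>R ind b"
      by (rule poly_mapping_eqI)
    have "1 / real (card D) \<le> 1"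
      using D by (simp add: Suc_le_eq card_gt_0_iff)
    then have inF: "(\<Sum>v\<in>ind ` H. g v *\<^sub>R v) \<in> F"
      unfolding eq using ab by (intro convexD_alt[OF \<open>convex F\<close>]) (simp_all del: One_nat_def)
    obtain i where i: "i \<in> D" using D by auto
    have pos: "0 < g (ind (a \<triangle> {i}))"
      using i D by (auto simp: g_def T_def card_gt_0_iff)
    have "ind (a \<triangle> {i}) \<in> F"
      by (rule face_of_convex_combination[OF F(1) _ _ g1 inF _ pos])
         (use i D nb in \<open>auto simp: g_def\<close>)
    moreover have "i < n"
      using i D(1) by auto
    ultimately have "a \<triangle> {i} \<in> e"
      using mem[of "a \<triangle> {i}"] nb[of i] euw by blast
    then have "a \<triangle> {i} = b"
      using ab(6) by simp
    then show ?thesis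
      using \<open>i < n\<close> by blast
  qed
  show ?thesis
  proof (rule that[OF euw F(4,5,6) 1])
    show "\<exists>i<n. w = u \<triangle> {i}" if "\<And>i. i < n \<Longrightarrow> u \<triangle> {i} \<in> H"
      using 2[OF F(4,5) indF F(6) euw that] .
    show "\<exists>i<n. u = w \<triangle> {i}" if "\<And>i. i < n \<Longrightarrow> w \<triangle> {i} \<in> H"
      using 2[OF F(5,4) indF(2,1) _ _ that] F(6) euw by blast
  qed
qed

lemma polytope_expansion_eq:
  "polytope_expansion (convex hull (ind ` H)) = edge_expansion H (cube_edges H)"
proof -
  let ?E = "polytope_edges (convex hull (ind ` H))"
  have E: "?E = (image ind) ` cube_edges H"
  proof
    show "?E \<subseteq> (image ind) ` cube_edges H"
    proof
      fix e assume e: "e \<in> ?E"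
      then obtain u w where uw: "e = ind ` {u, w}" "u \<in> H" "w \<in> H"
        using polytope_edgesE by metis
      then have "{u, w} \<in> cube_edges H"
        using e by (auto simp: cube_edges_def)
      then show "e \<in> (image ind) ` cube_edges H"
        using uw by blast
    qed
  qed (auto simp: cube_edges_def)
  have bd: "card (edge_boundary ?E (ind ` U)) = card (edge_boundary (cube_edges H) U)" if U: "U \<subseteq> H" for U
  proof -
    have "edge_boundary ?E (ind ` U) = (image ind) ` edge_boundary (cube_edges H) U"
    proof -
      have "card (ind ` e \<inter> ind ` U) = card (e \<inter> U)" if "e \<in> cube_edges H" for e
      proof -
        have "e \<subseteq> H"
          using that by (auto simp: cube_edges_def)
        then have "ind ` e \<inter> ind ` U = ind ` (e \<inter> U)"
          using inj_on_image_Int[OF inj_H] U by simp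
        moreover have "inj_on ind (e \<inter> U)"
          using inj_H U by (meson inj_on_subset le_infI2)
        ultimately show ?thesis
          by (simp add: card_image)
      qed
      then show ?thesis
        unfolding E edge_boundary_def by auto
    qed
    moreover have "inj_on (image ind) (edge_boundary (cube_edges H) U)"
      using inj_on_image_Pow[OF inj_H]
      by (rule inj_on_subset) (auto simp: edge_boundary_def cube_edges_def)
    ultimately show ?thesis
      by (simp add: card_image)
  qed
  have cd: "card (ind ` U) = card U" if "U \<subseteq> H" for U
    using inj_H that by (meson card_image inj_on_subset)
  have "{real (card (edge_boundary ?E U)) / real (card U) | U.
            U \<subseteq> ind ` H \<and> 1 \<le> card U \<and> real (card U) \<le> real (card (ind ` H)) / 2}
     = {real (card (edge_boundary (cube_edges H) U)) / real (card U) | U.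
            U \<subseteq> H \<and> 1 \<le> card U \<and> real (card U) \<le> real (card H) / 2}" (is "?L = ?R")
  proof
    show "?L \<subseteq> ?R"
    proof
      fix y assume "y \<in> ?L"
      then obtain U where "y = real (card (edge_boundary ?E (ind ` U))) / real (card (ind ` U))" "U \<subseteq> H"
         "1 \<le> card (ind ` U)" "real (card (ind ` U)) \<le> real (card (ind ` H)) / 2"
        by (auto simp: subset_image_iff)
      then show "y \<in> ?R"
        using bd cd by auto
    qed
    show "?R \<subseteq> ?L"
    proof
      fix y assume "y \<in> ?R"
      then obtain U where "y = real (card (edge_boundary (cube_edges H) U)) / real (card U)" "U \<subseteq> H"
         "1 \<le> card U" "real (card U) \<le> real (card H) / 2"
        by auto
      then show "y \<in> ?L"
        using bd[of U] cd[of U] cd[of H] by (intro CollectI exI[of _ "ind ` U"]) auto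
    qed
  qed
  then show ?thesis
    by (simp add: polytope_expansion_def edge_expansion_def vertices_eq)
qed

end

section \<open>Edge isoperimetry in the cube\<close>

text \<open>An edge leaving \<open>W\<close> is recorded by its end in \<open>W\<close> and its
  direction, so each such edge occurs exactly once.\<close>

definition cube_cut :: "nat \<Rightarrow> nat set set \<Rightarrow> (nat set \<times> nat) set" where
  "cube_cut n W = {(x, j). x \<in> W \<and> j < n \<and> x \<triangle> {j} \<notin> W}"

lemma finite_cube_cut [intro]: "finite W \<Longrightarrow> finite (cube_cut n W)"
  by (rule finite_subset[of _ "W \<times> {..<n}"]) (auto simp: cube_cut_def)

text \<open>Arithmetic of the induction below: \<open>a\<close> and \<open>b\<close> are the sizes
  of the two halves, \<open>N\<close> is the size of a half cube, \<open>x\<close> and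
  \<open>y\<close> are the cuts inside the halves, and \<open>p\<close> and \<open>q\<close> count
  the cut edges between them.\<close>

lemma min_add_le:
  fixes a b N x y p q t :: nat
  assumes "min a (N - a) \<le> x" "min b (N - b) \<le> y" "a - b \<le> p" "b - a \<le> q" "a \<le> N" "b \<le> N" "x + y + p + q \<le> t"
  shows "min (a + b) (2 * N - (a + b)) \<le> t"
  using assms by linarith

text \<open>Induction on the dimension. The two halves of \<open>W\<close> with respect to the last
  coordinate contribute their own cuts, and every point in exactly one of them contributes an edge
  in the last direction; there are at least as many of these as the sizes differ. Half cubes show
  that the constant 1 is sharp.\<close>

lemma card_cube_cut_ge:
  "W \<subseteq> Pow {..<n} \<Longrightarrow> min (card W) (2 ^ n - card W) \<le> card (cube_cut n W)"
proof (induction n arbitrary: W)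
  case 0
  then have "W = {} \<or> W = {{}}" by auto
  then show ?case by auto
next
  case (Suc n)
  define W0 where "W0 = {x \<in> W. n \<notin> x}"
  define W1 where "W1 = {x. n \<notin> x \<and> insert n x \<in> W}"
  have sub: "W0 \<subseteq> Pow {..<n}" "W1 \<subseteq> Pow {..<n}"
    using Suc.prems by (fastforce simp: W0_def W1_def less_Suc_eq)+
  then have fin: "finite W0" "finite W1"
    by (auto intro: finite_subset[OF _ finite_Pow_iff[THEN iffD2, of "{..<n}"]])
  have n_notin: "n \<notin> x" if "x \<in> W0 \<union> W1" for x
    using that by (auto simp: W0_def W1_def)
  have inj: "inj_on (insert n) W1"
    by (auto simp: inj_on_def W1_def)
  have W: "W = W0 \<union> insert n ` W1"
  proof -
    have "x \<in> insert n ` W1" if "x \<in> W" "n \<in> x" for x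
      using that by (intro image_eqI[of _ _ "x - {n}"]) (auto simp: W1_def insert_absorb)
    then show ?thesis
      by (auto simp: W0_def W1_def)
  qed
  have cW: "card W = card W0 + card W1"
    unfolding W using fin inj by (subst card_Un_disjoint) (auto simp: card_image W0_def)
  define A where "A = cube_cut n W0"
  define B where "B = (\<lambda>(x, j). (insert n x, j)) ` cube_cut n W1"
  define C where "C = (\<lambda>x. (x, n)) ` (W0 - W1)"
  define D where "D = (\<lambda>x. (insert n x, n)) ` (W1 - W0)"
  have nj: "x \<triangle> {n} = insert n x" "insert n x \<triangle> {n} = x" if "n \<notin> x" for x
    using that by (auto simp: sdiff_def)
  have nj': "insert n x \<triangle> {j} = insert n (x \<triangle> {j})" "n \<notin> x \<triangle> {j}" if "n \<notin> x" "j < n" for x j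
    using that by (auto simp: set_eq_iff)
  have mem0: "x \<in> W0 \<longleftrightarrow> x \<in> W" if "n \<notin> x" for x
    using that by (auto simp: W0_def)
  have mem1: "x \<in> W1 \<longleftrightarrow> insert n x \<in> W" if "n \<notin> x" for x
    using that by (auto simp: W1_def)
  have "A \<subseteq> cube_cut (Suc n) W"
  proof clarify
    fix x j assume "(x, j) \<in> A"
    then have x: "x \<in> W0" "j < n" "x \<triangle> {j} \<notin> W0"
      by (simp_all add: A_def cube_cut_def)
    have "n \<notin> x"
      using x(1) n_notin by blast
    then show "(x, j) \<in> cube_cut (Suc n) W"
      using x mem0[of x] mem0[of "x \<triangle> {j}"] nj'(2)[of x j] by (simp add: cube_cut_def)
  qed
  moreover have "B \<subseteq> cube_cut (Suc n) W"
  proof clarify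
    fix y j assume "(y, j) \<in> B"
    then obtain x where x: "y = insert n x" "x \<in> W1" "j < n" "x \<triangle> {j} \<notin> W1"
      by (auto simp only: B_def cube_cut_def)
    have "n \<notin> x"
      using x(2) n_notin by blast
    then show "(y, j) \<in> cube_cut (Suc n) W"
      using x mem1[of x] mem1[of "x \<triangle> {j}"] nj'[of x j] by (simp add: cube_cut_def)
  qed
  moreover have "C \<subseteq> cube_cut (Suc n) W"
  proof clarify
    fix x j assume "(x, j) \<in> C"
    then have x: "j = n" "x \<in> W0" "x \<notin> W1"
      by (auto simp only: C_def)
    have "n \<notin> x"
      using x(2) n_notin by blast
    then show "(x, j) \<in> cube_cut (Suc n) W"
      using x mem0[of x] mem1[of x] nj(1)[of x] by (simp add: cube_cut_def)
  qed
  moreover have "D \<subseteq> cube_cut (Suc n) W"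
  proof clarify
    fix y j assume "(y, j) \<in> D"
    then obtain x where x: "y = insert n x" "j = n" "x \<in> W1" "x \<notin> W0"
      by (auto simp only: D_def)
    have "n \<notin> x"
      using x(3) n_notin by blast
    then show "(y, j) \<in> cube_cut (Suc n) W"
      using x mem0[of x] mem1[of x] nj(2)[of x] by (simp add: cube_cut_def)
  qed
  ultimately have "A \<union> B \<union> (C \<union> D) \<subseteq> cube_cut (Suc n) W"
    by simp
  moreover have "finite W"
    using W fin by simp
  ultimately have "card (A \<union> B \<union> (C \<union> D)) \<le> card (cube_cut (Suc n) W)"
    by (intro card_mono) auto
  moreover have finABCD: "finite A" "finite B" "finite C" "finite D"
    using fin by (auto simp: A_def B_def C_def D_def)
  have "A \<inter> B = {}" "C \<inter> D = {}" "(A \<union> B) \<inter> (C \<union> D) = {}"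
    using n_notin by (auto simp: A_def B_def C_def D_def cube_cut_def)
  then have "card (A \<union> B \<union> (C \<union> D)) = card A + card B + (card C + card D)"
    using finABCD by (simp add: card_Un_disjoint)
  moreover have "card B = card (cube_cut n W1)"
    unfolding B_def by (rule card_image) (use inj in \<open>auto simp: inj_on_def cube_cut_def\<close>)
  moreover have "card C = card (W0 - W1)"
    unfolding C_def by (rule card_image) (auto simp: inj_on_def)
  moreover have "card D = card (W1 - W0)"
    unfolding D_def by (rule card_image) (use inj in \<open>auto simp: inj_on_def\<close>)
  ultimately have ge: "card (cube_cut n W0) + card (cube_cut n W1) + card (W0 - W1) + card (W1 - W0) \<le> card (cube_cut (Suc n) W)"
    by (simp add: A_def)
  have "card W0 - card W1 \<le> card (W0 - W1)" "card W1 - card W0 \<le> card (W1 - W0)"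
    using fin by (simp_all add: diff_card_le_card_Diff)
  moreover have "card W0 \<le> 2 ^ n" "card W1 \<le> 2 ^ n"
    using card_mono[OF _ sub(1)] card_mono[OF _ sub(2)] by (simp_all add: card_Pow)
  ultimately show ?case
    using min_add_le[OF Suc.IH[OF sub(1)] Suc.IH[OF sub(2)] _ _ _ _ ge] unfolding cW by simp
qed

section \<open>Edges of the polytope found in small subcubes\<close>

context set_family
begin

text \<open>Edges can be found inside a subcube at \<open>z\<close>: a heavy penalty for every
  direction outside \<open>Y\<close> leaves only the points of the subcube in competition, and among
  these \<open>u\<close> and \<open>w\<close> use the most directions of \<open>K\<close>.\<close>

lemma cube_edges_subcubeI:
  assumes uw: "u \<in> H" "w \<in> H" "u \<noteq> w" and z: "z \<subseteq> {..<n}" and Y: "u \<triangle> z \<subseteq> Y" "w \<triangle> z \<subseteq> Y"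
    and m: "card ((u \<triangle> z) \<inter> K) = m" "card ((w \<triangle> z) \<inter> K) = m"
    and lt: "\<And>x. x \<in> H \<Longrightarrow> x \<triangle> z \<subseteq> Y \<Longrightarrow> x \<noteq> u \<Longrightarrow> x \<noteq> w \<Longrightarrow> card ((x \<triangle> z) \<inter> K) < m"
  shows "{u, w} \<in> cube_edges H"
proof -
  \<comment> \<open>The reward from \<open>K\<close> is at most \<open>n\<close>, so a single
    direction outside \<open>Y\<close>, at the price n + 1, makes the value negative. Changing signs
    on \<open>z\<close> makes the weight of \<open>x\<close> that of \<open>x \<triangle> z\<close>,
    up to a constant.\<close>
  define g :: "nat \<Rightarrow> real" where "g i = (if i \<in> K then 1 else 0) - (if i \<in> Y then 0 else real n + 1)" for i
  define c where "c i = (if i \<in> z then - g i else g i)" for i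
  have fz: "finite z"
    using z finite_subset by blast
  have sum_c: "sum c x = sum g (x \<triangle> z) - sum g z" if x: "x \<in> H" for x
  proof -
    have fx: "finite x"
      using x by (rule H_finite)
    have "sum c x = sum c (x \<inter> z) + sum c (x - z)"
      by (rule sum.Int_Diff[OF fx])
    moreover have "sum c (x \<inter> z) = - sum g (x \<inter> z)"
      by (simp add: c_def sum_negf)
    moreover have "sum c (x - z) = sum g (x - z)"
      by (simp add: c_def)
    moreover have "sum g z = sum g (z \<inter> x) + sum g (z - x)"
      by (rule sum.Int_Diff[OF fz])
    moreover have "sum g (x \<triangle> z) = sum g (x - z) + sum g (z - x)"
      unfolding sdiff_def using fx fz by (intro sum.union_disjoint) auto
    ultimately show ?thesis
      by (simp add: Int_commute)
  qed
  have g_eq: "sum g X = real (card (X \<inter> K)) - (real n + 1) * real (card (X - Y))" if "finite X" for X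
  proof -
    have "sum g X = (\<Sum>i\<in>X. if i \<in> K then 1 else 0) - (\<Sum>i\<in>X. if i \<in> Y then 0 else real n + 1)"
      by (simp add: g_def sum_subtractf)
    also have "(\<Sum>i\<in>X. if i \<in> K then 1 else 0) = real (card (X \<inter> K))"
      using that by (simp add: sum.If_cases)
    also have "(\<Sum>i\<in>X. if i \<in> Y then 0 else real n + 1) = (real n + 1) * real (card (X - Y))"
      using that by (simp add: sum.If_cases Diff_eq)
    finally show ?thesis .
  qed
  have fin: "finite (x \<triangle> z)" if "x \<in> H" for x
    using H_finite[OF that] fz by auto
  have eqs: "sum g (u \<triangle> z) = real m" "sum g (w \<triangle> z) = real m"
    using Y m uw fin by (simp_all add: g_eq Diff_eq_empty_iff[THEN iffD2])
  show ?thesis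
  proof (rule cube_edgesI[OF uw, of c])
    show "sum c u = sum c w"
      using sum_c[OF uw(1)] sum_c[OF uw(2)] eqs by simp
    fix x assume x: "x \<in> H" "x \<noteq> u" "x \<noteq> w"
    have "sum g (x \<triangle> z) < real m"
    proof (cases "x \<triangle> z \<subseteq> Y")
      case True
      then show ?thesis
        using lt[OF x(1) True x(2,3)] fin[OF x(1)] by (simp add: g_eq Diff_eq_empty_iff[THEN iffD2])
    next
      case False
      have "x \<triangle> z \<subseteq> {..<n}"
        using x(1) z H_sub by (intro sdiff_subset) auto
      then have "real (card ((x \<triangle> z) \<inter> K)) \<le> real n"
        using card_mono[of "{..<n}" "(x \<triangle> z) \<inter> K"] by auto
      moreover have "1 \<le> card (x \<triangle> z - Y)"
        using False fin[OF x(1)] by (simp add: Suc_le_eq card_gt_0_iff)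
      then have "(real n + 1) * 1 \<le> (real n + 1) * real (card (x \<triangle> z - Y))"
        by (intro mult_left_mono) auto
      then have "real n < (real n + 1) * real (card (x \<triangle> z - Y))"
        by (simp only: mult_1_right)
      ultimately have "real (card ((x \<triangle> z) \<inter> K)) < (real n + 1) * real (card (x \<triangle> z - Y))"
        by (rule le_less_trans)
      then have "sum g (x \<triangle> z) < 0"
        using g_eq[OF fin[OF x(1)]] by simp
      then show ?thesis by simp
    qed
    then show "sum c x < sum c u"
      using sum_c[OF x(1)] sum_c[OF uw(1)] eqs by simp
  qed
qed

text \<open>With \<open>K\<close> empty all values inside the subcube are 0, so the subcube spanned
  by \<open>u\<close> and \<open>w\<close> may contain no further point of \<open>H\<close>.\<close>

lemma cube_edges_emptyI:
  assumes uw: "u \<in> H" "w \<in> H" "u \<noteq> w"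
    and "\<And>x. x \<in> H \<Longrightarrow> x \<triangle> u \<subseteq> w \<triangle> u \<Longrightarrow> x = u \<or> x = w"
  shows "{u, w} \<in> cube_edges H"
  by (rule cube_edges_subcubeI[OF uw H_sub[OF uw(1)], of "w \<triangle> u" "{}" 0]) (use assms(4) in auto)

lemma cube_edges_neighbor:
  assumes "u \<in> H" "u \<triangle> {i} \<in> H"
  shows "{u, u \<triangle> {i}} \<in> cube_edges H"
proof (rule cube_edges_emptyI)
  fix x assume "x \<triangle> u \<subseteq> u \<triangle> {i} \<triangle> u"
  then have "x \<triangle> u = {} \<or> x \<triangle> u = {i}"
    by auto
  then show "x = u \<or> x = u \<triangle> {i}"
    using sdiff_eqD by fastforce
qed (use assms in auto)

end

text \<open>
  Prescribing the family only at points \<open>z \<triangle> (J \<union> D)\<close> with at least two elements in \<open>J\<close> keeps the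
  conditions independent of the neighbours of \<open>z\<close>, and makes them independent for sets \<open>K\<close>
  sharing at most one element.
\<close>

definition shell :: "nat set \<Rightarrow> nat set \<Rightarrow> nat set \<Rightarrow> nat set set" where
  "shell z \<Delta> K = {z \<triangle> (J \<union> D) | J D. J \<subseteq> K \<and> 2 \<le> card J \<and> D \<subseteq> \<Delta>}"

definition pattern :: "nat set set \<Rightarrow> nat set \<Rightarrow> nat set \<Rightarrow> nat set \<Rightarrow> nat set \<Rightarrow> bool" where
  "pattern H z \<Delta> K1 K2 \<longleftrightarrow> H \<inter> shell z \<Delta> (K1 \<union> K2) = {z \<triangle> K1, z \<triangle> (K2 \<union> \<Delta>)}"

definition patterns ::
  "nat set set \<Rightarrow> nat \<Rightarrow> nat set \<Rightarrow> nat set \<Rightarrow> nat set \<Rightarrow> nat set \<Rightarrow> (nat set \<times> nat set) set" where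
  "patterns H d z \<Delta> X1 X2 = {(K1, K2). K1 \<subseteq> X1 \<and> K2 \<subseteq> X2 \<and> card K1 = d \<and> card K2 = d \<and>
     K1 \<inter> K2 = {} \<and> pattern H z \<Delta> K1 K2}"

text \<open>Seen from the opposite corner, \<open>D\<close> becomes its complement in
  \<open>\<Delta>\<close> while \<open>J\<close> stays.\<close>

lemma shell_opposite: "shell (z \<triangle> \<Delta>) \<Delta> K \<subseteq> shell z \<Delta> K" if "K \<inter> \<Delta> = {}"
proof
  fix x assume "x \<in> shell (z \<triangle> \<Delta>) \<Delta> K"
  then obtain J D where "x = z \<triangle> \<Delta> \<triangle> (J \<union> D)" "J \<subseteq> K" "2 \<le> card J" "D \<subseteq> \<Delta>"
    by (auto simp: shell_def)
  moreover from this have "x = z \<triangle> (J \<union> (\<Delta> - D))"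
    using that by (auto simp: set_eq_iff)
  ultimately show "x \<in> shell z \<Delta> K"
    unfolding shell_def by blast
qed

text \<open>The two ends can exchange roles, so whatever is shown for the first edge of a path also
  gives the last one.\<close>

lemma pattern_opposite:
  assumes "pattern H z \<Delta> K1 K2" "(K1 \<union> K2) \<inter> \<Delta> = {}"
  shows "pattern H (z \<triangle> \<Delta>) \<Delta> K2 K1"
proof -
  have "shell (z \<triangle> \<Delta>) \<Delta> (K1 \<union> K2) = shell z \<Delta> (K1 \<union> K2)"
    using shell_opposite[of "K1 \<union> K2" \<Delta> z] shell_opposite[of "K1 \<union> K2" \<Delta> "z \<triangle> \<Delta>"] assms(2) by simp
  moreover have "z \<triangle> \<Delta> \<triangle> K2 = z \<triangle> (K2 \<union> \<Delta>)" "z \<triangle> \<Delta> \<triangle> (K1 \<union> \<Delta>) = z \<triangle> K1"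
    using assms(2) by (auto simp: set_eq_iff)
  ultimately show ?thesis
    using assms(1) by (simp add: pattern_def Un_commute insert_commute)
qed

lemma pattern_memD:
  assumes "pattern H z \<Delta> K1 K2" "x \<in> H" "x \<triangle> z \<subseteq> K1 \<union> K2 \<union> \<Delta>" "2 \<le> card ((x \<triangle> z) \<inter> (K1 \<union> K2))"
  shows "x = z \<triangle> K1 \<or> x = z \<triangle> (K2 \<union> \<Delta>)"
proof -
  have "x = z \<triangle> (((x \<triangle> z) \<inter> (K1 \<union> K2)) \<union> ((x \<triangle> z) \<inter> \<Delta>))"
    using assms(3) by (auto simp: set_eq_iff subset_iff)
  then have "x \<in> shell z \<Delta> (K1 \<union> K2)"
    unfolding shell_def using assms(4) by blast
  then show ?thesis
    using assms(1,2) by (auto simp: pattern_def)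
qed

locale pattern_at = set_family +
  fixes d z \<Delta> K1 K2
  assumes pattern: "pattern H z \<Delta> K1 K2"
    and z: "z \<subseteq> {..<n}" and \<Delta>: "\<Delta> \<subseteq> {..<n}" and K: "K1 \<subseteq> {..<n}" "K2 \<subseteq> {..<n}"
    and disj: "K1 \<inter> K2 = {}" "K1 \<inter> \<Delta> = {}" "K2 \<inter> \<Delta> = {}"
    and cardK: "card K1 = d" "card K2 = d" and d: "2 \<le> d"
begin

lemma finK: "finite K1" "finite K2"
  using K finite_subset by blast+

lemma ends_in: "z \<triangle> K1 \<in> H" "z \<triangle> (K2 \<union> \<Delta>) \<in> H"
  using pattern by (auto simp: pattern_def)

lemma neK: "K1 \<noteq> {}" "K2 \<noteq> {}"
  using cardK d by auto

text \<open>Maximise the number of directions of \<open>K1 \<union> K2\<close>: the two ends use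
  \<open>d \<ge> 2\<close> of them, every other point of \<open>H\<close> in the subcube at most
  one, because the pattern controls all points with two or more.\<close>

lemma middle_edge: "{z \<triangle> K1, z \<triangle> (K2 \<union> \<Delta>)} \<in> cube_edges H"
proof (rule cube_edges_subcubeI[OF ends_in _ z, of "K1 \<union> K2 \<union> \<Delta>" "K1 \<union> K2" d])
  show "z \<triangle> K1 \<noteq> z \<triangle> (K2 \<union> \<Delta>)"
    using disj neK by (simp add: sdiff_cancel) blast
  show "card ((z \<triangle> K1 \<triangle> z) \<inter> (K1 \<union> K2)) = d"
    using cardK by (simp add: Int_absorb2)
  have "(K2 \<union> \<Delta>) \<inter> (K1 \<union> K2) = K2"
    using disj by auto
  then show "card ((z \<triangle> (K2 \<union> \<Delta>) \<triangle> z) \<inter> (K1 \<union> K2)) = d"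
    using cardK by simp
  fix x assume "x \<in> H" "x \<triangle> z \<subseteq> K1 \<union> K2 \<union> \<Delta>" "x \<noteq> z \<triangle> K1" "x \<noteq> z \<triangle> (K2 \<union> \<Delta>)"
  then have "\<not> 2 \<le> card ((x \<triangle> z) \<inter> (K1 \<union> K2))"
    using pattern_memD[OF pattern] by blast
  then show "card ((x \<triangle> z) \<inter> (K1 \<union> K2)) < d"
    using d by simp
qed auto

lemma in_subcube:
  assumes x: "x \<in> H" "x \<triangle> z \<subseteq> K1" "2 \<le> card (x \<triangle> z)"
  shows "x = z \<triangle> K1"
proof -
  have "(x \<triangle> z) \<inter> (K1 \<union> K2) = x \<triangle> z"
    using x(2) by auto
  then have "x = z \<triangle> K1 \<or> x = z \<triangle> (K2 \<union> \<Delta>)"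
    using pattern_memD[OF pattern x(1)] x(2,3) by auto
  moreover have "x \<noteq> z \<triangle> (K2 \<union> \<Delta>)"
    using x(2) neK(2) disj(1) by auto
  ultimately show ?thesis by simp
qed

text \<open>For the case that \<open>z\<close> is in \<open>H\<close> and the directions of
  \<open>K1\<close> lead out of \<open>H\<close>: in the subcube between \<open>z\<close> and
  \<open>z \<triangle> K1\<close> the pattern leaves open only \<open>z\<close> and its
  neighbours.\<close>

lemma base_edge:
  assumes "z \<in> H" "\<And>i. i \<in> K1 \<Longrightarrow> z \<triangle> {i} \<notin> H"
  shows "{z, z \<triangle> K1} \<in> cube_edges H"
proof (rule cube_edges_emptyI)
  fix x assume x: "x \<in> H" "x \<triangle> z \<subseteq> z \<triangle> K1 \<triangle> z"
  then have sub: "x \<triangle> z \<subseteq> K1" by simp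
  then have fin: "finite (x \<triangle> z)"
    using finK finite_subset by blast
  show "x = z \<or> x = z \<triangle> K1"
  proof (cases "2 \<le> card (x \<triangle> z)")
    case True
    then show ?thesis using in_subcube x(1) sub by blast
  next
    case False
    then have "card (x \<triangle> z) = 0 \<or> card (x \<triangle> z) = 1" by linarith
    then show ?thesis
    proof
      assume "card (x \<triangle> z) = 0"
      then show ?thesis using fin by simp
    next
      assume "card (x \<triangle> z) = 1"
      then obtain i where i: "x \<triangle> z = {i}"
        by (auto simp: card_1_singleton_iff)
      then have "x = z \<triangle> {i}"
        by (rule sdiff_eqD)
      then show ?thesis
        using assms(2)[of i] i sub x(1) by auto
    qed
  qed
qed (use assms ends_in neK in auto)

text \<open>For the case that \<open>z\<close> itself may be missing from \<open>H\<close>: the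
  subcube between \<open>z \<triangle> {i}\<close> and \<open>z \<triangle> K1\<close> contains
  neither \<open>z\<close> nor another neighbour of \<open>z\<close>.\<close>

lemma neighbor_edge:
  assumes "i \<in> K1" "z \<triangle> {i} \<in> H"
  shows "{z \<triangle> {i}, z \<triangle> K1} \<in> cube_edges H"
proof (rule cube_edges_emptyI)
  show "z \<triangle> {i} \<noteq> z \<triangle> K1"
    using cardK d by auto
  fix x assume x: "x \<in> H" "x \<triangle> (z \<triangle> {i}) \<subseteq> z \<triangle> K1 \<triangle> (z \<triangle> {i})"
  have sub: "x \<triangle> z \<subseteq> K1" "i \<in> x \<triangle> z"
    using x(2) assms(1) by (auto simp: subset_iff)
  then have fin: "finite (x \<triangle> z)"
    using finK finite_subset by blast
  show "x = z \<triangle> {i} \<or> x = z \<triangle> K1"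
  proof (cases "2 \<le> card (x \<triangle> z)")
    case True
    then show ?thesis using in_subcube x(1) sub by blast
  next
    case False
    moreover have "card (x \<triangle> z) \<noteq> 0"
      using sub(2) fin by auto
    ultimately have "card (x \<triangle> z) = 1"
      by linarith
    then have "x \<triangle> z = {i}"
      using sub(2) by (metis One_nat_def card_1_singletonE singletonD)
    then show ?thesis
      using sdiff_eqD by blast
  qed
qed (use assms ends_in in auto)

lemma opposite: "pattern_at n H d (z \<triangle> \<Delta>) \<Delta> K2 K1"
  using pattern_opposite[OF pattern, unfolded Int_Un_distrib2] z \<Delta> K disj cardK d
  by (intro pattern_at.intro pattern_at_axioms.intro set_family_axioms)
    (simp_all add: sdiff_subset Int_Un_distrib2 Int_commute)

lemma end_eq: "z \<triangle> (K2 \<union> \<Delta>) = z \<triangle> \<Delta> \<triangle> K2"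
proof -
  have "K2 \<union> \<Delta> = \<Delta> \<triangle> K2"
    using disj(3) unfolding sdiff_def by blast
  then show ?thesis
    by (simp add: sdiff_assoc)
qed

end

section \<open>Counting boundary edges along short paths\<close>

lemma card_le_image: "A \<subseteq> f ` B \<Longrightarrow> finite B \<Longrightarrow> card B \<le> m \<Longrightarrow> card A \<le> m"
  by (meson card_image_le card_mono finite_imageI le_trans)

text \<open>The factor 2 pays for the two orientations of an edge.\<close>

lemma card_edge_fiber_le:
  assumes "finite T" and M: "\<And>w w'. card {t \<in> T. a t = w \<and> b t = w'} \<le> M"
  shows "card {t \<in> T. {a t, b t} = e} \<le> 2 * M"
proof (cases "\<exists>t0 \<in> T. {a t0, b t0} = e")
  case True
  then obtain t0 where e: "e = {a t0, b t0}" by auto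
  have "{t \<in> T. {a t, b t} = e} \<subseteq> {t \<in> T. a t = a t0 \<and> b t = b t0} \<union> {t \<in> T. a t = b t0 \<and> b t = a t0}"
    by (auto simp: e doubleton_eq_iff)
  then have "card {t \<in> T. {a t, b t} = e} \<le> card ({t \<in> T. a t = a t0 \<and> b t = b t0} \<union> {t \<in> T. a t = b t0 \<and> b t = a t0})"
    using \<open>finite T\<close> by (intro card_mono) auto
  also have "\<dots> \<le> card {t \<in> T. a t = a t0 \<and> b t = b t0} + card {t \<in> T. a t = b t0 \<and> b t = a t0}"
    by (rule card_Un_le)
  also have "\<dots> \<le> 2 * M"
    using M[of "a t0" "b t0"] M[of "b t0" "a t0"] by simp
  finally show ?thesis .
next
  case False
  then have "{t \<in> T. {a t, b t} = e} = {}" by auto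
  then show ?thesis by (simp only: card.empty le0)
qed

lemma edge_boundaryI: "{a, b} \<in> E \<Longrightarrow> (a \<in> U) \<noteq> (b \<in> U) \<Longrightarrow> {a, b} \<in> edge_boundary E U"
  by (cases "a \<in> U"; cases "b \<in> U") (auto simp: edge_boundary_def)

text \<open>Each path starts in \<open>U\<close> and ends outside, so one of its three edges is a
  boundary edge. A boundary edge is charged by at most \<open>2 * M1\<close>, \<open>2 * M2\<close>
  and \<open>2 * M3\<close> paths in the three positions.\<close>

lemma card_paths_le:
  assumes "finite T" "finite E"
    and E: "\<And>t. t \<in> T \<Longrightarrow> {a t, b t} \<in> E" "\<And>t. t \<in> T \<Longrightarrow> {b t, c t} \<in> E" "\<And>t. t \<in> T \<Longrightarrow> {c t, d t} \<in> E"
    and U: "\<And>t. t \<in> T \<Longrightarrow> a t \<in> U" "\<And>t. t \<in> T \<Longrightarrow> d t \<notin> U"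
    and M: "\<And>w w'. card {t \<in> T. a t = w \<and> b t = w'} \<le> M1"
      "\<And>w w'. card {t \<in> T. b t = w \<and> c t = w'} \<le> M2" "\<And>w w'. card {t \<in> T. c t = w \<and> d t = w'} \<le> M3"
  shows "card T \<le> 2 * (M1 + M2 + M3) * card (edge_boundary E U)"
proof -
  let ?B = "edge_boundary E U"
  define S where "S e = {t \<in> T. {a t, b t} = e} \<union> {t \<in> T. {b t, c t} = e} \<union> {t \<in> T. {c t, d t} = e}" for e
  have "T \<subseteq> (\<Union>e\<in>?B. S e)"
  proof
    fix t assume t: "t \<in> T"
    consider "b t \<notin> U" | "b t \<in> U" "c t \<notin> U" | "c t \<in> U" by blast
    then show "t \<in> (\<Union>e\<in>?B. S e)"
    proof cases
      case 1
      then have "{a t, b t} \<in> ?B"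
        using t E U by (intro edge_boundaryI) auto
      then show ?thesis using t by (intro UN_I[of "{a t, b t}"]) (auto simp: S_def)
    next
      case 2
      then have "{b t, c t} \<in> ?B"
        using t E U by (intro edge_boundaryI) auto
      then show ?thesis using t by (intro UN_I[of "{b t, c t}"]) (auto simp: S_def)
    next
      case 3
      then have "{c t, d t} \<in> ?B"
        using t E U by (intro edge_boundaryI) auto
      then show ?thesis using t by (intro UN_I[of "{c t, d t}"]) (auto simp: S_def)
    qed
  qed
  moreover have finB: "finite ?B"
    using \<open>finite E\<close> by (auto simp: edge_boundary_def)
  moreover have finS: "finite (S e)" for e
    using \<open>finite T\<close> by (auto simp: S_def)
  ultimately have "card T \<le> card (\<Union>e\<in>?B. S e)"
    by (intro card_mono) auto
  also have "\<dots> \<le> (\<Sum>e\<in>?B. card (S e))"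
    using finB by (rule card_UN_le)
  also have "\<dots> \<le> (\<Sum>e\<in>?B. 2 * (M1 + M2 + M3))"
  proof (rule sum_mono)
    fix e
    have "card (S e) \<le> card {t \<in> T. {a t, b t} = e} + card {t \<in> T. {b t, c t} = e} + card {t \<in> T. {c t, d t} = e}"
      unfolding S_def by (meson add_le_mono card_Un_le le_refl le_trans)
    also have "\<dots> \<le> 2 * M1 + 2 * M2 + 2 * M3"
      using assms(1) M by (intro add_mono card_edge_fiber_le) auto
    finally show "card (S e) \<le> 2 * (M1 + M2 + M3)" by simp
  qed
  also have "\<dots> = 2 * (M1 + M2 + M3) * card ?B"
    by (simp only: sum_constant mult.commute of_nat_id)
  finally show ?thesis .
qed

lemma card_subsets_le_power: "card {K. K \<subseteq> {..<n::nat} \<and> card K = d} \<le> n ^ d"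
proof (cases "d \<le> n")
  case True
  then show ?thesis
    using n_subsets[of "{..<n}" d] binomial_le_pow[OF True] by simp
next
  case False
  then have "{K. K \<subseteq> {..<n::nat} \<and> card K = d} = {}"
    using card_mono[of "{..<n}"] by fastforce
  then show ?thesis by (simp only: card.empty le0)
qed

lemma card_small_subsets_le: "card {S. S \<subseteq> {..<n::nat} \<and> card S \<le> 2} \<le> (n + 1)\<^sup>2"
\<comment> \<open>\<open>n\<close> serves as a dummy element that is removed afterwards, so that the
  pair (n, n) encodes the empty set; singletons come from equal entries.\<close>
proof (rule card_le_image[of _ "\<lambda>(a, b). {a, b} - {n}" "{..n} \<times> {..n}"])
  show "{S. S \<subseteq> {..<n} \<and> card S \<le> 2} \<subseteq> (\<lambda>(a, b). {a, b} - {n}) ` ({..n} \<times> {..n})"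
  proof
    fix S assume "S \<in> {S. S \<subseteq> {..<n} \<and> card S \<le> 2}"
    then have S: "S \<subseteq> {..<n}" "card S \<le> 2" "finite S"
      by (auto intro: finite_subset)
    then consider "card S = 0" | "card S = 1" | "card S = 2" by linarith
    then show "S \<in> (\<lambda>(a, b). {a, b} - {n}) ` ({..n} \<times> {..n})"
    proof cases
      case 1
      then have "S = {}" using S by simp
      then show ?thesis by (intro image_eqI[of _ _ "(n, n)"]) auto
    next
      case 2
      then obtain a where "S = {a}" by (auto simp: card_1_singleton_iff)
      then show ?thesis using S by (intro image_eqI[of _ _ "(a, a)"]) auto
    next
      case 3
      then obtain a b where "S = {a, b}" by (auto simp: card_2_iff)
      then show ?thesis using S by (intro image_eqI[of _ _ "(a, b)"]) auto
    qed
  qed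
qed (auto simp: power2_eq_square)

lemma edge_expansion_le:
  assumes "finite W" "U \<subseteq> W" "1 \<le> card U" "real (card U) \<le> real (card W) / 2"
  shows "edge_expansion W E \<le> real (card (edge_boundary E U)) / real (card U)"
  unfolding edge_expansion_def
proof (rule Min_le)
  show "finite {real (card (edge_boundary E U)) / real (card U) | U.
            U \<subseteq> W \<and> 1 \<le> card U \<and> real (card U) \<le> real (card W) / 2}"
    using assms(1) by (intro finite_subset[OF _ finite_imageI[OF finite_Pow_iff[THEN iffD2, OF assms(1)],
      of "\<lambda>U. real (card (edge_boundary E U)) / real (card U)"]]) auto
qed (use assms in blast)

text \<open>Two vertices make singletons admissible, so the minimum is over a nonempty set.\<close>

lemma edge_expansion_ge:
  assumes "finite W" "2 \<le> card W"
    and "\<And>U. U \<subseteq> W \<Longrightarrow> 1 \<le> card U \<Longrightarrow> 2 * card U \<le> card W \<Longrightarrow> c * real (card U) \<le> real (card (edge_boundary E U))"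
  shows "c \<le> edge_expansion W E"
proof -
  have "finite {real (card (edge_boundary E U)) / real (card U) | U.
            U \<subseteq> W \<and> 1 \<le> card U \<and> real (card U) \<le> real (card W) / 2}" (is "finite ?S")
    using assms(1) by (intro finite_subset[OF _ finite_imageI[OF finite_Pow_iff[THEN iffD2, OF assms(1)],
      of "\<lambda>U. real (card (edge_boundary E U)) / real (card U)"]]) auto
  moreover have "?S \<noteq> {}"
  proof -
    obtain x where "x \<in> W"
      using assms(2) by fastforce
    then have "real (card (edge_boundary E {x})) / real (card {x}) \<in> ?S"
      using assms(2) by (intro CollectI exI[of _ "{x}"]) auto
    then show ?thesis by blast
  qed
  moreover have "c \<le> y" if y: "y \<in> ?S" for y
  proof -
    obtain U where U: "y = real (card (edge_boundary E U)) / real (card U)" "U \<subseteq> W" "1 \<le> card U"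
       "real (card U) \<le> real (card W) / 2"
      using y by blast
    have "2 * card U \<le> card W"
      using U(4) by linarith
    then show ?thesis
      using assms(3)[OF U(2,3)] U(1,3) by (simp add: pos_le_divide_eq)
  qed
  ultimately show ?thesis
    unfolding edge_expansion_def by (simp add: Min_ge_iff)
qed

section \<open>From cut edges of the cube to boundary edges of the polytope\<close>

lemma mem_patterns:
  assumes "(K1, K2) \<in> patterns H d z \<Delta> X1 X2"
  shows "K1 \<subseteq> X1" "K2 \<subseteq> X2" "card K1 = d" "card K2 = d" "K1 \<inter> K2 = {}" "pattern H z \<Delta> K1 K2"
  using assms by (simp_all add: patterns_def)

lemma finite_patterns:
  assumes "X1 \<subseteq> {..<n}" "X2 \<subseteq> {..<n}"
  shows "finite (patterns H d z \<Delta> X1 X2)"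
  by (rule finite_subset[of _ "Pow {..<n} \<times> Pow {..<n}"]) (use assms in \<open>auto simp: patterns_def\<close>)

context set_family
begin

lemma finite_cube_edges [simp, intro]: "finite (cube_edges H)"
  by (rule finite_subset[of _ "Pow H"]) (auto simp: cube_edges_def)

lemma sub_n: "x \<subseteq> {..<n} \<Longrightarrow> j < n \<Longrightarrow> x \<triangle> {j} \<subseteq> {..<n}"
  by (intro sdiff_subset) auto

lemma pattern_atI:
  assumes "(K1, K2) \<in> patterns H d z \<Delta> X1 X2" "z \<subseteq> {..<n}" "\<Delta> \<subseteq> {..<n}"
    "X1 \<subseteq> {..<n} - \<Delta>" "X2 \<subseteq> {..<n} - \<Delta>" "2 \<le> d"
  shows "pattern_at n H d z \<Delta> K1 K2"
proof -
  note P = mem_patterns[OF assms(1)]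
  have "K1 \<subseteq> {..<n}" "K2 \<subseteq> {..<n}" "K1 \<inter> \<Delta> = {}" "K2 \<inter> \<Delta> = {}"
    using P(1,2) assms(4,5) by blast+
  then show ?thesis
    using P assms(2,3,6) by (intro pattern_at.intro pattern_at_axioms.intro set_family_axioms) simp_all
qed

text \<open>\<open>U\<close> is extended to the set \<open>W\<close> of all cube points whose
  representative in \<open>H\<close> lies in \<open>U\<close>. A cut edge of \<open>W\<close> leads
  to two representatives on different sides of \<open>U\<close> at distance at most 2 + 1 + 2 = 5,
  which is the bound on \<open>\<Delta>\<close>, and each of the at least \<open>\<kappa>\<close>
  patterns between them gives a path across the boundary. The coefficient of the boundary counts the
  paths through one edge: a whole \<open>d\<close>-set is free for an outer edge, but only subsets
  of a set of size at most 2d + 5 for the middle one.\<close>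

lemma card_le_boundary_sparse:
  fixes \<kappa> N d :: nat
  assumes U: "U \<subseteq> H" "2 * card U \<le> card H" and d: "2 \<le> d"
    and near: "\<And>x. x \<subseteq> {..<n} \<Longrightarrow> \<exists>y\<in>H. card (x \<triangle> y) \<le> 2"
    and missing: "\<And>x. x \<subseteq> {..<n} \<Longrightarrow> N \<le> card {i. i < n \<and> x \<triangle> {i} \<notin> H}"
    and pat: "\<And>z \<Delta> X1 X2. z \<subseteq> {..<n} \<Longrightarrow> \<Delta> \<subseteq> {..<n} \<Longrightarrow> card \<Delta> \<le> 5 \<Longrightarrow> X1 \<subseteq> {..<n} - \<Delta> \<Longrightarrow>
       X2 \<subseteq> {..<n} - \<Delta> \<Longrightarrow> N \<le> card X1 + 5 \<Longrightarrow> N \<le> card X2 + 5 \<Longrightarrow> \<kappa> \<le> card (patterns H d z \<Delta> X1 X2)"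
  shows "\<kappa> * card U \<le> 2 * (2 * ((n + 1)\<^sup>2 * n * n ^ d) + (n + 1)\<^sup>2 * n * 4 ^ (2 * d + 5)) *
           card (edge_boundary (cube_edges H) U)"
proof -
  \<comment> \<open>Points of \<open>H\<close> represent themselves, so \<open>W\<close> agrees with
    \<open>U\<close> on \<open>H\<close>.\<close>
  define \<pi> where "\<pi> x = (if x \<in> H then x else SOME y. y \<in> H \<and> card (x \<triangle> y) \<le> 2)" for x
  have \<pi>: "\<pi> x \<in> H" "card (x \<triangle> \<pi> x) \<le> 2" if "x \<subseteq> {..<n}" for x
  proof -
    have "(SOME y. y \<in> H \<and> card (x \<triangle> y) \<le> 2) \<in> H \<and> card (x \<triangle> (SOME y. y \<in> H \<and> card (x \<triangle> y) \<le> 2)) \<le> 2"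
      using near[OF that] by (intro someI_ex[of "\<lambda>y. y \<in> H \<and> card (x \<triangle> y) \<le> 2"]) blast
    then show "\<pi> x \<in> H" "card (x \<triangle> \<pi> x) \<le> 2"
      by (simp_all add: \<pi>_def)
  qed
  have \<pi>_H: "\<pi> x = x" if "x \<in> H" for x
    using that by (simp add: \<pi>_def)
  have \<pi>_n: "\<pi> x \<subseteq> {..<n}" if "x \<subseteq> {..<n}" for x
    using \<pi>(1)[OF that] H_sub by blast
  define W where "W = {x. x \<subseteq> {..<n} \<and> \<pi> x \<in> U}"
  have W: "W \<subseteq> Pow {..<n}"
    by (auto simp: W_def)
  have finW: "finite W"
    using W by (rule finite_subset) simp
  have UW: "U \<subseteq> W"
    using U(1) H_sub \<pi>_H by (auto simp: W_def subset_iff)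
  have HW: "H - U \<subseteq> Pow {..<n} - W"
    using H_sub \<pi>_H by (auto simp: W_def)
  have "card U \<le> card W"
    using UW finW by (rule card_mono[rotated])
  moreover have "card U \<le> 2 ^ n - card W"
  proof -
    have "card (H - U) \<le> card (Pow {..<n} - W)"
      using HW by (intro card_mono) auto
    moreover have "card (H - U) = card H - card U"
      using U(1) by (intro card_Diff_subset) (auto intro: finite_subset)
    moreover have "card (Pow {..<n} - W) = 2 ^ n - card W"
      using W finW by (subst card_Diff_subset) (auto simp: card_Pow)
    ultimately show ?thesis
      using U(2) by linarith
  qed
  ultimately have cU: "card U \<le> card (cube_cut n W)"
    using card_cube_cut_ge[OF W] by linarith
  define y where "y x j = \<pi> (x \<triangle> {j})" for x j
  define \<Delta> where "\<Delta> x j = \<pi> x \<triangle> y x j" for x j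
  \<comment> \<open>Directions leading out of \<open>H\<close>, as \<open>base_edge\<close> demands;
    the removal of \<open>\<Delta>\<close> costs at most 5 of them.\<close>
  define X where "X u D = {i. i < n \<and> u \<triangle> {i} \<notin> H} - D" for u D
  define P where "P x j = patterns H d (\<pi> x) (\<Delta> x j) (X (\<pi> x) (\<Delta> x j)) (X (y x j) (\<Delta> x j))" for x j
  define T where "T = Sigma (cube_cut n W) (\<lambda>(x, j). P x j)"
  have X_sub: "X u D \<subseteq> {..<n} - D" for u D
    by (auto simp: X_def)
  have cutD: "x \<subseteq> {..<n}" "j < n" "\<pi> x \<in> U" "y x j \<in> H - U" "x \<triangle> {j} \<subseteq> {..<n}" "card (x \<triangle> {j} \<triangle> y x j) \<le> 2" if "(x, j) \<in> cube_cut n W" for x j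
  proof -
    show x: "x \<subseteq> {..<n}" "j < n" "\<pi> x \<in> U"
      using that by (auto simp: cube_cut_def W_def)
    show xj: "x \<triangle> {j} \<subseteq> {..<n}"
      using x sub_n by blast
    show "y x j \<in> H - U"
      using that xj \<pi>(1) by (auto simp: cube_cut_def W_def y_def)
    show "card (x \<triangle> {j} \<triangle> y x j) \<le> 2"
      using \<pi>(2)[OF xj] by (simp add: y_def)
  qed
  have \<Delta>_n: "\<Delta> x j \<subseteq> {..<n}" if "(x, j) \<in> cube_cut n W" for x j
    using cutD[OF that] \<pi>_n H_sub unfolding \<Delta>_def by (intro sdiff_subset) auto
  have \<Delta>_card: "card (\<Delta> x j) \<le> 5" if c: "(x, j) \<in> cube_cut n W" for x j
  proof -
    note C = cutD[OF c]
    have "\<Delta> x j \<subseteq> (x \<triangle> \<pi> x) \<union> {j} \<union> (x \<triangle> {j} \<triangle> y x j)"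
      by (auto simp: \<Delta>_def)
    moreover have "finite ((x \<triangle> \<pi> x) \<union> {j} \<union> (x \<triangle> {j} \<triangle> y x j))"
    proof -
      have "(x \<triangle> \<pi> x) \<union> {j} \<union> (x \<triangle> {j} \<triangle> y x j) \<subseteq> {..<n}"
        using C \<pi>_n H_sub by (intro Un_least sdiff_subset) auto
      then show ?thesis using finite_subset by blast
    qed
    ultimately have "card (\<Delta> x j) \<le> card ((x \<triangle> \<pi> x) \<union> {j} \<union> (x \<triangle> {j} \<triangle> y x j))"
      by (intro card_mono)
    also have "\<dots> \<le> card (x \<triangle> \<pi> x) + card {j} + card (x \<triangle> {j} \<triangle> y x j)"
      by (meson add_le_mono card_Un_le le_refl le_trans)
    also have "\<dots> \<le> 5"
      using C(6) \<pi>(2)[OF C(1)] by simp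
    finally show ?thesis .
  qed
  have X_card: "N \<le> card (X u D) + 5" if "u \<subseteq> {..<n}" "D \<subseteq> {..<n}" "card D \<le> 5" for u D
  proof -
    have "finite D"
      using that(2) finite_subset by blast
    then have "card {i. i < n \<and> u \<triangle> {i} \<notin> H} - card D \<le> card (X u D)"
      unfolding X_def by (rule diff_card_le_card_Diff)
    then show ?thesis
      using missing[OF that(1)] that(3) by linarith
  qed
  have finP: "finite (P x j)" for x j
    unfolding P_def by (rule finite_patterns[of _ n]) (use X_sub in blast)+
  have finT: "finite T"
    unfolding T_def using finW finP by (intro finite_SigmaI) auto
  have "\<kappa> * card (cube_cut n W) = (\<Sum>t\<in>cube_cut n W. \<kappa>)"
    by simp
  also have "\<dots> \<le> (\<Sum>(x, j)\<in>cube_cut n W. card (P x j))"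
  proof (rule sum_mono, clarify)
    fix x j assume c: "(x, j) \<in> cube_cut n W"
    note C = cutD[OF c]
    have "y x j \<subseteq> {..<n}"
      using C(4) H_sub by blast
    then show "\<kappa> \<le> card (P x j)"
      unfolding P_def using \<pi>_n[OF C(1)] \<Delta>_n[OF c] \<Delta>_card[OF c] by (intro pat X_sub X_card)
  qed
  also have "\<dots> = card T"
    unfolding T_def using finW finP by (subst card_SigmaI) (auto intro!: sum.cong)
  finally have cT: "\<kappa> * card (cube_cut n W) \<le> card T" .
  define a where "a t = \<pi> (fst (fst t))" for t :: "(nat set \<times> nat) \<times> nat set \<times> nat set"
  define b where "b t = \<pi> (fst (fst t)) \<triangle> fst (snd t)" for t :: "(nat set \<times> nat) \<times> nat set \<times> nat set"
  define c where "c t = y (fst (fst t)) (snd (fst t)) \<triangle> snd (snd t)" for t :: "(nat set \<times> nat) \<times> nat set \<times> nat set"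
  define e where "e t = y (fst (fst t)) (snd (fst t))" for t :: "(nat set \<times> nat) \<times> nat set \<times> nat set"
  let ?S = "{S. S \<subseteq> {..<n} \<and> card S \<le> 2}" and ?K = "{K. K \<subseteq> {..<n} \<and> card K = d}"
  have TE: "\<exists>x j K1 K2. t = ((x, j), (K1, K2)) \<and> (x, j) \<in> cube_cut n W \<and> pattern_at n H d (\<pi> x) (\<Delta> x j) K1 K2
      \<and> K1 \<subseteq> X (\<pi> x) (\<Delta> x j) \<and> K2 \<subseteq> X (y x j) (\<Delta> x j)" if "t \<in> T" for t
  proof -
    obtain x j K1 K2 where t1: "t = ((x, j), (K1, K2))"
      by (metis surj_pair)
    then have t: "t = ((x, j), (K1, K2))" "(x, j) \<in> cube_cut n W" "(K1, K2) \<in> P x j"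
      using that unfolding T_def by simp_all
    have "pattern_at n H d (\<pi> x) (\<Delta> x j) K1 K2"
      using pattern_atI[OF t(3)[unfolded P_def] \<pi>_n[OF cutD(1)[OF t(2)]] \<Delta>_n[OF t(2)] X_sub X_sub d] .
    then show ?thesis
      using t mem_patterns(1,2)[OF t(3)[unfolded P_def]] by blast
  qed
  have "card T \<le> 2 * ((n + 1)\<^sup>2 * n * n ^ d + (n + 1)\<^sup>2 * n * 4 ^ (2 * d + 5) + (n + 1)\<^sup>2 * n * n ^ d) *
      card (edge_boundary (cube_edges H) U)"
  proof (rule card_paths_le[OF finT finite_cube_edges, of a b c e])
    fix t assume "t \<in> T"
    then obtain x j K1 K2 where t: "t = ((x, j), (K1, K2))" "(x, j) \<in> cube_cut n W"
      "pattern_at n H d (\<pi> x) (\<Delta> x j) K1 K2" "K1 \<subseteq> X (\<pi> x) (\<Delta> x j)" "K2 \<subseteq> X (y x j) (\<Delta> x j)"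
      using TE[of t] by blast
    interpret pattern_at n H d "\<pi> x" "\<Delta> x j" K1 K2 by fact
    interpret o: pattern_at n H d "\<pi> x \<triangle> \<Delta> x j" "\<Delta> x j" K2 K1 by (rule opposite)
    note C = cutD[OF t(2)]
    have yeq: "\<pi> x \<triangle> \<Delta> x j = y x j"
      by (simp add: \<Delta>_def)
    show "{a t, b t} \<in> cube_edges H"
      unfolding a_def b_def t using t(4) \<pi>(1)[OF C(1)] base_edge by (simp add: X_def subset_iff)
    show "{b t, c t} \<in> cube_edges H"
      unfolding c_def b_def t using middle_edge by (simp add: end_eq yeq)
    show "{c t, e t} \<in> cube_edges H"
      unfolding c_def e_def t using t(5) C(4) o.base_edge by (simp add: X_def subset_iff yeq insert_commute)
    show "a t \<in> U" "e t \<notin> U"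
      using C by (simp_all add: a_def e_def t)
  next
    fix w w'
    \<comment> \<open>The edge yields \<open>\<pi> x\<close> and \<open>K1\<close>; free are the
      displacement \<open>x \<triangle> \<pi> x\<close> of at most two elements, the direction
      \<open>j\<close> and the set \<open>K2\<close>.\<close>
    show "card {t \<in> T. a t = w \<and> b t = w'} \<le> (n + 1)\<^sup>2 * n * n ^ d"
    proof (rule card_le_image[of _ "\<lambda>(S, j, K2). ((w \<triangle> S, j), (w \<triangle> w', K2))" "?S \<times> {..<n} \<times> ?K"])
      show "{t \<in> T. a t = w \<and> b t = w'} \<subseteq> (\<lambda>(S, j, K2). ((w \<triangle> S, j), (w \<triangle> w', K2))) ` (?S \<times> {..<n} \<times> ?K)"
      proof clarify
        fix t assume "t \<in> T" "w = a t" "w' = b t"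
        then obtain x j K1 K2 where t: "t = ((x, j), (K1, K2))" "(x, j) \<in> cube_cut n W"
          "pattern_at n H d (\<pi> x) (\<Delta> x j) K1 K2"
          using TE[of t] by blast
        interpret pattern_at n H d "\<pi> x" "\<Delta> x j" K1 K2 by fact
        note C = cutD[OF t(2)]
        have "x \<triangle> \<pi> x \<subseteq> {..<n}"
          using C(1) \<pi>_n by (intro sdiff_subset) auto
        then show "t \<in> (\<lambda>(S, j, K2). ((a t \<triangle> S, j), (a t \<triangle> b t, K2))) ` (?S \<times> {..<n} \<times> ?K)"
          using t C \<pi>(2)[OF C(1)] K cardK unfolding a_def b_def
          by (intro image_eqI[of _ _ "(x \<triangle> \<pi> x, j, K2)"]) auto
      qed
      show "card (?S \<times> {..<n} \<times> ?K) \<le> (n + 1)\<^sup>2 * n * n ^ d"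
        using card_small_subsets_le[of n] card_subsets_le_power[of n d]
        by (simp add: card_cartesian_product mult.assoc mult_le_mono)
    qed auto
    show "card {t \<in> T. c t = w \<and> e t = w'} \<le> (n + 1)\<^sup>2 * n * n ^ d"
    proof (rule card_le_image[of _ "\<lambda>(S, j, K1). ((w' \<triangle> S \<triangle> {j}, j), (K1, w \<triangle> w'))" "?S \<times> {..<n} \<times> ?K"])
      show "{t \<in> T. c t = w \<and> e t = w'} \<subseteq> (\<lambda>(S, j, K1). ((w' \<triangle> S \<triangle> {j}, j), (K1, w \<triangle> w'))) ` (?S \<times> {..<n} \<times> ?K)"
      proof clarify
        fix t assume "t \<in> T" "w = c t" "w' = e t"
        then obtain x j K1 K2 where t: "t = ((x, j), (K1, K2))" "(x, j) \<in> cube_cut n W"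
          "pattern_at n H d (\<pi> x) (\<Delta> x j) K1 K2"
          using TE[of t] by blast
        interpret pattern_at n H d "\<pi> x" "\<Delta> x j" K1 K2 by fact
        note C = cutD[OF t(2)]
        have "x \<triangle> {j} \<triangle> y x j \<subseteq> {..<n}"
          using C H_sub by (intro sdiff_subset) auto
        then show "t \<in> (\<lambda>(S, j, K1). ((e t \<triangle> S \<triangle> {j}, j), (K1, c t \<triangle> e t))) ` (?S \<times> {..<n} \<times> ?K)"
          using t C K cardK unfolding c_def e_def
          by (intro image_eqI[of _ _ "(x \<triangle> {j} \<triangle> y x j, j, K1)"]) auto
      qed
      show "card (?S \<times> {..<n} \<times> ?K) \<le> (n + 1)\<^sup>2 * n * n ^ d"
        using card_small_subsets_le[of n] card_subsets_le_power[of n d]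
        by (simp add: card_cartesian_product mult.assoc mult_le_mono)
    qed auto
    \<comment> \<open>For a middle edge \<open>w \<triangle> w'\<close> equals
      \<open>K1 \<union> K2 \<union> \<Delta> x j\<close>, so \<open>K1\<close> and
      \<open>K2\<close> are among its at most 2^(2d + 5) subsets. A larger
      \<open>w \<triangle> w'\<close> belongs to no path.\<close>
    show "card {t \<in> T. b t = w \<and> c t = w'} \<le> (n + 1)\<^sup>2 * n * 4 ^ (2 * d + 5)"
    proof (cases "finite (w \<triangle> w') \<and> card (w \<triangle> w') \<le> 2 * d + 5")
      case True
      show ?thesis
      proof (rule card_le_image[of _ "\<lambda>(S, j, K1, K2). ((w \<triangle> K1 \<triangle> S, j), (K1, K2))" "?S \<times> {..<n} \<times> Pow (w \<triangle> w') \<times> Pow (w \<triangle> w')"])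
        show "{t \<in> T. b t = w \<and> c t = w'} \<subseteq>
          (\<lambda>(S, j, K1, K2). ((w \<triangle> K1 \<triangle> S, j), (K1, K2))) ` (?S \<times> {..<n} \<times> Pow (w \<triangle> w') \<times> Pow (w \<triangle> w'))"
        proof clarify
          fix t assume "t \<in> T" "w = b t" "w' = c t"
          then obtain x j K1 K2 where t: "t = ((x, j), (K1, K2))" "(x, j) \<in> cube_cut n W"
            "pattern_at n H d (\<pi> x) (\<Delta> x j) K1 K2"
            using TE[of t] by blast
          interpret pattern_at n H d "\<pi> x" "\<Delta> x j" K1 K2 by fact
          note C = cutD[OF t(2)]
          have bc: "b t \<triangle> c t = K1 \<union> K2 \<union> \<Delta> x j"
            unfolding b_def c_def t using disj unfolding \<Delta>_def by (auto simp: set_eq_iff)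
          have "x \<triangle> \<pi> x \<subseteq> {..<n}"
            using C(1) \<pi>_n by (intro sdiff_subset) auto
          moreover have "b t \<triangle> K1 \<triangle> (x \<triangle> \<pi> x) = x"
            by (simp add: b_def t)
          ultimately show "t \<in> (\<lambda>(S, j, K1, K2). ((b t \<triangle> K1 \<triangle> S, j), (K1, K2))) `
              (?S \<times> {..<n} \<times> Pow (b t \<triangle> c t) \<times> Pow (b t \<triangle> c t))"
            using t(1) C \<pi>(2)[OF C(1)] unfolding bc
            by (intro image_eqI[of _ _ "(x \<triangle> \<pi> x, j, K1, K2)"]) auto
        qed
        have "(2::nat) ^ card (w \<triangle> w') \<le> 2 ^ (2 * d + 5)"
          using True by (intro power_increasing) auto
        then have "(2::nat) ^ card (w \<triangle> w') * 2 ^ card (w \<triangle> w') \<le> 2 ^ (2 * d + 5) * 2 ^ (2 * d + 5)"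
          by (intro mult_le_mono)
        also have "\<dots> = 4 ^ (2 * d + 5)"
          by (simp flip: power_mult_distrib)
        finally show "card (?S \<times> {..<n} \<times> Pow (w \<triangle> w') \<times> Pow (w \<triangle> w')) \<le> (n + 1)\<^sup>2 * n * 4 ^ (2 * d + 5)"
          using True card_small_subsets_le[of n]
          by (simp add: card_cartesian_product card_Pow mult.assoc mult_le_mono)
      qed (use True in auto)
    next
      case False
      have "\<not> (b t = w \<and> c t = w')" if tT: "t \<in> T" for t
      proof
        assume bc': "b t = w \<and> c t = w'"
        obtain x j K1 K2 where t: "t = ((x, j), (K1, K2))" "(x, j) \<in> cube_cut n W"
            "pattern_at n H d (\<pi> x) (\<Delta> x j) K1 K2"
          using TE[OF tT] by blast
        interpret pattern_at n H d "\<pi> x" "\<Delta> x j" K1 K2 by fact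
        have "b t \<triangle> c t = K1 \<union> K2 \<union> \<Delta> x j"
          unfolding b_def c_def t using disj unfolding \<Delta>_def by (auto simp: set_eq_iff)
        then have bc: "w \<triangle> w' = K1 \<union> K2 \<union> \<Delta> x j"
          using bc' by simp
        have "card (K1 \<union> K2 \<union> \<Delta> x j) \<le> card K1 + card K2 + card (\<Delta> x j)"
          by (meson add_le_mono card_Un_le le_refl le_trans)
        then have "card (w \<triangle> w') \<le> 2 * d + 5"
          unfolding bc using cardK \<Delta>_card[OF t(2)] by simp
        moreover have "finite (w \<triangle> w')"
          unfolding bc using finK \<Delta> finite_subset by blast
        ultimately show False using False by blast
      qed
      then have "{t \<in> T. b t = w \<and> c t = w'} = {}" by blast
      then show ?thesis by (simp only: card.empty le0)
    qed
  qed
  moreover have "\<kappa> * card U \<le> card T"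
    using cU cT by (meson le_trans mult_le_mono2)
  moreover have "A + B + A = 2 * A + B" for A B :: nat
    by simp
  ultimately show ?thesis
    by (metis le_trans)
qed

text \<open>
  Below, \<open>a\<close> is the number of vertices at which \<open>U\<close> disagrees with the majority of their neighbours, and
  \<open>b\<close> is the edge boundary of the majority set in the cube.
\<close>

lemma card_le_boundary_dense:
  fixes \<kappa> N :: nat
  assumes U: "U \<subseteq> H" "2 * card U \<le> card H"
    and nbs: "\<And>x. x \<subseteq> {..<n} \<Longrightarrow> N \<le> card {i. i < n \<and> x \<triangle> {i} \<in> H}"
    and pat: "\<And>z j X1 X2. z \<subseteq> {..<n} \<Longrightarrow> j < n \<Longrightarrow> X1 \<subseteq> {..<n} - {j} \<Longrightarrow>
       X2 \<subseteq> {..<n} - {j} \<Longrightarrow> N \<le> 2 * (card X1 + 1) \<Longrightarrow> N \<le> 2 * (card X2 + 1) \<Longrightarrow>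
       \<kappa> \<le> card (patterns H 3 z {j} X1 X2)"
  shows "\<exists>a b. card U \<le> a + b \<and> N * a \<le> 4 * card (edge_boundary (cube_edges H) U) \<and>
    \<kappa> * b \<le> 2 * (2 * n ^ 5 + 7 * 4 ^ 7) * card (edge_boundary (cube_edges H) U)"
proof -
  let ?B = "edge_boundary (cube_edges H) U"
  define N1 where "N1 x = {i. i < n \<and> x \<triangle> {i} \<in> U}" for x
  define N0 where "N0 x = {i. i < n \<and> x \<triangle> {i} \<in> H - U}" for x
  have finN: "finite (N1 x)" "finite (N0 x)" for x
    by (auto simp: N1_def N0_def)
  have N_sum: "N \<le> card (N0 x) + card (N1 x)" if "x \<subseteq> {..<n}" for x
  proof -
    have "{i. i < n \<and> x \<triangle> {i} \<in> H} = N0 x \<union> N1 x"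
      using U(1) by (auto simp: N1_def N0_def)
    then show ?thesis
      using nbs[OF that] card_Un_le[of "N0 x" "N1 x"] by simp
  qed
  \<comment> \<open>A vote among the neighbours in \<open>H\<close>. Ties count for
    \<open>W\<close>, so outside \<open>W\<close> the majority is strict.\<close>
  define W where "W = {x. x \<subseteq> {..<n} \<and> card (N0 x) \<le> card (N1 x)}"
  have W: "W \<subseteq> Pow {..<n}"
    by (auto simp: W_def)
  have finW: "finite W"
    using W by (rule finite_subset) simp
  \<comment> \<open>The vertices of \<open>H\<close> at which \<open>U\<close> and the vote
    disagree. Each has at least \<open>N / 2\<close> neighbours in \<open>H\<close> on the other
    side of \<open>U\<close>, and cube edges inside \<open>H\<close> are always edges of the
    polytope.\<close>
  define R where "R = (U - W) \<union> ((H - U) \<inter> W)"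
  have finR: "finite R"
    using U(1) by (auto simp: R_def intro: finite_subset)
  have finU: "finite U"
    using U(1) finite_H finite_subset by blast
  define Nw where "Nw x = (if x \<in> U then N0 x else N1 x)" for x
  define T where "T = Sigma R Nw"
  have finT: "finite T"
    unfolding T_def using finR finN by (intro finite_SigmaI) (auto simp: Nw_def)
  have R_le: "N * card R \<le> 4 * card ?B"
  proof -
    have "N * card R = (\<Sum>x\<in>R. N)" by simp
    also have "\<dots> \<le> (\<Sum>x\<in>R. 2 * card (Nw x))"
    proof (rule sum_mono)
      fix x assume x: "x \<in> R"
      then have "x \<subseteq> {..<n}"
        using U(1) H_sub by (auto simp: R_def)
      then show "N \<le> 2 * card (Nw x)"
        using N_sum[of x] x by (auto simp: R_def W_def Nw_def)
    qed
    also have "\<dots> = 2 * card T"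
      unfolding T_def using finR finN by (subst card_SigmaI) (auto simp: Nw_def sum_distrib_left)
    also have "card T \<le> 2 * card ?B"
    proof -
      define g where "g = (\<lambda>(x, i). {x, x \<triangle> {i}} :: nat set set)"
      have gB: "g t \<in> ?B" if "t \<in> T" for t
      proof -
        obtain x i where t: "t = (x, i)" by (cases t)
        have xi: "x \<in> R" "i \<in> Nw x"
          using that unfolding t T_def by simp_all
        have xH: "x \<in> H"
          using xi(1) U(1) by (auto simp: R_def)
        have "x \<triangle> {i} \<in> H \<and> (x \<in> U) \<noteq> (x \<triangle> {i} \<in> U)"
          using xi(2) U(1) by (auto simp: Nw_def N0_def N1_def split: if_splits)
        then show ?thesis
          unfolding t g_def prod.case using xH by (intro edge_boundaryI cube_edges_neighbor) auto
      qed
      have "T \<subseteq> (\<Union>e\<in>?B. {t \<in> T. g t = e})"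
        using gB by blast
      moreover have finB: "finite ?B"
        by (auto simp: edge_boundary_def)
      ultimately have "card T \<le> card (\<Union>e\<in>?B. {t \<in> T. g t = e})"
        using finT by (intro card_mono) auto
      also have "\<dots> \<le> (\<Sum>e\<in>?B. card {t \<in> T. g t = e})"
        using finB by (rule card_UN_le)
      also have "\<dots> \<le> (\<Sum>e\<in>?B. 2)"
      proof (rule sum_mono)
        fix e
        have "card {t \<in> T. {fst t, fst t \<triangle> {snd t}} = e} \<le> 2 * 1"
        proof (rule card_edge_fiber_le[OF finT])
          fix w w'
          have "{t \<in> T. fst t = w \<and> fst t \<triangle> {snd t} = w'} \<subseteq> {(w, the_elem (w \<triangle> w'))}"
            by auto
          then show "card {t \<in> T. fst t = w \<and> fst t \<triangle> {snd t} = w'} \<le> 1"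
            using card_mono[OF _ \<open>_ \<subseteq> {(w, the_elem (w \<triangle> w'))}\<close>] by simp
        qed
        then show "card {t \<in> T. g t = e} \<le> 2"
          by (simp add: g_def case_prod_beta)
      qed
      also have "\<dots> = 2 * card ?B"
        by simp
      finally show ?thesis .
    qed
    finally show ?thesis by simp
  qed
  have "card U \<le> card W + card R"
  proof -
    have "U \<subseteq> W \<union> R"
      by (auto simp: R_def)
    then have "card U \<le> card (W \<union> R)"
      using finW finR by (intro card_mono) auto
    then show ?thesis
      using card_Un_le[of W R] by linarith
  qed
  moreover have "card U \<le> (2 ^ n - card W) + card R"
  proof -
    have "H - U \<subseteq> (Pow {..<n} - W) \<union> R"
      using H_sub by (auto simp: R_def)
    then have "card (H - U) \<le> card ((Pow {..<n} - W) \<union> R)"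
      using finR by (intro card_mono) auto
    also have "\<dots> \<le> card (Pow {..<n} - W) + card R"
      by (rule card_Un_le)
    also have "card (Pow {..<n} - W) = 2 ^ n - card W"
      using W finW by (subst card_Diff_subset) (auto simp: card_Pow)
    finally have "card (H - U) \<le> 2 ^ n - card W + card R" .
    moreover have "card (H - U) = card H - card U"
      using U(1) finU by (intro card_Diff_subset)
    ultimately show ?thesis
      using U(2) by linarith
  qed
  ultimately have cU: "card U \<le> card R + card (cube_cut n W)"
    using card_cube_cut_ge[OF W] by linarith
  define y where "y x j = x \<triangle> {j}" for x :: "nat set" and j
  define P where "P x j = patterns H 3 x {j} (N1 x - {j}) (N0 (y x j) - {j})" for x j
  define T where "T = Sigma (cube_cut n W) (\<lambda>(x, j). P x j)"
  have N_sub: "N1 x - {j} \<subseteq> {..<n} - {j}" "N0 x - {j} \<subseteq> {..<n} - {j}" for x j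
    by (auto simp: N1_def N0_def)
  have cutD: "x \<subseteq> {..<n}" "j < n" "y x j \<subseteq> {..<n}" "card (N0 x) \<le> card (N1 x)" "card (N1 (y x j)) < card (N0 (y x j))"
    if "(x, j) \<in> cube_cut n W" for x j
  proof -
    show x: "x \<subseteq> {..<n}" "j < n" "card (N0 x) \<le> card (N1 x)"
      using that by (auto simp: cube_cut_def W_def)
    show xj: "y x j \<subseteq> {..<n}"
      using x sub_n unfolding y_def by blast
    show "card (N1 (y x j)) < card (N0 (y x j))"
      using that xj by (auto simp: cube_cut_def W_def y_def)
  qed
  have finP: "finite (P x j)" for x j
    unfolding P_def by (rule finite_patterns[of _ n]) (use N_sub in blast)+
  have finT: "finite T"
    unfolding T_def using finW finP by (intro finite_SigmaI) auto
  have "\<kappa> * card (cube_cut n W) = (\<Sum>t\<in>cube_cut n W. \<kappa>)"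
    by simp
  also have "\<dots> \<le> (\<Sum>(x, j)\<in>cube_cut n W. card (P x j))"
  proof (rule sum_mono, clarify)
    fix x j assume c: "(x, j) \<in> cube_cut n W"
    note C = cutD[OF c]
    have "N \<le> 2 * (card (N1 x - {j}) + 1)"
      using N_sum[OF C(1)] C(4) diff_card_le_card_Diff[of "{j}" "N1 x"] by simp
    moreover have "N \<le> 2 * (card (N0 (y x j) - {j}) + 1)"
      using N_sum[OF C(3)] C(5) diff_card_le_card_Diff[of "{j}" "N0 (y x j)"] by simp
    ultimately show "\<kappa> \<le> card (P x j)"
      unfolding P_def using C by (intro pat N_sub)
  qed
  also have "\<dots> = card T"
    unfolding T_def using finW finP by (subst card_SigmaI) (auto intro!: sum.cong)
  finally have cT: "\<kappa> * card (cube_cut n W) \<le> card T" .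
  \<comment> \<open>\<open>x\<close> need not be in \<open>H\<close>, so the path starts at a
    neighbour of \<open>x\<close> in \<open>U\<close>. Every direction of \<open>K1\<close> leads to
    one, and \<open>Min\<close> fixes a choice; the other end is treated in the same way.\<close>
  define a where "a t = fst (fst t) \<triangle> {Min (fst (snd t))}" for t :: "(nat set \<times> nat) \<times> nat set \<times> nat set"
  define b where "b t = fst (fst t) \<triangle> fst (snd t)" for t :: "(nat set \<times> nat) \<times> nat set \<times> nat set"
  define c where "c t = y (fst (fst t)) (snd (fst t)) \<triangle> snd (snd t)" for t :: "(nat set \<times> nat) \<times> nat set \<times> nat set"
  define e where "e t = y (fst (fst t)) (snd (fst t)) \<triangle> {Min (snd (snd t))}" for t :: "(nat set \<times> nat) \<times> nat set \<times> nat set"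
  let ?K = "{K. K \<subseteq> {..<n} \<and> card K = 3}"
  have TE: "\<exists>x j K1 K2. t = ((x, j), (K1, K2)) \<and> (x, j) \<in> cube_cut n W \<and> pattern_at n H 3 x {j} K1 K2
      \<and> K1 \<subseteq> N1 x \<and> K2 \<subseteq> N0 (y x j) \<and> Min K1 \<in> K1 \<and> Min K2 \<in> K2" if "t \<in> T" for t
  proof -
    obtain x j K1 K2 where t1: "t = ((x, j), (K1, K2))"
      by (metis surj_pair)
    then have t: "(x, j) \<in> cube_cut n W" "(K1, K2) \<in> P x j"
      using that unfolding T_def by simp_all
    note C = cutD[OF t(1)]
    have p: "pattern_at n H 3 x {j} K1 K2"
      using pattern_atI[OF t(2)[unfolded P_def] C(1) _ N_sub] C(2) by simp
    then interpret pattern_at n H 3 x "{j}" K1 K2 .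
    have "Min K1 \<in> K1" "Min K2 \<in> K2"
      using finK neK by (auto intro: Min_in)
    then show ?thesis
      using t1 t p mem_patterns(1,2)[OF t(2)[unfolded P_def]] by blast
  qed
  have "card T \<le> 2 * (n ^ 5 + 7 * 4 ^ 7 + n ^ 5) * card ?B"
  proof (rule card_paths_le[OF finT finite_cube_edges, of a b c e])
    fix t assume "t \<in> T"
    then obtain x j K1 K2 where t: "t = ((x, j), (K1, K2))" "(x, j) \<in> cube_cut n W"
      "pattern_at n H 3 x {j} K1 K2" "K1 \<subseteq> N1 x" "K2 \<subseteq> N0 (y x j)" "Min K1 \<in> K1" "Min K2 \<in> K2"
      using TE[of t] by blast
    interpret pattern_at n H 3 x "{j}" K1 K2 by fact
    interpret o: pattern_at n H 3 "x \<triangle> {j}" "{j}" K2 K1 by (rule opposite)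
    note C = cutD[OF t(2)]
    have 1: "a t \<in> U"
      using t(4,6) by (auto simp: a_def t(1) N1_def)
    have 2: "e t \<in> H - U"
      using t(5,7) by (auto simp: e_def t(1) N0_def)
    show "a t \<in> U" "e t \<notin> U"
      using 1 2 by auto
    show "{a t, b t} \<in> cube_edges H"
      using 1 U(1) neighbor_edge[OF t(6)] unfolding a_def b_def t(1) by auto
    show "{b t, c t} \<in> cube_edges H"
      using middle_edge unfolding c_def b_def t(1) y_def end_eq by simp
    show "{c t, e t} \<in> cube_edges H"
      using 2 o.neighbor_edge[OF t(7)] unfolding c_def e_def t(1) y_def by (simp add: insert_commute)
  next
    fix w w'
    have n5: "card ({..<n} \<times> {..<n} \<times> ?K) \<le> n ^ 5"
    proof -
      have "card ({..<n} \<times> {..<n} \<times> ?K) \<le> n * (n * n ^ 3)"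
        using card_subsets_le_power[of n 3] by (simp add: card_cartesian_product)
      then show ?thesis by (simp add: eval_nat_numeral)
    qed
    \<comment> \<open>Free are the direction \<open>i\<close> that leads back to \<open>x\<close>,
      the direction \<open>j\<close> and the 3-set \<open>K2\<close>: n^5 possibilities against
      about n^6 patterns. With \<open>d\<close>-sets the numbers would be n^(d + 2) and n^(2d), so 3
      is the first \<open>d\<close> that gains a factor n.\<close>
    show "card {t \<in> T. a t = w \<and> b t = w'} \<le> n ^ 5"
    proof (rule card_le_image[of _ "\<lambda>(i, j, K2). ((w \<triangle> {i}, j), (insert i (w \<triangle> w'), K2))" "{..<n} \<times> {..<n} \<times> ?K"])
      show "{t \<in> T. a t = w \<and> b t = w'} \<subseteq> (\<lambda>(i, j, K2). ((w \<triangle> {i}, j), (insert i (w \<triangle> w'), K2))) ` ({..<n} \<times> {..<n} \<times> ?K)"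
      proof clarify
        fix t assume "t \<in> T" "w = a t" "w' = b t"
        then obtain x j K1 K2 where t: "t = ((x, j), (K1, K2))" "(x, j) \<in> cube_cut n W"
          "pattern_at n H 3 x {j} K1 K2" "Min K1 \<in> K1"
          using TE[of t] by blast
        interpret pattern_at n H 3 x "{j}" K1 K2 by fact
        note C = cutD[OF t(2)]
        have "insert (Min K1) (a t \<triangle> b t) = K1"
          unfolding a_def b_def t using t(4) by (auto simp: set_eq_iff)
        moreover have "a t \<triangle> {Min K1} = x"
          by (simp add: a_def t)
        moreover have "Min K1 < n"
          using t(4) K by auto
        ultimately show "t \<in> (\<lambda>(i, j, K2). ((a t \<triangle> {i}, j), (insert i (a t \<triangle> b t), K2))) ` ({..<n} \<times> {..<n} \<times> ?K)"
          using t(1) C K cardK by (intro image_eqI[of _ _ "(Min K1, j, K2)"]) auto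
      qed
    qed (use n5 in auto)
    show "card {t \<in> T. c t = w \<and> e t = w'} \<le> n ^ 5"
    proof (rule card_le_image[of _ "\<lambda>(i, j, K1). ((w' \<triangle> {i} \<triangle> {j}, j), (K1, insert i (w \<triangle> w')))" "{..<n} \<times> {..<n} \<times> ?K"])
      show "{t \<in> T. c t = w \<and> e t = w'} \<subseteq> (\<lambda>(i, j, K1). ((w' \<triangle> {i} \<triangle> {j}, j), (K1, insert i (w \<triangle> w')))) ` ({..<n} \<times> {..<n} \<times> ?K)"
      proof clarify
        fix t assume "t \<in> T" "w = c t" "w' = e t"
        then obtain x j K1 K2 where t: "t = ((x, j), (K1, K2))" "(x, j) \<in> cube_cut n W"
          "pattern_at n H 3 x {j} K1 K2" "Min K2 \<in> K2"
          using TE[of t] by blast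
        interpret pattern_at n H 3 x "{j}" K1 K2 by fact
        note C = cutD[OF t(2)]
        have "insert (Min K2) (c t \<triangle> e t) = K2"
          unfolding c_def e_def t using t(4) by (auto simp: set_eq_iff)
        moreover have "e t \<triangle> {Min K2} \<triangle> {j} = x"
          by (simp add: e_def t y_def)
        moreover have "Min K2 < n"
          using t(4) K by auto
        ultimately show "t \<in> (\<lambda>(i, j, K1). ((e t \<triangle> {i} \<triangle> {j}, j), (K1, insert i (c t \<triangle> e t)))) ` ({..<n} \<times> {..<n} \<times> ?K)"
          using t(1) C K cardK by (intro image_eqI[of _ _ "(Min K2, j, K1)"]) auto
      qed
    qed (use n5 in auto)
    have bc: "b t \<triangle> c t = K1 \<union> K2 \<union> {j}" if "t = ((x, j), (K1, K2))" "pattern_at n H 3 x {j} K1 K2" for t x j K1 K2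
    proof -
      interpret pattern_at n H 3 x "{j}" K1 K2 by fact
      have "K1 \<union> K2 \<union> {j} = K1 \<triangle> ({j} \<triangle> K2)"
        using disj unfolding sdiff_def by blast
      then show ?thesis
        unfolding b_def c_def that(1) y_def by (simp add: sdiff_assoc) (metis sdiff_assoc sdiff_commute sdiff_self(2))
    qed
    \<comment> \<open>This bound does not grow with \<open>n\<close>: \<open>j\<close>,
      \<open>K1\<close> and \<open>K2\<close> all lie inside the set \<open>w \<triangle> w'\<close>
      of size at most 7.\<close>
    show "card {t \<in> T. b t = w \<and> c t = w'} \<le> 7 * 4 ^ 7"
    proof (cases "finite (w \<triangle> w') \<and> card (w \<triangle> w') \<le> 7")
      case True
      show ?thesis
      proof (rule card_le_image[of _ "\<lambda>(j, K1, K2). ((w \<triangle> K1, j), (K1, K2))" "(w \<triangle> w') \<times> Pow (w \<triangle> w') \<times> Pow (w \<triangle> w')"])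
        show "{t \<in> T. b t = w \<and> c t = w'} \<subseteq>
          (\<lambda>(j, K1, K2). ((w \<triangle> K1, j), (K1, K2))) ` ((w \<triangle> w') \<times> Pow (w \<triangle> w') \<times> Pow (w \<triangle> w'))"
        proof clarify
          fix t assume "t \<in> T" "w = b t" "w' = c t"
          then obtain x j K1 K2 where t: "t = ((x, j), (K1, K2))" "pattern_at n H 3 x {j} K1 K2"
            using TE[of t] by blast
          have "b t \<triangle> K1 = x"
            by (simp add: b_def t)
          then show "t \<in> (\<lambda>(j, K1, K2). ((b t \<triangle> K1, j), (K1, K2))) `
              ((b t \<triangle> c t) \<times> Pow (b t \<triangle> c t) \<times> Pow (b t \<triangle> c t))"
            using t(1) unfolding bc[OF t]
            by (intro image_eqI[of _ _ "(j, K1, K2)"]) auto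
        qed
        have "(2::nat) ^ card (w \<triangle> w') \<le> 2 ^ 7"
          using True by (intro power_increasing) auto
        then have "card (w \<triangle> w') * ((2::nat) ^ card (w \<triangle> w') * 2 ^ card (w \<triangle> w')) \<le> 7 * (2 ^ 7 * 2 ^ 7)"
          using True by (intro mult_le_mono) auto
        then show "card ((w \<triangle> w') \<times> Pow (w \<triangle> w') \<times> Pow (w \<triangle> w')) \<le> 7 * 4 ^ 7"
          using True by (simp add: card_cartesian_product card_Pow)
      qed (use True in auto)
    next
      case False
      have "\<not> (b t = w \<and> c t = w')" if tT: "t \<in> T" for t
      proof
        assume bc': "b t = w \<and> c t = w'"
        obtain x j K1 K2 where t: "t = ((x, j), (K1, K2))" "pattern_at n H 3 x {j} K1 K2"
          using TE[OF tT] by blast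
        interpret pattern_at n H 3 x "{j}" K1 K2 by fact
        have eq: "w \<triangle> w' = K1 \<union> K2 \<union> {j}"
          using bc' bc[OF t] by simp
        have "card (K1 \<union> K2 \<union> {j}) \<le> card K1 + card K2 + card {j}"
          by (meson add_le_mono card_Un_le le_refl le_trans)
        then have "card (w \<triangle> w') \<le> 7"
          unfolding eq using cardK by simp
        moreover have "finite (w \<triangle> w')"
          unfolding eq using finK by simp
        ultimately show False using False by blast
      qed
      then have "{t \<in> T. b t = w \<and> c t = w'} = {}" by blast
      then show ?thesis by (simp only: card.empty le0)
    qed
  qed
  then have "\<kappa> * card (cube_cut n W) \<le> 2 * (2 * n ^ 5 + 7 * 4 ^ 7) * card ?B"
    using cT by (simp add: algebra_simps)
  then show ?thesis
    using cU R_le by blast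
qed

section \<open>Upper bounds from single vertices\<close>

lemma edge_expansion_star_le:
  assumes "z \<in> H" "\<And>i. i < n \<Longrightarrow> z \<triangle> {i} \<in> H" "0 < n"
  shows "edge_expansion H (cube_edges H) \<le> real n"
proof -
  have "card {z, z \<triangle> {0}} \<le> card H"
    using assms by (intro card_mono) auto
  moreover have "z \<noteq> z \<triangle> {0}"
    by (metis insert_not_empty sdiff_eq_self(1))
  ultimately have "2 \<le> card H" by simp
  \<comment> \<open>\<open>{z}\<close> is an admissible set, so the expansion is at most the degree
    of \<open>z\<close>.\<close>
  then have "edge_expansion H (cube_edges H) \<le> real (card (edge_boundary (cube_edges H) {z})) / real (card {z})"
    using assms(1) by (intro edge_expansion_le) auto
  also have "\<dots> = real (card (edge_boundary (cube_edges H) {z}))"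
    by simp
  also have "card (edge_boundary (cube_edges H) {z}) \<le> n"
  proof (rule card_le_image[of _ "\<lambda>i. {z, z \<triangle> {i}}" "{..<n}"])
    show "edge_boundary (cube_edges H) {z} \<subseteq> (\<lambda>i. {z, z \<triangle> {i}}) ` {..<n}"
    proof
      fix e assume "e \<in> edge_boundary (cube_edges H) {z}"
      then have e: "e \<in> cube_edges H" "z \<in> e"
        by (auto simp: edge_boundary_def card_1_singleton_iff)
      from cube_edges_obtain_ends[OF e(1)] obtain u w where
        uw: "e = {u, w}" "(\<And>i. i < n \<Longrightarrow> u \<triangle> {i} \<in> H) \<Longrightarrow> \<exists>i<n. w = u \<triangle> {i}"
        "(\<And>i. i < n \<Longrightarrow> w \<triangle> {i} \<in> H) \<Longrightarrow> \<exists>i<n. u = w \<triangle> {i}"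
        by metis
      have "z = u \<or> z = w"
        using e(2) uw(1) by blast
      then show "e \<in> (\<lambda>i. {z, z \<triangle> {i}}) ` {..<n}"
      proof
        assume "z = u"
        then obtain i where "i < n" "w = u \<triangle> {i}"
          using uw(2) assms(2) by blast
        then show ?thesis
          using uw(1) \<open>z = u\<close> by blast
      next
        assume "z = w"
        then obtain i where "i < n" "u = w \<triangle> {i}"
          using uw(3) assms(2) by blast
        then show ?thesis
          using uw(1) \<open>z = w\<close> by blast
      qed
    qed
  qed auto
  finally show ?thesis by simp
qed

end

text \<open>A pair \<open>u, w\<close> is recorded as \<open>(u, u \<triangle> w)\<close>.\<close>

definition lonely_pairs :: "nat set set \<Rightarrow> (nat set \<times> nat set) set" where
  "lonely_pairs H = {(u, D). u \<in> H \<and> D \<noteq> {} \<and> u \<triangle> D \<in> H \<and>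
     (\<forall>S\<subseteq>D. u \<triangle> S \<in> H \<longrightarrow> u \<triangle> (D - S) \<in> H \<longrightarrow> S = {} \<or> S = D)}"

context set_family
begin

lemma lonely_pairs_sub: "lonely_pairs H \<subseteq> Pow {..<n} \<times> Pow {..<n}"
proof clarify
  fix u D assume "(u, D) \<in> lonely_pairs H"
  then have "u \<subseteq> {..<n}" "u \<triangle> D \<subseteq> {..<n}"
    using H_sub unfolding lonely_pairs_def by blast+
  then have "u \<triangle> (u \<triangle> D) \<subseteq> {..<n}"
    by (rule sdiff_subset)
  then show "u \<in> Pow {..<n} \<and> D \<in> Pow {..<n}"
    using \<open>u \<subseteq> {..<n}\<close> by simp
qed

text \<open>Singletons bound the expansion by every degree, hence by the average degree, and the
  edges at \<open>u\<close> give distinct lonely pairs that start at \<open>u\<close>.\<close>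

lemma edge_expansion_le_lonely_pairs:
  assumes "2 \<le> card H"
  shows "edge_expansion H (cube_edges H) * real (card H) \<le> real (card (lonely_pairs H))"
proof -
  have fin: "finite (lonely_pairs H)"
    using lonely_pairs_sub by (rule finite_subset) simp
  define L where "L u = {D. (u, D) \<in> lonely_pairs H}" for u
  have finL: "finite (L u)" for u
    unfolding L_def using finite_subset[OF _ finite_imageI[OF fin, of snd], of "{D. (u, D) \<in> lonely_pairs H}"]
    by force
  have "edge_expansion H (cube_edges H) \<le> real (card (L u))" if u: "u \<in> H" for u
  proof -
    have "edge_expansion H (cube_edges H) \<le> real (card (edge_boundary (cube_edges H) {u})) / real (card {u})"
      using u assms by (intro edge_expansion_le) auto
    also have "\<dots> = real (card (edge_boundary (cube_edges H) {u}))"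
      by simp
    also have "card (edge_boundary (cube_edges H) {u}) \<le> card (L u)"
    proof (rule card_le_image[OF _ finL le_refl, of _ "\<lambda>D. {u, u \<triangle> D}"], rule subsetI)
      fix e assume "e \<in> edge_boundary (cube_edges H) {u}"
      then have e: "e \<in> cube_edges H" "u \<in> e"
        by (auto simp: edge_boundary_def card_1_singleton_iff)
      from cube_edges_obtain_ends[OF e(1)] obtain a b where
        ab: "e = {a, b}" "a \<in> H" "b \<in> H" "a \<noteq> b"
        "\<And>S. S \<subseteq> a \<triangle> b \<Longrightarrow> a \<triangle> S \<in> H \<Longrightarrow> b \<triangle> S \<in> H \<Longrightarrow> S = {} \<or> S = a \<triangle> b"
        by metis
      have "\<exists>w. e = {u, w} \<and> w \<in> H \<and> u \<noteq> w \<and>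
        (\<forall>S. S \<subseteq> u \<triangle> w \<longrightarrow> u \<triangle> S \<in> H \<longrightarrow> w \<triangle> S \<in> H \<longrightarrow> S = {} \<or> S = u \<triangle> w)"
      proof (cases "u = a")
        case True
        then show ?thesis using ab by (intro exI[of _ b]) simp
      next
        case False
        then have "u = b" using e(2) ab(1) by blast
        then show ?thesis using ab sdiff_commute[of a b] by (intro exI[of _ a]) (simp add: insert_commute)
      qed
      then obtain w where w: "e = {u, w}" "w \<in> H" "u \<noteq> w"
        "\<And>S. S \<subseteq> u \<triangle> w \<Longrightarrow> u \<triangle> S \<in> H \<Longrightarrow> w \<triangle> S \<in> H \<Longrightarrow> S = {} \<or> S = u \<triangle> w"
        by blast
      have "u \<triangle> (u \<triangle> w - S) = w \<triangle> S" if "S \<subseteq> u \<triangle> w" for S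
        using that by (auto simp: set_eq_iff subset_iff)
      then have "u \<triangle> w \<in> L u"
        unfolding L_def lonely_pairs_def using u w by simp
      then show "e \<in> (\<lambda>D. {u, u \<triangle> D}) ` L u"
        using w(1) by (intro image_eqI[of _ _ "u \<triangle> w"]) auto
    qed
    finally show ?thesis by simp
  qed
  then have "(\<Sum>u\<in>H. edge_expansion H (cube_edges H)) \<le> (\<Sum>u\<in>H. real (card (L u)))"
    by (intro sum_mono)
  also have "\<dots> = real (card (Sigma H L))"
    using finL by (subst card_SigmaI) auto
  also have "Sigma H L = lonely_pairs H"
  proof -
    have "u \<in> H" if "(u, D) \<in> lonely_pairs H" for u D
      using that by (simp add: lonely_pairs_def)
    then show ?thesis
      by (auto simp: L_def)
  qed
  finally show ?thesis
    by (simp add: mult.commute)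
qed

end

section \<open>Random subsets and independence over disjoint blocks\<close>

text \<open>\<open>wexp p A \<phi>\<close> is the expectation of \<open>\<phi>\<close> under \<open>random_subset_pmf A p\<close>, as a finite sum.\<close>

definition wexp :: "real \<Rightarrow> 'a set \<Rightarrow> ('a set \<Rightarrow> real) \<Rightarrow> real" where
  "wexp p A \<phi> = (\<Sum>V\<in>Pow A. p ^ card V * (1 - p) ^ card (A - V) * \<phi> V)"

lemma pmf_random_subset_pmf:
  assumes "finite A" "V \<subseteq> A" "0 \<le> p" "p \<le> 1"
  shows "pmf (random_subset_pmf A p) V = p ^ card V * (1 - p) ^ card (A - V)"
proof -
  let ?M = "Pi_pmf A False (\<lambda>_. bernoulli_pmf p)"
  have "pmf (random_subset_pmf A p) V = measure_pmf.prob ?M ((\<lambda>f. {x \<in> A. f x}) -` {V})"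
    by (simp add: random_subset_pmf_def pmf_map)
  \<comment> \<open>Outside \<open>A\<close> the random function almost surely takes the default
    value \<open>False\<close>, so the chosen subset determines it.\<close>
  also have "\<dots> = measure_pmf.prob ?M {\<lambda>x. x \<in> V}"
  proof (rule measure_prob_cong_0)
    fix f assume f: "f \<in> (\<lambda>f. {x \<in> A. f x}) -` {V} - {\<lambda>x. x \<in> V}"
    then have V: "{x \<in> A. f x} = V" and "f \<noteq> (\<lambda>x. x \<in> V)"
      by auto
    then obtain x where "f x \<noteq> (x \<in> V)" by blast
    then have "x \<notin> A" "f x"
      using V assms(2) by blast+
    then show "pmf ?M f = 0"
      using assms(1) by (intro pmf_Pi_outside) auto
  next
    fix f assume f: "f \<in> {\<lambda>x. x \<in> V} - (\<lambda>f. {x \<in> A. f x}) -` {V}"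
    then have "{x \<in> A. x \<in> V} \<noteq> V" by auto
    then show "pmf ?M f = 0"
      using assms(2) by blast
  qed
  also have "\<dots> = pmf ?M (\<lambda>x. x \<in> V)"
    by (simp add: measure_pmf_single)
  also have "\<dots> = (\<Prod>x\<in>A. pmf (bernoulli_pmf p) (x \<in> V))"
    using assms by (intro pmf_Pi') auto
  also have "\<dots> = (\<Prod>x\<in>A. if x \<in> V then p else 1 - p)"
    using assms by (intro prod.cong) auto
  also have "\<dots> = p ^ card V * (1 - p) ^ card (A - V)"
    using assms by (simp add: prod.If_cases Int_absorb1 Diff_eq)
  finally show ?thesis .
qed

lemma set_pmf_random_subset: "finite A \<Longrightarrow> set_pmf (random_subset_pmf A p) \<subseteq> Pow A"
  by (auto simp: random_subset_pmf_def)

lemma prob_eq_wexp: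
  assumes "finite A" "0 \<le> p" "p \<le> 1"
  shows "measure_pmf.prob (random_subset_pmf A p) S = wexp p A (\<lambda>V. of_bool (V \<in> S))"
proof -
  have "measure_pmf.prob (random_subset_pmf A p) S = measure_pmf.prob (random_subset_pmf A p) (S \<inter> Pow A)"
    using set_pmf_random_subset[OF assms(1), of p] by (intro measure_prob_cong_0) (auto simp: pmf_eq_0_set_pmf)
  also have "\<dots> = sum (pmf (random_subset_pmf A p)) (S \<inter> Pow A)"
    using assms(1) by (intro measure_measure_pmf_finite) auto
  also have "\<dots> = (\<Sum>V\<in>S \<inter> Pow A. p ^ card V * (1 - p) ^ card (A - V))"
    using assms by (intro sum.cong) (auto simp: pmf_random_subset_pmf)
  also have "\<dots> = wexp p A (\<lambda>V. of_bool (V \<in> S))"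
    unfolding wexp_def using assms(1)
    by (intro sum.mono_neutral_cong_left) auto
  finally show ?thesis .
qed

lemma prob_random_subset_image:
  assumes "finite A" "inj_on f A" "0 \<le> p" "p \<le> 1"
  shows "measure_pmf.prob (random_subset_pmf (f ` A) p) S =
    measure_pmf.prob (random_subset_pmf A p) {V. f ` V \<in> S}"
proof -
  have inj: "inj_on (image f) (Pow A)"
    using assms(2) by (rule inj_on_image_Pow)
  have "wexp p (f ` A) (\<lambda>V. of_bool (V \<in> S)) = wexp p A (\<lambda>V. of_bool (V \<in> {V. f ` V \<in> S}))"
    unfolding wexp_def image_Pow_surj[OF refl, symmetric]
  proof (subst sum.reindex[OF inj], intro sum.cong refl)
    fix V assume V: "V \<in> Pow A"
    have "f ` A - f ` V = f ` (A - V)"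
      using assms(2) V by (intro inj_on_image_set_diff[symmetric]) auto
    moreover have "inj_on f V" "inj_on f (A - V)"
      using assms(2) V by (auto intro: inj_on_subset)
    ultimately show "((\<lambda>V. p ^ card V * (1 - p) ^ card (f ` A - V) * of_bool (V \<in> S)) \<circ> (`) f) V =
      p ^ card V * (1 - p) ^ card (A - V) * of_bool (V \<in> {V. f ` V \<in> S})"
      by (simp add: card_image)
  qed
  then show ?thesis
    using assms by (simp add: prob_eq_wexp)
qed

lemma wexp_one: "finite A \<Longrightarrow> 0 \<le> p \<Longrightarrow> p \<le> 1 \<Longrightarrow> wexp p A (\<lambda>_. 1) = 1"
  using prob_eq_wexp[of A p UNIV] by simp

lemma wexp_mono:
  assumes "0 \<le> p" "p \<le> 1" "\<And>V. V \<subseteq> A \<Longrightarrow> \<phi> V \<le> \<psi> V"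
  shows "wexp p A \<phi> \<le> wexp p A \<psi>"
  unfolding wexp_def using assms by (intro sum_mono mult_left_mono) auto

lemma wexp_sum: "wexp p A (\<lambda>V. \<Sum>i\<in>I. \<phi> i V) = (\<Sum>i\<in>I. wexp p A (\<phi> i))"
  unfolding wexp_def sum_distrib_left by (rule sum.swap)

lemma wexp_cmult: "wexp p A (\<lambda>V. c * \<phi> V) = c * wexp p A \<phi>"
  unfolding wexp_def sum_distrib_left by (simp add: mult_ac)

text \<open>Independence of the traces on two disjoint sets.\<close>

lemma wexp_split:
  assumes "finite B" "finite C" "B \<inter> C = {}"
  shows "wexp p (B \<union> C) (\<lambda>V. g (V \<inter> B) * h (V \<inter> C)) = wexp p B g * wexp p C h"
proof -
  have bij: "bij_betw (\<lambda>(X, Y). X \<union> Y) (Pow B \<times> Pow C) (Pow (B \<union> C))"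
    by (rule bij_betwI[where g = "\<lambda>V. (V \<inter> B, V \<inter> C)"]) (use assms(3) in auto)
  have "wexp p (B \<union> C) (\<lambda>V. g (V \<inter> B) * h (V \<inter> C)) =
    (\<Sum>(X, Y)\<in>Pow B \<times> Pow C. (p ^ card X * (1 - p) ^ card (B - X) * g X) * (p ^ card Y * (1 - p) ^ card (C - Y) * h Y))"
    unfolding wexp_def
  proof (subst sum.reindex_bij_betw[OF bij, symmetric], intro sum.cong refl, clarify)
    fix X Y assume XY: "X \<subseteq> B" "Y \<subseteq> C"
    have fin: "finite X" "finite Y"
      using XY assms finite_subset by blast+
    have 1: "(X \<union> Y) \<inter> B = X" "(X \<union> Y) \<inter> C = Y"
      using XY assms(3) by blast+
    have 2: "card (X \<union> Y) = card X + card Y"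
      using XY assms(3) fin by (intro card_Un_disjoint) auto
    have "B \<union> C - (X \<union> Y) = (B - X) \<union> (C - Y)"
      using XY assms(3) by blast
    then have 3: "card (B \<union> C - (X \<union> Y)) = card (B - X) + card (C - Y)"
      using assms by (simp add: card_Un_disjoint Int_Diff disjoint_iff)
    show "p ^ card (X \<union> Y) * (1 - p) ^ card (B \<union> C - (X \<union> Y)) * (g ((X \<union> Y) \<inter> B) * h ((X \<union> Y) \<inter> C)) =
      p ^ card X * (1 - p) ^ card (B - X) * g X * (p ^ card Y * (1 - p) ^ card (C - Y) * h Y)"
      unfolding 1 2 3 by (simp add: power_add mult_ac)
  qed
  also have "\<dots> = wexp p B g * wexp p C h"
    by (simp add: wexp_def sum_product sum.cartesian_product)
  finally show ?thesis .
qed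

text \<open>The product is 1 - \<open>\<theta>\<close> to the number of blocks with the prescribed
  trace. By independence its expectation factorises, and a block contributes 1 minus
  \<open>\<theta>\<close> times the probability of its trace.\<close>

lemma wexp_prod_le:
  assumes "finite L" "finite A" "0 \<le> p" "p \<le> 1" "0 \<le> \<theta>" "\<theta> \<le> 1" "q \<le> 1"
    and B: "\<And>l. l \<in> L \<Longrightarrow> B l \<subseteq> A" and R: "\<And>l. l \<in> L \<Longrightarrow> R l \<subseteq> B l"
    and disj: "disjoint_family_on B L"
    and q: "\<And>l. l \<in> L \<Longrightarrow> q \<le> p ^ card (R l) * (1 - p) ^ card (B l - R l)"
  shows "wexp p A (\<lambda>V. \<Prod>l\<in>L. 1 - \<theta> * of_bool (V \<inter> B l = R l)) \<le> (1 - \<theta> * q) ^ card L"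
  using assms
proof (induction L arbitrary: A rule: finite_induct)
  case empty
  then show ?case by (simp add: wexp_one)
next
  case (insert k L)
  let ?h = "\<lambda>V. \<Prod>l\<in>L. 1 - \<theta> * of_bool (V \<inter> B l = R l)"
  let ?g = "\<lambda>V. 1 - \<theta> * of_bool (V = R k)"
  have Bk: "B k \<subseteq> A" "finite (B k)"
    using insert.prems(1,7) finite_subset by blast+
  have BL: "B l \<subseteq> A - B k" if "l \<in> L" for l
  proof -
    have "B l \<inter> B k = {}"
      using disjoint_family_onD[OF insert.prems(9), of l k] that insert.hyps(2) by auto
    then show ?thesis
      using insert.prems(7)[of l] that by auto
  qed
  have h_eq: "?h V = ?h (V \<inter> (A - B k))" for V
  proof (intro prod.cong refl)
    fix l assume "l \<in> L"
    then have "V \<inter> (A - B k) \<inter> B l = V \<inter> B l"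
      using BL by blast
    then show "1 - \<theta> * of_bool (V \<inter> B l = R l) = 1 - \<theta> * of_bool (V \<inter> (A - B k) \<inter> B l = R l)"
      by simp
  qed
  have "wexp p A (\<lambda>V. \<Prod>l\<in>insert k L. 1 - \<theta> * of_bool (V \<inter> B l = R l)) =
    wexp p (B k \<union> (A - B k)) (\<lambda>V. ?g (V \<inter> B k) * ?h (V \<inter> (A - B k)))"
  proof -
    have "B k \<union> (A - B k) = A"
      using Bk by blast
    moreover have "(\<lambda>V. \<Prod>l\<in>insert k L. 1 - \<theta> * of_bool (V \<inter> B l = R l)) = (\<lambda>V. ?g (V \<inter> B k) * ?h (V \<inter> (A - B k)))"
      using insert.hyps h_eq by (intro ext) simp
    ultimately show ?thesis by simp
  qed
  also have "\<dots> = wexp p (B k) ?g * wexp p (A - B k) ?h"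
    using Bk insert.prems(1) by (intro wexp_split) auto
  also have "wexp p (B k) ?g = 1 - \<theta> * (p ^ card (R k) * (1 - p) ^ card (B k - R k))"
  proof -
    have "wexp p (B k) ?g = wexp p (B k) (\<lambda>_. 1) - \<theta> * wexp p (B k) (\<lambda>V. of_bool (V = R k))"
      unfolding wexp_def by (simp add: algebra_simps sum_subtractf sum_distrib_left)
    also have "wexp p (B k) (\<lambda>V. of_bool (V = R k)) = p ^ card (R k) * (1 - p) ^ card (B k - R k)"
      unfolding wexp_def using insert.prems(8)[of k] Bk
      by (subst sum.remove[of _ "R k"]) (auto intro!: sum.neutral)
    finally show ?thesis
      using Bk insert.prems by (simp add: wexp_one)
  qed
  also have "\<dots> * wexp p (A - B k) ?h \<le> (1 - \<theta> * q) * (1 - \<theta> * q) ^ card L"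
  proof (rule mult_mono)
    show "1 - \<theta> * (p ^ card (R k) * (1 - p) ^ card (B k - R k)) \<le> 1 - \<theta> * q"
      using insert.prems(4) insert.prems(10)[of k] by (simp add: mult_left_mono)
    show "wexp p (A - B k) ?h \<le> (1 - \<theta> * q) ^ card L"
      using insert.prems BL by (intro insert.IH) (auto simp: disjoint_family_on_def)
    show "0 \<le> 1 - \<theta> * q"
    proof (cases "q \<le> 0")
      case True
      then have "\<theta> * q \<le> 0"
        using insert.prems(4) by (simp add: mult_nonneg_nonpos)
      then show ?thesis by simp
    next
      case False
      then show ?thesis
        using insert.prems(5,6) mult_mono[of \<theta> 1 q 1] by simp
    qed
    show "0 \<le> wexp p (A - B k) ?h"
      unfolding wexp_def using insert.prems by (intro sum_nonneg mult_nonneg_nonneg prod_nonneg) (auto simp: of_bool_def)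
  qed
  also have "\<dots> = (1 - \<theta> * q) ^ card (insert k L)"
    using insert.hyps by simp
  finally show ?case .
qed

text \<open>The common setting of the tail bounds below: independent events, each prescribing the
  random set on its own block, of probability at least \<open>q\<close>.\<close>

locale blocks =
  fixes A :: "'a set" and p :: real and L :: "'l set" and B R :: "'l \<Rightarrow> 'a set" and q :: real
  assumes fin: "finite L" "finite A" and p: "0 \<le> p" "p \<le> 1" and q1: "q \<le> 1"
    and B: "\<And>l. l \<in> L \<Longrightarrow> B l \<subseteq> A" and R: "\<And>l. l \<in> L \<Longrightarrow> R l \<subseteq> B l"
    and disj: "disjoint_family_on B L"
    and q: "\<And>l. l \<in> L \<Longrightarrow> q \<le> p ^ card (R l) * (1 - p) ^ card (B l - R l)"
begin

text \<open>Markov's inequality for 1 - \<open>\<theta>\<close> to the number of successes. The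
  power stays on the left so that \<open>\<theta> = 1\<close> is allowed, which with
  \<open>t = 0\<close> bounds the probability of no success at all.\<close>

lemma prob_count_le:
  assumes "0 \<le> \<theta>" "\<theta> \<le> 1"
  shows "(1 - \<theta>) ^ t * measure_pmf.prob (random_subset_pmf A p) {V. card {l \<in> L. V \<inter> B l = R l} \<le> t}
    \<le> (1 - \<theta> * q) ^ card L"
proof -
  have "(1 - \<theta>) ^ t * measure_pmf.prob (random_subset_pmf A p) {V. card {l \<in> L. V \<inter> B l = R l} \<le> t}
    = wexp p A (\<lambda>V. (1 - \<theta>) ^ t * of_bool (V \<in> {V. card {l \<in> L. V \<inter> B l = R l} \<le> t}))"
    using fin p by (simp add: prob_eq_wexp wexp_cmult)
  also have "\<dots> \<le> wexp p A (\<lambda>V. \<Prod>l\<in>L. 1 - \<theta> * of_bool (V \<inter> B l = R l))"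
  proof (rule wexp_mono[OF p])
    fix V
    have "(\<Prod>l\<in>L. 1 - \<theta> * of_bool (V \<inter> B l = R l)) = (\<Prod>l\<in>L. if V \<inter> B l = R l then 1 - \<theta> else 1)"
      by (intro prod.cong) auto
    also have "\<dots> = (1 - \<theta>) ^ card {l \<in> L. V \<inter> B l = R l}"
      using fin by (simp add: prod.If_cases Int_def)
    finally show "(1 - \<theta>) ^ t * of_bool (V \<in> {V. card {l \<in> L. V \<inter> B l = R l} \<le> t}) \<le>
      (\<Prod>l\<in>L. 1 - \<theta> * of_bool (V \<inter> B l = R l))"
      using assms by (auto intro!: power_decreasing)
  qed
  also have "\<dots> \<le> (1 - \<theta> * q) ^ card L"
    using fin p assms q1 B R disj q by (intro wexp_prod_le)
  finally show ?thesis .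
qed

lemma prob_none_le:
  "measure_pmf.prob (random_subset_pmf A p) {V. \<forall>l\<in>L. V \<inter> B l \<noteq> R l} \<le> (1 - q) ^ card L"
proof -
  have "{V. card {l \<in> L. V \<inter> B l = R l} \<le> 0} = {V. \<forall>l\<in>L. V \<inter> B l \<noteq> R l}"
    using fin by auto
  then show ?thesis
    using prob_count_le[of 1 0] by simp
qed

text \<open>A Chernoff bound with \<open>\<theta> = 1/2\<close>: for the threshold \<open>x\<close>,
  the power of 1 - q/2 is at most exp (-2x), and moving (1/2)^t to the right costs at most exp
  x.\<close>

lemma prob_few_le:
  assumes "0 \<le> q"
  shows "measure_pmf.prob (random_subset_pmf A p) {V. real (card {l \<in> L. V \<inter> B l = R l}) \<le> q * real (card L) / 4}
    \<le> exp (- (q * real (card L) / 4))"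
proof -
  define x where "x = q * real (card L) / 4"
  define t where "t = nat \<lfloor>x\<rfloor>"
  have x0: "0 \<le> x" using assms by (simp add: x_def)
  then have tx: "real t \<le> x" by (simp add: t_def)
  have "{V. real (card {l \<in> L. V \<inter> B l = R l}) \<le> x} = {V. card {l \<in> L. V \<inter> B l = R l} \<le> t}"
    using le_nat_floor[of _ x] tx unfolding t_def by fastforce
  moreover have "measure_pmf.prob (random_subset_pmf A p) {V. card {l \<in> L. V \<inter> B l = R l} \<le> t} \<le> exp (- x)"
  proof -
    let ?P = "measure_pmf.prob (random_subset_pmf A p) {V. card {l \<in> L. V \<inter> B l = R l} \<le> t}"
    have "(1 - 1/2) ^ t * ?P \<le> (1 - 1/2 * q) ^ card L"
      by (rule prob_count_le) auto
    also have "(1 - 1/2 * q) ^ card L \<le> exp (- (q / 2)) ^ card L"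
      using exp_ge_add_one_self[of "- (q/2)"] q1 by (intro power_mono) auto
    also have "\<dots> = exp (- 2 * x)"
      by (simp add: x_def flip: exp_of_nat_mult)
    finally have "(1/2) ^ t * ?P \<le> exp (- 2 * x)" by simp
    then have "2 ^ t * ((1/2) ^ t * ?P) \<le> 2 ^ t * exp (- 2 * x)"
      by (intro mult_left_mono) auto
    then have "?P \<le> 2 ^ t * exp (- 2 * x)"
      by (simp add: power_divide)
    also have "(2::real) ^ t \<le> exp 1 ^ t"
      using exp_ge_add_one_self[of "1::real"] by (intro power_mono) auto
    also have "exp 1 ^ t = exp (real t)"
      by (simp flip: exp_of_nat_mult)
    also have "\<dots> \<le> exp x"
      using tx by simp
    finally show ?thesis
      by (simp flip: exp_add)
  qed
  ultimately show ?thesis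
    by (simp add: x_def)
qed

end

lemma prob_union_le:
  fixes M :: "'a pmf"
  assumes "finite I" "\<And>i. i \<in> I \<Longrightarrow> measure_pmf.prob M (S i) \<le> e" "real (card I) \<le> c" "0 \<le> e"
  shows "measure_pmf.prob M {x. \<exists>i\<in>I. x \<in> S i} \<le> c * e"
proof -
  have "{x. \<exists>i\<in>I. x \<in> S i} = (\<Union>i\<in>I. S i)" by auto
  then have "measure_pmf.prob M {x. \<exists>i\<in>I. x \<in> S i} \<le> (\<Sum>i\<in>I. measure_pmf.prob M (S i))"
    using assms(1) measure_pmf.finite_measure_subadditive_finite[of I S M] by simp
  also have "\<dots> \<le> (\<Sum>i\<in>I. e)"
    using assms(2) by (intro sum_mono)
  also have "\<dots> \<le> c * e"
    using assms(3,4) by (simp add: mult_right_mono)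
  finally show ?thesis .
qed

section \<open>Patterns are abundant\<close>

text \<open>
  A grid \<open>\<beta>\<close> arranges \<open>r\<close> directions in each of \<open>2 * d\<close> columns. Two lines meet in at most one column, so
  the shells of their direction sets are disjoint: each grid provides quadratically many independent
  events, enough for a union bound over all \<open>n ^ n\<close> grids.
\<close>

definition grid_set :: "(nat \<times> nat \<Rightarrow> nat) \<Rightarrow> (nat \<Rightarrow> nat) \<Rightarrow> nat \<Rightarrow> nat \<Rightarrow> nat set" where
  "grid_set \<beta> g lo hi = (\<lambda>l. \<beta> (l, g l)) ` {lo..<hi}"

definition line :: "nat \<times> nat \<Rightarrow> nat \<Rightarrow> nat" where
  "line ab l = fst ab + snd ab * l"

lemma line_eqD:
  assumes "line ab l = line cd l" "line ab l' = line cd l'" "l \<noteq> l'"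
  shows "ab = cd"
proof -
  have "int (fst ab) + int (snd ab) * int l = int (fst cd) + int (snd cd) * int l"
    "int (fst ab) + int (snd ab) * int l' = int (fst cd) + int (snd cd) * int l'"
    using assms(1,2) unfolding line_def by (simp_all flip: of_nat_mult of_nat_add)
  then have "(int (snd ab) - int (snd cd)) * (int l - int l') = 0"
    by (simp add: algebra_simps)
  then have "snd ab = snd cd"
    using assms(3) by simp
  then show ?thesis
    using assms(1) by (simp add: line_def prod_eq_iff)
qed

text \<open>The steepest line reaches at most (s - 1) + (s - 1) (2d - 1) = (s - 1) 2d in the last
  column, still below \<open>r\<close>.\<close>

lemma line_less:
  assumes "ab \<in> {..<s} \<times> {..<s}" "l < 2 * d" "2 * d * s \<le> r"
  shows "line ab l < r"
proof -
  obtain a b where ab: "ab = (a, b)" "a < s" "b < s"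
    using assms(1) by auto
  have "b * l \<le> (s - 1) * (2 * d - 1)"
    using ab assms(2) by (intro mult_le_mono) auto
  then have "line ab l \<le> (s - 1) + (s - 1) * (2 * d - 1)"
    using ab by (simp add: line_def)
  also have "\<dots> = (s - 1) * (2 * d)"
    using assms(2) by (cases d) (auto simp: algebra_simps)
  also have "\<dots> < s * (2 * d)"
    using ab assms(2) by (intro mult_strict_right_mono) auto
  also have "\<dots> \<le> r"
    using assms(3) by (simp add: mult.commute)
  finally show ?thesis .
qed

locale grid =
  fixes n d r :: nat and \<Delta> :: "nat set" and \<beta> :: "nat \<times> nat \<Rightarrow> nat"
  assumes \<beta>: "\<And>l t. l < 2 * d \<Longrightarrow> t < r \<Longrightarrow> \<beta> (l, t) \<in> {..<n} - \<Delta>"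
    and inj: "inj_on \<beta> ({..<2 * d} \<times> {..<r})"
begin

lemma grid_inj:
  assumes "\<beta> (l, t) = \<beta> (l', t')" "l < 2 * d" "l' < 2 * d" "t < r" "t' < r"
  shows "l = l'" "t = t'"
  using inj_onD[OF inj assms(1)] assms(2-) by auto

context
  fixes g :: "nat \<Rightarrow> nat"
  assumes g: "\<And>l. l < 2 * d \<Longrightarrow> g l < r"
begin

lemma grid_set_sub: "hi \<le> 2 * d \<Longrightarrow> grid_set \<beta> g lo hi \<subseteq> {..<n} - \<Delta>"
  using \<beta> g unfolding grid_set_def by (intro image_subsetI) auto

lemma card_grid_set: "hi \<le> 2 * d \<Longrightarrow> card (grid_set \<beta> g lo hi) = hi - lo"
  unfolding grid_set_def by (subst card_image) (auto intro!: inj_onI dest: grid_inj(1) simp: g)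

lemma grid_set_disj: "grid_set \<beta> g 0 d \<inter> grid_set \<beta> g d (2 * d) = {}"
proof -
  have False if x: "x \<in> grid_set \<beta> g 0 d" "x \<in> grid_set \<beta> g d (2 * d)" for x
  proof -
    obtain l where l: "x = \<beta> (l, g l)" "l < d"
      using x(1) unfolding grid_set_def by auto
    obtain l' where l': "x = \<beta> (l', g l')" "d \<le> l'" "l' < 2 * d"
      using x(2) unfolding grid_set_def by auto
    have "\<beta> (l, g l) = \<beta> (l', g l')"
      using l(1) l'(1) by simp
    from grid_inj(1)[OF this] have "l = l'"
      using l(2) l'(3) g[of l] g[of l'] by simp
    then show False using l(2) l'(2) by simp
  qed
  then show ?thesis by blast
qed

lemma grid_set_memD:
  assumes "\<beta> (l, t) \<in> grid_set \<beta> g lo hi" "l < 2 * d" "t < r" "hi \<le> 2 * d"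
  shows "lo \<le> l \<and> l < hi \<and> t = g l"
proof -
  obtain l' where l': "\<beta> (l, t) = \<beta> (l', g l')" "lo \<le> l'" "l' < hi"
    using assms(1) unfolding grid_set_def by auto
  then have "l' < 2 * d" using assms(4) by simp
  then have "l = l'" "t = g l'"
    using grid_inj[OF l'(1) assms(2) _ assms(3)] g by auto
  then show ?thesis using l' by simp
qed

end

lemma grid_set_Un: "grid_set \<beta> g 0 d \<union> grid_set \<beta> g d (2 * d) = grid_set \<beta> g 0 (2 * d)"
proof -
  have "{0..<d} \<union> {d..<2 * d} = {0..<2 * d}" by auto
  then show ?thesis
    unfolding grid_set_def image_Un[symmetric] by simp
qed

text \<open>A point of a shell at \<open>z\<close> determines \<open>J\<close>, since the grid
  avoids \<open>\<Delta>\<close>. Two elements of \<open>J\<close> lie in different columns and on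
  both lines, and two points determine a line. This is where a shell needs two elements in
  \<open>J\<close>.\<close>

lemma shell_lines_disjoint:
  assumes "2 * d * s \<le> r" "ab \<in> {..<s} \<times> {..<s}" "cd \<in> {..<s} \<times> {..<s}"
    and x: "x \<in> shell z \<Delta> (grid_set \<beta> (line ab) 0 (2 * d))" "x \<in> shell z \<Delta> (grid_set \<beta> (line cd) 0 (2 * d))"
  shows "ab = cd"
proof -
  obtain J D where J: "x = z \<triangle> (J \<union> D)" "J \<subseteq> grid_set \<beta> (line ab) 0 (2 * d)" "2 \<le> card J" "D \<subseteq> \<Delta>"
    using x(1) unfolding shell_def by blast
  obtain J' D' where J': "x = z \<triangle> (J' \<union> D')" "J' \<subseteq> grid_set \<beta> (line cd) 0 (2 * d)" "D' \<subseteq> \<Delta>"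
    using x(2) unfolding shell_def by blast
  have less: "\<And>l. l < 2 * d \<Longrightarrow> line ab l < r" "\<And>l. l < 2 * d \<Longrightarrow> line cd l < r"
    using line_less[OF assms(2) _ assms(1)] line_less[OF assms(3) _ assms(1)] by blast+
  have sub: "grid_set \<beta> (line ab) 0 (2 * d) \<inter> \<Delta> = {}" "grid_set \<beta> (line cd) 0 (2 * d) \<inter> \<Delta> = {}"
    using grid_set_sub[where g = "line ab" and lo = 0, OF less(1) le_refl] grid_set_sub[where g = "line cd" and lo = 0, OF less(2) le_refl] by blast+
  have "J \<union> D = J' \<union> D'"
    using J(1) J'(1) by simp
  then have JJ: "J \<subseteq> J'"
    using J J' sub by blast
  obtain T where T: "T \<subseteq> J" "card T = 2"
    using J(3) obtain_subset_with_card_n by metis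
  then obtain y y' where y: "y \<in> J" "y' \<in> J" "y \<noteq> y'"
    by (auto simp: card_2_iff)
  have "y \<in> grid_set \<beta> (line ab) 0 (2 * d)" "y' \<in> grid_set \<beta> (line ab) 0 (2 * d)"
    using y J(2) by blast+
  then obtain l l' where l: "y = \<beta> (l, line ab l)" "l < 2 * d" "y' = \<beta> (l', line ab l')" "l' < 2 * d"
    unfolding grid_set_def by auto
  have "y \<in> grid_set \<beta> (line cd) 0 (2 * d)" "y' \<in> grid_set \<beta> (line cd) 0 (2 * d)"
    using y JJ J'(2) by blast+
  then have "line ab l = line cd l" "line ab l' = line cd l'"
    using grid_set_memD[where g = "line cd" and l = l and t = "line ab l", OF less(2)]
      grid_set_memD[where g = "line cd" and l = l' and t = "line ab l'", OF less(2)] l less(1) by auto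
  moreover have "l \<noteq> l'"
    using y(3) l by auto
  ultimately show ?thesis
    by (rule line_eqD)
qed

end

lemma finite_card_shell:
  assumes "finite K" "finite \<Delta>"
  shows "finite (shell z \<Delta> K)" "card (shell z \<Delta> K) \<le> 2 ^ (card K + card \<Delta>)"
proof -
  have sub: "shell z \<Delta> K \<subseteq> (\<lambda>(J, D). z \<triangle> (J \<union> D)) ` (Pow K \<times> Pow \<Delta>)"
    unfolding shell_def by auto
  show "finite (shell z \<Delta> K)"
    using sub by (rule finite_subset) (use assms in auto)
  show "card (shell z \<Delta> K) \<le> 2 ^ (card K + card \<Delta>)"
    by (rule card_le_image[OF sub]) (use assms in \<open>auto simp: card_cartesian_product card_Pow power_add\<close>)
qed

context grid
begin

text \<open>\<open>q\<close> bounds from below the probability that two points are present and at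
  most 2^(2d + 5) others absent, a shell being spanned by the \<open>2 * d\<close> directions of a
  line and at most 5 of \<open>\<Delta>\<close>. The s^2 lines are independent trials.\<close>

lemma prob_few_lines_le:
  assumes p: "0 < p" "p < 1" and d: "2 \<le> d" and s: "2 * d * s \<le> r"
    and z: "z \<subseteq> {..<n}" and \<Delta>: "\<Delta> \<subseteq> {..<n}" "card \<Delta> \<le> 5"
    and q: "q = p ^ 2 * (1 - p) ^ (2 ^ (2 * d + 5))"
  shows "measure_pmf.prob (random_subset_pmf (Pow {..<n}) p)
     {H. real (card {ab \<in> {..<s} \<times> {..<s}. pattern H z \<Delta> (grid_set \<beta> (line ab) 0 d) (grid_set \<beta> (line ab) d (2 * d))})
       \<le> q * real (s * s) / 4} \<le> exp (- (q * real (s * s) / 4))"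
proof -
  let ?L = "{..<s} \<times> {..<s}"
  define K1 where "K1 ab = grid_set \<beta> (line ab) 0 d" for ab
  define K2 where "K2 ab = grid_set \<beta> (line ab) d (2 * d)" for ab
  define B where "B ab = shell z \<Delta> (grid_set \<beta> (line ab) 0 (2 * d))" for ab
  define R where "R ab = {z \<triangle> K1 ab, z \<triangle> (K2 ab \<union> \<Delta>)}" for ab
  have BK: "B ab = shell z \<Delta> (K1 ab \<union> K2 ab)" for ab
    by (simp add: B_def K1_def K2_def grid_set_Un)
  have q01: "0 \<le> q" "q \<le> 1"
    using p unfolding q by (auto intro!: mult_le_one power_le_one)
  have K: "K1 ab \<subseteq> {..<n} - \<Delta>" "K2 ab \<subseteq> {..<n} - \<Delta>" "card (K1 ab) = d" "card (K2 ab) = d" "K1 ab \<inter> K2 ab = {}"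
    if "ab \<in> ?L" for ab
  proof -
    have less: "\<And>l. l < 2 * d \<Longrightarrow> line ab l < r"
      using line_less[OF that _ s] .
    show "K1 ab \<subseteq> {..<n} - \<Delta>" "K2 ab \<subseteq> {..<n} - \<Delta>" "card (K1 ab) = d" "card (K2 ab) = d" "K1 ab \<inter> K2 ab = {}"
      unfolding K1_def K2_def using grid_set_sub[OF less] card_grid_set[OF less] grid_set_disj[OF less] by auto
  qed
  have fin\<Delta>: "finite \<Delta>"
    using \<Delta>(1) finite_subset by blast
  have finK: "finite (K1 ab \<union> K2 ab)" "card (K1 ab \<union> K2 ab) \<le> 2 * d" if "ab \<in> ?L" for ab
  proof -
    have "K1 ab \<union> K2 ab \<subseteq> {..<n}"
      using K[OF that] by blast
    then show "finite (K1 ab \<union> K2 ab)"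
      using finite_subset by blast
    show "card (K1 ab \<union> K2 ab) \<le> 2 * d"
      using card_Un_le[of "K1 ab" "K2 ab"] K[OF that] by simp
  qed
  interpret blocks "Pow {..<n}" p ?L B R q
  proof
    show "finite ?L" "finite (Pow {..<n})" "0 \<le> p" "p \<le> 1" "q \<le> 1"
      using p q01 by auto
    show "disjoint_family_on B ?L"
      unfolding disjoint_family_on_def B_def using shell_lines_disjoint[OF s] by blast
    fix ab assume ab: "ab \<in> ?L"
    note Kab = K[OF ab]
    show "B ab \<subseteq> Pow {..<n}"
    proof
      fix x assume "x \<in> B ab"
      then obtain J D where "x = z \<triangle> (J \<union> D)" "J \<subseteq> K1 ab \<union> K2 ab" "D \<subseteq> \<Delta>"
        unfolding BK shell_def by blast
      moreover from this have "J \<union> D \<subseteq> {..<n}"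
        using Kab \<Delta> by blast
      ultimately show "x \<in> Pow {..<n}"
        using sdiff_subset[OF z, of "J \<union> D"] by blast
    qed
    have "z \<triangle> (K1 ab \<union> {}) \<in> B ab"
      unfolding BK shell_def using Kab(3) d by blast
    moreover have "z \<triangle> (K2 ab \<union> \<Delta>) \<in> B ab"
      unfolding BK shell_def using Kab(4) d by blast
    ultimately show RB: "R ab \<subseteq> B ab"
      by (simp add: R_def)
    have "K1 ab \<noteq> {}"
      using Kab(3) d by auto
    then have "K1 ab \<noteq> K2 ab \<union> \<Delta>"
      using Kab(1,5) by blast
    then have R2: "card (R ab) = 2"
      by (simp add: R_def)
    have "card (B ab - R ab) \<le> card (B ab)"
      unfolding BK by (intro card_mono finite_card_shell finK[OF ab] fin\<Delta>) auto
    also have "\<dots> \<le> 2 ^ (card (K1 ab \<union> K2 ab) + card \<Delta>)"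
      unfolding BK by (intro finite_card_shell finK[OF ab] fin\<Delta>)
    also have "\<dots> \<le> 2 ^ (2 * d + 5)"
      using finK(2)[OF ab] \<Delta>(2) by (intro power_increasing) auto
    finally have "card (B ab - R ab) \<le> 2 ^ (2 * d + 5)" .
    then show "q \<le> p ^ card (R ab) * (1 - p) ^ card (B ab - R ab)"
      unfolding q R2 using p by (intro mult_left_mono power_decreasing) auto
  qed
  have "pattern H z \<Delta> (K1 ab) (K2 ab) \<longleftrightarrow> H \<inter> B ab = R ab" for H ab
    by (simp add: pattern_def BK R_def)
  then show ?thesis
    using prob_few_le[OF q01(1)] by (simp add: K1_def[symmetric] K2_def[symmetric] card_cartesian_product)
qed

end

text \<open>\<open>\<beta>\<close> is extensional, which makes the set finite and leaves at most
  \<open>n ^ (2 * d * r)\<close> grids for given \<open>z\<close> and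
  \<open>\<Delta>\<close>.\<close>

definition grids :: "nat \<Rightarrow> nat \<Rightarrow> nat \<Rightarrow> (nat set \<times> nat set \<times> (nat \<times> nat \<Rightarrow> nat)) set" where
  "grids n d r = {(z, \<Delta>, \<beta>). z \<subseteq> {..<n} \<and> \<Delta> \<subseteq> {..<n} \<and> card \<Delta> \<le> 5 \<and>
     \<beta> \<in> ({..<2 * d} \<times> {..<r}) \<rightarrow>\<^sub>E {..<n} \<and> grid n d r \<Delta> \<beta>}"

definition few_patterns :: "nat \<Rightarrow> nat \<Rightarrow> nat \<Rightarrow> nat \<Rightarrow> real \<Rightarrow> nat set set \<Rightarrow> bool" where
  "few_patterns n d r s q H \<longleftrightarrow> (\<exists>(z, \<Delta>, \<beta>)\<in>grids n d r.
     real (card {ab \<in> {..<s} \<times> {..<s}. pattern H z \<Delta> (grid_set \<beta> (line ab) 0 d) (grid_set \<beta> (line ab) d (2 * d))})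
       \<le> q * real (s * s) / 4)"

text \<open>A union bound over at most 2^n vertices \<open>z\<close>, 2^n sets
  \<open>\<Delta>\<close> and, because of 2dr \<le> n, n^n grids.\<close>

lemma prob_few_patterns_le:
  assumes p: "0 < p" "p < 1" and d: "2 \<le> d" and s: "2 * d * s \<le> r" and r: "2 * d * r \<le> n" "0 < n"
    and q: "q = p ^ 2 * (1 - p) ^ (2 ^ (2 * d + 5))"
  shows "measure_pmf.prob (random_subset_pmf (Pow {..<n}) p) {H. few_patterns n d r s q H}
    \<le> 4 ^ n * real n ^ n * exp (- (q * real (s * s) / 4))"
proof -
  let ?S = "\<lambda>(z, \<Delta>, \<beta>). {H.
     real (card {ab \<in> {..<s} \<times> {..<s}. pattern H z \<Delta> (grid_set \<beta> (line ab) 0 d) (grid_set \<beta> (line ab) d (2 * d))})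
       \<le> q * real (s * s) / 4}"
  have sub: "grids n d r \<subseteq> Pow {..<n} \<times> Pow {..<n} \<times> (({..<2 * d} \<times> {..<r}) \<rightarrow>\<^sub>E {..<n})"
    unfolding grids_def by auto
  have fin: "finite (Pow {..<n} \<times> Pow {..<n} \<times> (({..<2 * d} \<times> {..<r}) \<rightarrow>\<^sub>E {..<n}))"
    by (intro finite_cartesian_product finite_PiE) auto
  have "card (grids n d r) \<le> card (Pow {..<n} \<times> Pow {..<n} \<times> (({..<2 * d} \<times> {..<r}) \<rightarrow>\<^sub>E {..<n}))"
    using sub fin by (intro card_mono)
  also have "\<dots> = 2 ^ n * (2 ^ n * n ^ (2 * d * r))"
    by (simp add: card_cartesian_product card_Pow card_PiE)
  also have "\<dots> \<le> 2 ^ n * (2 ^ n * n ^ n)"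
    using r by (intro mult_le_mono power_increasing) auto
  also have "\<dots> = 4 ^ n * n ^ n"
    by (simp only: mult.assoc[symmetric] power_mult_distrib[symmetric]) simp
  finally have "card (grids n d r) \<le> 4 ^ n * n ^ n" .
  then have "real (card (grids n d r)) \<le> real (4 ^ n * n ^ n)"
    by (rule of_nat_mono)
  then have card: "real (card (grids n d r)) \<le> 4 ^ n * real n ^ n"
    by simp
  have "measure_pmf.prob (random_subset_pmf (Pow {..<n}) p) {H. \<exists>i\<in>grids n d r. H \<in> ?S i}
    \<le> 4 ^ n * real n ^ n * exp (- (q * real (s * s) / 4))"
  proof (rule prob_union_le[OF _ _ card])
    show "finite (grids n d r)"
      using sub fin by (rule finite_subset)
    fix i assume i: "i \<in> grids n d r"
    obtain z \<Delta> \<beta> where i_eq: "i = (z, \<Delta>, \<beta>)" by (metis surj_pair)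
    have i': "z \<subseteq> {..<n}" "\<Delta> \<subseteq> {..<n}" "card \<Delta> \<le> 5" "grid n d r \<Delta> \<beta>"
      using i unfolding i_eq grids_def by auto
    interpret grid n d r \<Delta> \<beta> by fact
    show "measure_pmf.prob (random_subset_pmf (Pow {..<n}) p) (?S i) \<le> exp (- (q * real (s * s) / 4))"
      unfolding i_eq prod.case by (rule prob_few_lines_le[OF p d s i'(1,2,3) q])
  qed auto
  moreover have "{H. \<exists>i\<in>grids n d r. H \<in> ?S i} = {H. few_patterns n d r s q H}"
    unfolding few_patterns_def by (auto simp: case_prod_beta)
  ultimately show ?thesis by simp
qed

text \<open>Greedy choice, column by column: before column \<open>m\<close> at most
  \<open>m * r\<close> elements are taken, which leaves \<open>r\<close> of the at least
  \<open>k * r\<close> available ones.\<close>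

lemma grid_exists:
  fixes X :: "nat \<Rightarrow> 'a set"
  assumes "\<And>l. l < k \<Longrightarrow> finite (X l)" "\<And>l. l < k \<Longrightarrow> k * r \<le> card (X l)"
  shows "\<exists>\<beta>. (\<forall>l<k. \<forall>t<r. \<beta> (l, t) \<in> X l) \<and> inj_on \<beta> ({..<k} \<times> {..<r})"
proof -
  have "\<exists>\<beta>. (\<forall>l<m. \<forall>t<r. \<beta> (l, t) \<in> X l) \<and> inj_on \<beta> ({..<m} \<times> {..<r})" if "m \<le> k" for m
    using that
  proof (induction m)
    case 0
    then show ?case by auto
  next
    case (Suc m)
    then obtain \<beta> where \<beta>: "\<forall>l<m. \<forall>t<r. \<beta> (l, t) \<in> X l" "inj_on \<beta> ({..<m} \<times> {..<r})"
      by auto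
    let ?I = "\<beta> ` ({..<m} \<times> {..<r})"
    have "card ?I \<le> m * r"
      using card_image_le[of "{..<m} \<times> {..<r}" \<beta>] by (simp add: card_cartesian_product)
    moreover have "card (X m) - card ?I \<le> card (X m - ?I)"
      by (rule diff_card_le_card_Diff) auto
    moreover have "Suc m * r \<le> card (X m)"
      using assms(2)[of m] Suc.prems mult_le_mono1[of "Suc m" k r] by linarith
    ultimately have "r \<le> card (X m - ?I)"
      by simp
    then obtain Y where Y: "Y \<subseteq> X m - ?I" "card Y = r" "finite Y"
      using obtain_subset_with_card_n by metis
    then obtain h where h: "bij_betw h {..<r} Y"
      using ex_bij_betw_nat_finite[of Y] by (auto simp: lessThan_atLeast0)
    define \<gamma> where "\<gamma> lt = (if fst lt = m then h (snd lt) else \<beta> lt)" for lt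
    have hY: "h t \<in> Y" if "t < r" for t
      using bij_betwE[OF h] that by auto
    have "\<forall>l<Suc m. \<forall>t<r. \<gamma> (l, t) \<in> X l"
      using \<beta>(1) hY Y(1) by (auto simp: \<gamma>_def less_Suc_eq)
    moreover have "inj_on \<gamma> ({..<Suc m} \<times> {..<r})"
    proof -
      have eq: "{..<Suc m} \<times> {..<r} = {..<m} \<times> {..<r} \<union> {m} \<times> {..<r}"
        by (auto simp: less_Suc_eq)
      have "inj_on \<gamma> ({..<m} \<times> {..<r})"
        using \<beta>(2) by (rule inj_on_cong[THEN iffD1, rotated]) (auto simp: \<gamma>_def)
      moreover have "inj_on \<gamma> ({m} \<times> {..<r})"
        using bij_betw_imp_inj_on[OF h] by (auto simp: inj_on_def \<gamma>_def)
      moreover have "\<gamma> ` ({..<m} \<times> {..<r}) = ?I"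
        by (intro image_cong refl) (auto simp: \<gamma>_def)
      moreover have "\<gamma> ` ({m} \<times> {..<r}) \<subseteq> Y"
        using hY by (auto simp: \<gamma>_def)
      ultimately show ?thesis
        unfolding eq inj_on_Un using Y(1) by blast
    qed
    ultimately show ?case by blast
  qed
  then show ?thesis by blast
qed

text \<open>The lines are only s^2 of the r^(2d) transversals of a grid. Shifting the columns
  cyclically gives grids again, each with many good lines, and for a fixed line different shifts
  give different transversals of the original grid. On average a proportion of at least
  \<open>q / 4\<close> of all transversals is therefore good, whatever \<open>s\<close> is. With the
  first \<open>d\<close> columns in \<open>X1\<close> and the others in \<open>X2\<close>, distinct
  good transversals are distinct patterns.\<close>

lemma card_patterns_ge:
  assumes few: "\<not> few_patterns n d r s q H" and d: "2 \<le> d" and s: "2 * d * s \<le> r" "0 < s"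
    and z: "z \<subseteq> {..<n}" and \<Delta>: "\<Delta> \<subseteq> {..<n}" "card \<Delta> \<le> 5"
    and X: "X1 \<subseteq> {..<n} - \<Delta>" "X2 \<subseteq> {..<n} - \<Delta>" "2 * d * r \<le> card X1" "2 * d * r \<le> card X2"
  shows "q / 4 * real r ^ (2 * d) \<le> real (card (patterns H d z \<Delta> X1 X2))"
proof -
  have finX: "finite X1" "finite X2"
    using X(1,2) finite_subset by blast+
  have r: "0 < r"
    using s d by (metis gr0I le_zero_eq mult_is_0 not_numeral_le_zero zero_neq_numeral)
  obtain \<beta> where \<beta>X: "\<And>l t. l < 2 * d \<Longrightarrow> t < r \<Longrightarrow> \<beta> (l, t) \<in> (if l < d then X1 else X2)"
    "inj_on \<beta> ({..<2 * d} \<times> {..<r})"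
  proof -
    have "\<exists>\<beta>. (\<forall>l<2 * d. \<forall>t<r. \<beta> (l, t) \<in> (if l < d then X1 else X2)) \<and> inj_on \<beta> ({..<2 * d} \<times> {..<r})"
      by (rule grid_exists) (use finX X(3,4) in auto)
    then show ?thesis
      using that by blast
  qed
  have \<beta>n: "\<beta> (l, t) \<in> {..<n} - \<Delta>" if "l < 2 * d" "t < r" for l t
    using \<beta>X(1)[OF that] X(1,2) by (auto split: if_splits)
  interpret grid n d r \<Delta> \<beta>
    by (rule grid.intro[OF \<beta>n \<beta>X(2)])
  let ?C = "{..<2 * d} \<rightarrow>\<^sub>E {..<r}"
  let ?L = "{..<s} \<times> {..<s}"
  define good where "good \<gamma> g \<longleftrightarrow> pattern H z \<Delta> (grid_set \<gamma> g 0 d) (grid_set \<gamma> g d (2 * d))" for \<gamma> g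
  define \<gamma> where "\<gamma> c = restrict (\<lambda>(l, t). \<beta> (l, (t + c l) mod r)) ({..<2 * d} \<times> {..<r})" for c :: "nat \<Rightarrow> nat"
  txt \<open>Shifting the columns of the grid by all \<open>c\<close> turns the bound for lines into one for all transversals.\<close>
  define sh where "sh ab c = restrict (\<lambda>l. (line ab l + c l) mod r) {..<2 * d}" for ab and c :: "nat \<Rightarrow> nat"
  define G where "G = {g \<in> ?C. good \<beta> g}"
  have finC: "finite ?C"
    by (intro finite_PiE) auto
  have mod_inj: "t = t'" if "(t + k) mod r = (t' + k) mod r" "t < r" "t' < r" for t t' k
  proof -
    have aux: "a = b" if ab: "(a + k) mod r = (b + k) mod r" "a < r" "b \<le> a" for a b
    proof -
      obtain e where "a + k = b + k + r * e"
        using mod_eq_nat1E[OF ab(1)] ab(3) by auto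
      then show ?thesis
        using ab(2) by (cases e) auto
    qed
    show ?thesis
      using aux[of t t'] aux[of t' t] that by (cases "t' \<le> t") auto
  qed
  have gridc: "(z, \<Delta>, \<gamma> c) \<in> grids n d r" for c
  proof -
    have in_n: "\<gamma> c (l, t) \<in> {..<n} - \<Delta>" if "l < 2 * d" "t < r" for l t
      using that r \<beta>n by (simp add: \<gamma>_def)
    have "inj_on (\<gamma> c) ({..<2 * d} \<times> {..<r})"
    proof (rule inj_onI)
      fix u v assume uv: "u \<in> {..<2 * d} \<times> {..<r}" "v \<in> {..<2 * d} \<times> {..<r}" "\<gamma> c u = \<gamma> c v"
      obtain l t l' t' where lt: "u = (l, t)" "v = (l', t')"
        by (metis surj_pair)
      have *: "l < 2 * d" "t < r" "l' < 2 * d" "t' < r" "\<gamma> c (l, t) = \<gamma> c (l', t')"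
        using uv unfolding lt by auto
      then have "\<beta> (l, (t + c l) mod r) = \<beta> (l', (t' + c l') mod r)"
        by (simp add: \<gamma>_def)
      from grid_inj[OF this] have "l = l'" "(t + c l) mod r = (t' + c l') mod r"
        using * r by auto
      then show "u = v"
        unfolding lt using mod_inj[of t "c l" t'] * by simp
    qed
    then have "grid n d r \<Delta> (\<gamma> c)"
      using in_n by (intro grid.intro)
    moreover have "\<gamma> c \<in> ({..<2 * d} \<times> {..<r}) \<rightarrow>\<^sub>E {..<n}"
      using r \<beta>n by (auto simp: \<gamma>_def)
    ultimately show ?thesis
      unfolding grids_def using z \<Delta> by blast
  qed
  have sh_eq: "grid_set (\<gamma> c) (line ab) lo hi = grid_set \<beta> (sh ab c) lo hi" if "ab \<in> ?L" "hi \<le> 2 * d" for c ab lo hi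
    unfolding grid_set_def using line_less[OF that(1) _ s(1)] that(2) by (intro image_cong refl) (auto simp: \<gamma>_def sh_def)
  have count: "q * real (s * s) / 4 \<le> real (card {ab \<in> ?L. good \<beta> (sh ab c)})" for c
  proof -
    have "\<not> real (card {ab \<in> ?L. good (\<gamma> c) (line ab)}) \<le> q * real (s * s) / 4"
      using few gridc[of c] unfolding few_patterns_def good_def by blast
    moreover have "{ab \<in> ?L. good (\<gamma> c) (line ab)} = {ab \<in> ?L. good \<beta> (sh ab c)}"
      unfolding good_def by (intro Collect_cong conj_cong refl) (simp add: sh_eq)
    ultimately show ?thesis by simp
  qed
  have inj_sh: "card {c \<in> ?C. good \<beta> (sh ab c)} \<le> card G" for ab
  proof (rule card_inj_on_le[of "sh ab"])
    show "inj_on (sh ab) {c \<in> ?C. good \<beta> (sh ab c)}"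
    proof (rule inj_onI)
      fix c c' assume c: "c \<in> {c \<in> ?C. good \<beta> (sh ab c)}" "c' \<in> {c \<in> ?C. good \<beta> (sh ab c)}" "sh ab c = sh ab c'"
      show "c = c'"
      proof (rule PiE_ext)
        show "c \<in> ?C" "c' \<in> ?C" using c by auto
        fix l assume l: "l \<in> {..<2 * d}"
        then have "(line ab l + c l) mod r = (line ab l + c' l) mod r"
          using fun_cong[OF c(3), of l] by (simp add: sh_def)
        then show "c l = c' l"
          using mod_inj[of "c l" "line ab l" "c' l"] PiE_mem[of c "{..<2 * d}" "\<lambda>_. {..<r}" l]
            PiE_mem[of c' "{..<2 * d}" "\<lambda>_. {..<r}" l] c(1,2) l
          by (simp add: add.commute)
      qed
    qed
    show "sh ab ` {c \<in> ?C. good \<beta> (sh ab c)} \<subseteq> G"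
    proof (rule image_subsetI)
      fix c assume c: "c \<in> {c \<in> ?C. good \<beta> (sh ab c)}"
      have "sh ab c \<in> ?C"
        unfolding sh_def using r by (intro restrict_PiE_iff[THEN iffD2]) simp
      then show "sh ab c \<in> G"
        using c unfolding G_def by blast
    qed
    show "finite G"
      using finC by (simp add: G_def)
  qed
  \<comment> \<open>Double counting of the pairs of a shift and a line that is good after this
    shift.\<close>
  have "real r ^ (2 * d) * (q * real (s * s) / 4) = (\<Sum>c\<in>?C. q * real (s * s) / 4)"
    by (simp add: card_PiE)
  also have "\<dots> \<le> (\<Sum>c\<in>?C. real (card {ab \<in> ?L. good \<beta> (sh ab c)}))"
    by (intro sum_mono count)
  also have "\<dots> = (\<Sum>c\<in>?C. \<Sum>ab\<in>?L. of_bool (good \<beta> (sh ab c)))"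
    by (intro sum.cong refl) (simp add: Int_def sum.inter_filter[symmetric] of_bool_def flip: sum.inter_filter)
  also have "\<dots> = (\<Sum>ab\<in>?L. \<Sum>c\<in>?C. of_bool (good \<beta> (sh ab c)))"
    by (rule sum.swap)
  also have "\<dots> = (\<Sum>ab\<in>?L. real (card {c \<in> ?C. good \<beta> (sh ab c)}))"
    using finC by (intro sum.cong refl) (simp add: Int_def)
  also have "\<dots> \<le> (\<Sum>ab\<in>?L. real (card G))"
    by (intro sum_mono) (use inj_sh in auto)
  also have "\<dots> = real (s * s) * real (card G)"
    by (simp add: card_cartesian_product)
  finally have "real (s * s) * (q / 4 * real r ^ (2 * d)) \<le> real (s * s) * real (card G)"
    by (simp add: mult_ac)
  then have "q / 4 * real r ^ (2 * d) \<le> real (card G)"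
    using s(2) by (subst (asm) mult_le_cancel_left_pos) auto
  also have "card G \<le> card (patterns H d z \<Delta> X1 X2)"
  proof (rule card_inj_on_le[of "\<lambda>g. (grid_set \<beta> g 0 d, grid_set \<beta> g d (2 * d))"])
    have less: "g l < r" if "g \<in> G" "l < 2 * d" for g l
      using that by (auto simp: G_def)
    show "inj_on (\<lambda>g. (grid_set \<beta> g 0 d, grid_set \<beta> g d (2 * d))) G"
    proof (rule inj_onI)
      fix g g' assume g: "g \<in> G" "g' \<in> G" "(grid_set \<beta> g 0 d, grid_set \<beta> g d (2 * d)) = (grid_set \<beta> g' 0 d, grid_set \<beta> g' d (2 * d))"
      then have eq: "grid_set \<beta> g 0 (2 * d) = grid_set \<beta> g' 0 (2 * d)"
        by (simp flip: grid_set_Un)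
      show "g = g'"
      proof (rule PiE_ext)
        show "g \<in> ?C" "g' \<in> ?C" using g by (auto simp: G_def)
        fix l assume "l \<in> {..<2 * d}"
        then have l: "l < 2 * d" by simp
        then have "\<beta> (l, g l) \<in> grid_set \<beta> g 0 (2 * d)"
          unfolding grid_set_def by auto
        then have "\<beta> (l, g l) \<in> grid_set \<beta> g' 0 (2 * d)"
          unfolding eq .
        then show "g l = g' l"
          using grid_set_memD[where g = g' and l = l and t = "g l", OF less[OF g(2)]] l less[OF g(1)] by auto
      qed
    qed
    show "(\<lambda>g. (grid_set \<beta> g 0 d, grid_set \<beta> g d (2 * d))) ` G \<subseteq> patterns H d z \<Delta> X1 X2"
    proof (rule image_subsetI)
      fix g assume g: "g \<in> G"
      note lg = less[OF g]
      have "\<beta> (l, g l) \<in> X1" if "l < d" for l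
        using \<beta>X(1)[of l "g l"] lg[of l] that by simp
      then have "grid_set \<beta> g 0 d \<subseteq> X1"
        unfolding grid_set_def by (intro image_subsetI) simp
      moreover have "\<beta> (l, g l) \<in> X2" if "d \<le> l" "l < 2 * d" for l
        using \<beta>X(1)[of l "g l"] lg[of l] that by simp
      then have "grid_set \<beta> g d (2 * d) \<subseteq> X2"
        unfolding grid_set_def by (intro image_subsetI) simp
      moreover have "good \<beta> g"
        using g by (simp add: G_def)
      ultimately show "(grid_set \<beta> g 0 d, grid_set \<beta> g d (2 * d)) \<in> patterns H d z \<Delta> X1 X2"
        using card_grid_set[OF lg] grid_set_disj[OF lg] by (simp add: patterns_def good_def)
    qed
    show "finite (patterns H d z \<Delta> X1 X2)"
      using X by (intro finite_patterns[of _ n]) auto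
  qed
  finally show ?thesis by simp
qed

section \<open>Further typical properties of random families\<close>

lemma prob_mono_support:
  assumes "finite A" "0 \<le> p" "p \<le> 1" "\<And>V. V \<subseteq> A \<Longrightarrow> V \<in> S \<Longrightarrow> V \<in> T"
  shows "measure_pmf.prob (random_subset_pmf A p) S \<le> measure_pmf.prob (random_subset_pmf A p) T"
  using assms by (simp add: prob_eq_wexp) (intro wexp_mono; auto)

text \<open>For \<open>\<theta>\<close> near 1 the bound is about (2 (1 - p))^n times (1 / (1 -
  \<open>\<theta>\<close>))^t, which is small if p > 1/2 and \<open>t\<close> is a small multiple of
  \<open>n\<close>.\<close>

lemma prob_few_neighbors_le:
  assumes p: "0 \<le> p" "p \<le> 1" and \<theta>: "0 \<le> \<theta>" "\<theta> < 1"
  shows "measure_pmf.prob (random_subset_pmf (Pow {..<n}) p)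
    {H. \<exists>x\<in>Pow {..<n}. H \<in> {H. card {i. i < n \<and> x \<triangle> {i} \<in> H} \<le> t}} \<le> 2 ^ n * ((1 - \<theta> * p) ^ n / (1 - \<theta>) ^ t)"
proof (rule prob_union_le)
  show "0 \<le> (1 - \<theta> * p) ^ n / (1 - \<theta>) ^ t"
    using p \<theta> by (simp add: mult_le_one)
  fix x assume x: "x \<in> Pow {..<n}"
  have sub: "x \<triangle> {i} \<subseteq> {..<n}" if "i < n" for i
    using x that by (intro sdiff_subset) auto
  interpret blocks "Pow {..<n}" p "{..<n}" "\<lambda>i. {x \<triangle> {i}}" "\<lambda>i. {x \<triangle> {i}}" p
    using p sub by unfold_locales (simp_all add: disjoint_family_on_def)
  have "{i \<in> {..<n}. H \<inter> {x \<triangle> {i}} = {x \<triangle> {i}}} = {i. i < n \<and> x \<triangle> {i} \<in> H}" for H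
    by auto
  then show "measure_pmf.prob (random_subset_pmf (Pow {..<n}) p) {H. card {i. i < n \<and> x \<triangle> {i} \<in> H} \<le> t}
     \<le> (1 - \<theta> * p) ^ n / (1 - \<theta>) ^ t"
    using prob_count_le[of \<theta> t] \<theta> by (simp add: pos_le_divide_eq mult.commute)
qed (auto simp: card_Pow)

text \<open>The mirror image for p < 1/2: now the prescribed trace on each block is empty.\<close>

lemma prob_few_missing_le:
  assumes p: "0 \<le> p" "p \<le> 1" and \<theta>: "0 \<le> \<theta>" "\<theta> < 1"
  shows "measure_pmf.prob (random_subset_pmf (Pow {..<n}) p)
    {H. \<exists>x\<in>Pow {..<n}. H \<in> {H. card {i. i < n \<and> x \<triangle> {i} \<notin> H} \<le> t}} \<le> 2 ^ n * ((1 - \<theta> * (1 - p)) ^ n / (1 - \<theta>) ^ t)"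
proof (rule prob_union_le)
  show "0 \<le> (1 - \<theta> * (1 - p)) ^ n / (1 - \<theta>) ^ t"
    using p \<theta> by (simp add: mult_le_one)
  fix x assume x: "x \<in> Pow {..<n}"
  have sub: "x \<triangle> {i} \<subseteq> {..<n}" if "i < n" for i
    using x that by (intro sdiff_subset) auto
  interpret blocks "Pow {..<n}" p "{..<n}" "\<lambda>i. {x \<triangle> {i}}" "\<lambda>i. {}" "1 - p"
    using p sub by unfold_locales (simp_all add: disjoint_family_on_def)
  have "{i \<in> {..<n}. H \<inter> {x \<triangle> {i}} = {}} = {i. i < n \<and> x \<triangle> {i} \<notin> H}" for H
    by auto
  then show "measure_pmf.prob (random_subset_pmf (Pow {..<n}) p) {H. card {i. i < n \<and> x \<triangle> {i} \<notin> H} \<le> t}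
     \<le> (1 - \<theta> * (1 - p)) ^ n / (1 - \<theta>) ^ t"
    using prob_count_le[of \<theta> t] \<theta> by (simp add: pos_le_divide_eq mult.commute)
qed (auto simp: card_Pow)

text \<open>About n^2/2 points have distance 2 from \<open>x\<close>, so the probability that all
  are absent beats the 2^n choices of \<open>x\<close> even if p is a small negative power of n. The
  n neighbours would not be enough, since (1 - p)^n exceeds 2^(-n) for p < 1/2.\<close>

lemma prob_far_le:
  assumes p: "0 \<le> p" "p \<le> 1"
  shows "measure_pmf.prob (random_subset_pmf (Pow {..<n}) p)
    {H. \<exists>x\<in>Pow {..<n}. H \<in> {H. \<forall>y\<in>H. \<not> card (x \<triangle> y) \<le> 2}} \<le> 2 ^ n * (1 - p) ^ (n choose 2)"
proof (rule prob_union_le)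
  show "0 \<le> (1 - p) ^ (n choose 2)"
    using p by simp
  fix x assume x: "x \<in> Pow {..<n}"
  let ?L = "{T. T \<subseteq> {..<n} \<and> card T = 2}"
  have "finite ?L"
    by (rule finite_subset[of _ "Pow {..<n}"]) auto
  moreover have "x \<triangle> T \<subseteq> {..<n}" if "T \<subseteq> {..<n}" for T
    using x that by (intro sdiff_subset) auto
  ultimately interpret blocks "Pow {..<n}" p ?L "\<lambda>T. {x \<triangle> T}" "\<lambda>T. {x \<triangle> T}" p
    using p by unfold_locales (simp_all add: disjoint_family_on_def)
  have "measure_pmf.prob (random_subset_pmf (Pow {..<n}) p) {H. \<forall>y\<in>H. \<not> card (x \<triangle> y) \<le> 2} \<le>
    measure_pmf.prob (random_subset_pmf (Pow {..<n}) p) {V. \<forall>T\<in>?L. V \<inter> {x \<triangle> T} \<noteq> {x \<triangle> T}}"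
  proof (rule measure_pmf.finite_measure_mono)
    show "{H. \<forall>y\<in>H. \<not> card (x \<triangle> y) \<le> 2} \<subseteq> {V. \<forall>T\<in>?L. V \<inter> {x \<triangle> T} \<noteq> {x \<triangle> T}}"
    proof (intro subsetI CollectI ballI notI)
      fix H T assume H: "H \<in> {H. \<forall>y\<in>H. \<not> card (x \<triangle> y) \<le> 2}" and T: "T \<in> ?L" and "H \<inter> {x \<triangle> T} = {x \<triangle> T}"
      then have "x \<triangle> T \<in> H" by blast
      then have "\<not> card (x \<triangle> (x \<triangle> T)) \<le> 2" using H by blast
      then show False using T by simp
    qed
  qed auto
  also have "\<dots> \<le> (1 - p) ^ card ?L"
    by (rule prob_none_le)
  finally show "measure_pmf.prob (random_subset_pmf (Pow {..<n}) p) {H. \<forall>y\<in>H. \<not> card (x \<triangle> y) \<le> 2} \<le> (1 - p) ^ (n choose 2)"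
    by (simp add: n_subsets)
qed (auto simp: card_Pow)

section \<open>Events behind the upper bounds\<close>

definition star :: "nat \<Rightarrow> nat set \<Rightarrow> nat set set" where
  "star n z = insert z ((\<lambda>i. z \<triangle> {i}) ` {..<n})"

lemma card_star: "card (star n z) = n + 1"
proof -
  have "inj_on (\<lambda>i. z \<triangle> {i}) {..<n}"
    by (rule inj_onI) simp
  moreover have "z \<notin> (\<lambda>i. z \<triangle> {i}) ` {..<n}"
    by (metis (no_types, lifting) imageE insert_not_empty sdiff_eq_self(1))
  ultimately show ?thesis
    by (simp add: star_def card_image)
qed

lemma star_sub: "z \<subseteq> {..<n} \<Longrightarrow> star n z \<subseteq> Pow {..<n}"
  unfolding star_def by (intro insert_subsetI image_subsetI PowI sdiff_subset) auto

text \<open>In a maximal disjoint family of stars every star meets the star of some centre. So every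
  point is reached from a centre in two steps, each of them empty or along an edge, and a centre has
  at most (n + 1)^2 such walks.\<close>

lemma star_packing:
  obtains C where "C \<subseteq> Pow {..<n}" "disjoint_family_on (star n) C" "2 ^ n \<le> card C * (n + 1)\<^sup>2"
proof -
  let ?F = "{C. C \<subseteq> Pow {..<n} \<and> disjoint_family_on (star n) C}"
  have "finite ?F"
    by (rule finite_subset[of _ "Pow (Pow {..<n})"]) auto
  moreover have "{} \<in> ?F"
    by (simp add: disjoint_family_on_def)
  ultimately obtain C where C: "C \<in> ?F" "\<And>C'. C' \<in> ?F \<Longrightarrow> C \<subseteq> C' \<Longrightarrow> C = C'"
    using finite_has_maximal2[of ?F "{}"] by auto
  let ?S = "insert {} ((\<lambda>i. {i}) ` {..<n})"
  have C1: "C \<subseteq> Pow {..<n}" "disjoint_family_on (star n) C"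
    using C(1) by auto
  have finC: "finite C"
    using C1(1) by (rule finite_subset) simp
  have star_eq: "star n z = (\<lambda>S. z \<triangle> S) ` ?S" for z
    by (simp add: star_def image_image)
  have "Pow {..<n} \<subseteq> (\<lambda>(c, S, T). c \<triangle> S \<triangle> T) ` (C \<times> ?S \<times> ?S)"
  proof
    fix x assume x: "x \<in> Pow {..<n}"
    have "\<exists>c\<in>C. star n c \<inter> star n x \<noteq> {}"
    proof (rule ccontr)
      assume neg: "\<not> (\<exists>c\<in>C. star n c \<inter> star n x \<noteq> {})"
      then have "insert x C \<in> ?F"
        using C1 x by (auto simp: disjoint_family_on_def)
      then have "x \<in> C"
        using C(2)[of "insert x C"] by blast
      then have "star n x \<inter> star n x = {}"
        using neg by blast
      then show False
        by (simp add: star_def)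
    qed
    then obtain c y where c: "c \<in> C" "y \<in> star n c" "y \<in> star n x" by blast
    then obtain S T where "S \<in> ?S" "T \<in> ?S" "y = c \<triangle> S" "y = x \<triangle> T"
      unfolding star_eq by blast
    then have "x = c \<triangle> S \<triangle> T"
      by (metis sdiff_self(3))
    then show "x \<in> (\<lambda>(c, S, T). c \<triangle> S \<triangle> T) ` (C \<times> ?S \<times> ?S)"
      using c(1) \<open>S \<in> ?S\<close> \<open>T \<in> ?S\<close> by (intro image_eqI[of _ _ "(c, S, T)"]) auto
  qed
  then have "card (Pow {..<n}) \<le> card (C \<times> ?S \<times> ?S)"
    using finC by (intro card_le_image[OF _ _ le_refl]) auto
  moreover have "card ?S \<le> n + 1"
    using card_insert_le_m1[of "n + 1" "(\<lambda>i. {i}) ` {..<n}" "{}"] card_image_le[of "{..<n}" "\<lambda>i. {i}"] by simp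
  then have "card (C \<times> ?S \<times> ?S) \<le> card C * ((n + 1) * (n + 1))"
    unfolding card_cartesian_product by (intro mult_le_mono) auto
  ultimately show ?thesis
    using that[OF C1] by (simp add: card_Pow power2_eq_square)
qed

text \<open>The stars of a packing are independent, and each is contained in \<open>H\<close> with
  probability p^(n + 1). Up to the polynomial loss of the packing the exponent is p (2p)^n, which
  grows for p > 1/2.\<close>

lemma prob_no_star_le:
  assumes p: "0 \<le> p" "p \<le> 1"
  shows "measure_pmf.prob (random_subset_pmf (Pow {..<n}) p) {H. \<forall>z\<in>Pow {..<n}. \<not> star n z \<subseteq> H}
    \<le> exp (- (p ^ (n + 1) * (2 ^ n / (real n + 1)\<^sup>2)))"
proof -
  obtain C where C: "C \<subseteq> Pow {..<n}" "disjoint_family_on (star n) C" "2 ^ n \<le> card C * (n + 1)\<^sup>2"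
    using star_packing .
  have C_sub: "\<And>z. z \<in> C \<Longrightarrow> z \<subseteq> {..<n}"
    using C(1) by blast
  interpret blocks "Pow {..<n}" p C "star n" "star n" "p ^ (n + 1)"
    using p C star_sub[OF C_sub] by unfold_locales (auto simp: card_star power_le_one mult_le_one intro: finite_subset)
  have "measure_pmf.prob (random_subset_pmf (Pow {..<n}) p) {H. \<forall>z\<in>Pow {..<n}. \<not> star n z \<subseteq> H} \<le>
    measure_pmf.prob (random_subset_pmf (Pow {..<n}) p) {V. \<forall>z\<in>C. V \<inter> star n z \<noteq> star n z}"
  proof (rule measure_pmf.finite_measure_mono)
    show "{H. \<forall>z\<in>Pow {..<n}. \<not> star n z \<subseteq> H} \<subseteq> {V. \<forall>z\<in>C. V \<inter> star n z \<noteq> star n z}"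
    proof (intro subsetI CollectI ballI notI)
      fix H z assume H: "H \<in> {H. \<forall>z\<in>Pow {..<n}. \<not> star n z \<subseteq> H}" and "z \<in> C" "H \<inter> star n z = star n z"
      then have "star n z \<subseteq> H" "z \<in> Pow {..<n}"
        using C(1) by blast+
      then show False using H by blast
    qed
  qed auto
  also have "\<dots> \<le> (1 - p ^ (n + 1)) ^ card C"
    by (rule prob_none_le)
  also have "\<dots> \<le> exp (- (p ^ (n + 1))) ^ card C"
    using exp_ge_add_one_self[of "- (p ^ (n + 1))"] q1 by (intro power_mono) auto
  also have "\<dots> = exp (- (p ^ (n + 1) * real (card C)))"
    by (simp add: mult.commute flip: exp_of_nat_mult)
  also have "\<dots> \<le> exp (- (p ^ (n + 1) * (2 ^ n / (real n + 1)\<^sup>2)))"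
  proof -
    have "real (2 ^ n) \<le> real (card C * (n + 1)\<^sup>2)"
      using C(3) by (rule of_nat_mono)
    then have "2 ^ n \<le> real (card C) * (real n + 1)\<^sup>2"
      by (simp add: add.commute)
    then have "2 ^ n / (real n + 1)\<^sup>2 \<le> real (card C)"
      by (simp add: pos_divide_le_eq)
    then have "p ^ (n + 1) * (2 ^ n / (real n + 1)\<^sup>2) \<le> p ^ (n + 1) * real (card C)"
      using p by (intro mult_left_mono) auto
    then show ?thesis
      by (simp only: exp_le_cancel_iff neg_le_iff_le)
  qed
  finally show ?thesis .
qed

lemma prob_card_le:
  assumes p: "0 \<le> p" "p \<le> 1"
  shows "measure_pmf.prob (random_subset_pmf (Pow {..<n}) p) {H. real (card H) \<le> p * 2 ^ n / 4} \<le> exp (- (p * 2 ^ n / 4))"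
proof -
  interpret blocks "Pow {..<n}" p "Pow {..<n}" "\<lambda>x. {x}" "\<lambda>x. {x}" p
    using p by unfold_locales (auto simp: disjoint_family_on_def)
  have "measure_pmf.prob (random_subset_pmf (Pow {..<n}) p) {H. real (card H) \<le> p * 2 ^ n / 4} \<le>
    measure_pmf.prob (random_subset_pmf (Pow {..<n}) p) {V. real (card {l \<in> Pow {..<n}. V \<inter> {l} = {l}}) \<le> p * real (card (Pow {..<n})) / 4}"
  proof (rule prob_mono_support)
    fix V assume V: "V \<subseteq> Pow {..<n}" "V \<in> {H. real (card H) \<le> p * 2 ^ n / 4}"
    have "{l \<in> Pow {..<n}. V \<inter> {l} = {l}} = V"
      using V(1) by auto
    then show "V \<in> {V. real (card {l \<in> Pow {..<n}. V \<inter> {l} = {l}}) \<le> p * real (card (Pow {..<n})) / 4}"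
      using V(2) by (simp add: card_Pow)
  qed (use p in auto)
  also have "\<dots> \<le> exp (- (p * real (card (Pow {..<n})) / 4))"
    using p by (intro prob_few_le)
  finally show ?thesis
    by (simp add: card_Pow)
qed

text \<open>Distinct antipodal pairs of the subcube are independent. A fixed \<open>m\<close> in
  \<open>D\<close> names each pair by the one of \<open>S\<close> and \<open>D - S\<close> that
  contains \<open>m\<close>; leaving out \<open>S = D\<close> omits the pair of the two
  ends.\<close>

lemma prob_lonely_le:
  assumes p: "0 \<le> p" "p \<le> 1" and D: "D \<subseteq> {..<n}" "D \<noteq> {}" and u: "u \<subseteq> {..<n}"
  shows "measure_pmf.prob (random_subset_pmf (Pow {..<n}) p) {H. (u, D) \<in> lonely_pairs H}
    \<le> (1 - p\<^sup>2) ^ (2 ^ (card D - 1) - 1)"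
proof -
  obtain m where m: "m \<in> D"
    using D(2) by auto
  have finD: "finite D"
    using D(1) finite_subset by blast
  define L where "L = {S. S \<subseteq> D \<and> m \<in> S \<and> S \<noteq> D}"
  define B where "B S = {u \<triangle> S, u \<triangle> (D - S)}" for S
  have cardL: "card L = 2 ^ (card D - 1) - 1"
  proof -
    have "L = insert m ` (Pow (D - {m}) - {D - {m}})"
    proof -
      have "S \<in> insert m ` (Pow (D - {m}) - {D - {m}})" if "S \<subseteq> D" "m \<in> S" "S \<noteq> D" for S
        using that by (intro image_eqI[of _ _ "S - {m}"]) auto
      then show ?thesis
        using m by (auto simp: L_def)
    qed
    moreover have "inj_on (insert m) (Pow (D - {m}) - {D - {m}})"
      by (auto simp: inj_on_def)
    ultimately have "card L = card (Pow (D - {m}) - {D - {m}})"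
      by (simp add: card_image)
    also have "\<dots> = 2 ^ (card D - 1) - 1"
      using finD m by (simp add: card_Diff_singleton card_Pow)
    finally show ?thesis .
  qed
  have B2: "card (B S) = 2" if "S \<in> L" for S
  proof -
    have "S \<noteq> D - S"
      using that m by (auto simp: L_def)
    then show ?thesis
      by (simp add: B_def)
  qed
  interpret blocks "Pow {..<n}" p L B B "p\<^sup>2"
  proof
    show "finite L"
      by (rule finite_subset[of _ "Pow D"]) (use finD in \<open>auto simp: L_def\<close>)
    show "p\<^sup>2 \<le> 1"
      using p by (simp add: power_le_one)
    show "disjoint_family_on B L"
      unfolding disjoint_family_on_def
    proof (intro ballI impI)
      fix S T assume S: "S \<in> L" "T \<in> L" "S \<noteq> T"
      then have "S \<noteq> D - T" "D - S \<noteq> T" "D - S \<noteq> D - T"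
        using m by (auto simp: L_def)
      then show "B S \<inter> B T = {}"
        using S(3) unfolding B_def by simp
    qed
    show "p\<^sup>2 \<le> p ^ card (B S) * (1 - p) ^ card (B S - B S)" if "S \<in> L" for S
      using B2[OF that] by simp
    show "B S \<subseteq> Pow {..<n}" if "S \<in> L" for S
    proof -
      have "S \<subseteq> {..<n}" "D - S \<subseteq> {..<n}"
        using that D(1) by (auto simp: L_def)
      then show ?thesis
        using sdiff_subset[OF u] unfolding B_def by blast
    qed
  qed (use p in auto)
  have "measure_pmf.prob (random_subset_pmf (Pow {..<n}) p) {H. (u, D) \<in> lonely_pairs H} \<le>
    measure_pmf.prob (random_subset_pmf (Pow {..<n}) p) {V. \<forall>S\<in>L. V \<inter> B S \<noteq> B S}"
  proof (rule measure_pmf.finite_measure_mono)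
    show "{H. (u, D) \<in> lonely_pairs H} \<subseteq> {V. \<forall>S\<in>L. V \<inter> B S \<noteq> B S}"
    proof (intro subsetI CollectI ballI notI)
      fix H S assume "H \<in> {H. (u, D) \<in> lonely_pairs H}" "S \<in> L" "H \<inter> B S = B S"
      then have "u \<triangle> S \<in> H" "u \<triangle> (D - S) \<in> H" "S \<subseteq> D" "m \<in> S" "S \<noteq> D"
        "\<forall>S\<subseteq>D. u \<triangle> S \<in> H \<longrightarrow> u \<triangle> (D - S) \<in> H \<longrightarrow> S = {} \<or> S = D"
        unfolding B_def L_def lonely_pairs_def by blast+
      then show False by blast
    qed
  qed auto
  also have "\<dots> \<le> (1 - p\<^sup>2) ^ card L"
    by (rule prob_none_le)
  finally show ?thesis
    by (simp add: cardL)
qed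

text \<open>First moment: \<open>t\<close> times the indicator of the event is at most the number of
  lonely pairs, and the factor 2^n counts the vertices \<open>u\<close>.\<close>

lemma prob_many_lonely_le:
  assumes p: "0 \<le> p" "p \<le> 1"
  shows "t * measure_pmf.prob (random_subset_pmf (Pow {..<n}) p) {H. t \<le> real (card (lonely_pairs H))}
    \<le> 2 ^ n * (\<Sum>D\<in>Pow {..<n} - {{}}. (1 - p\<^sup>2) ^ (2 ^ (card D - 1) - 1))"
proof -
  let ?I = "Pow {..<n} \<times> (Pow {..<n} - {{}})"
  have "t * measure_pmf.prob (random_subset_pmf (Pow {..<n}) p) {H. t \<le> real (card (lonely_pairs H))} =
    wexp p (Pow {..<n}) (\<lambda>H. t * of_bool (H \<in> {H. t \<le> real (card (lonely_pairs H))}))"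
    using p by (simp add: prob_eq_wexp wexp_cmult)
  also have "\<dots> \<le> wexp p (Pow {..<n}) (\<lambda>H. \<Sum>(u, D)\<in>?I. of_bool (H \<in> {H. (u, D) \<in> lonely_pairs H}))"
  proof (rule wexp_mono[OF p])
    fix H assume H: "H \<subseteq> Pow {..<n}"
    interpret set_family n H by unfold_locales fact
    have "D \<noteq> {}" if "(u, D) \<in> lonely_pairs H" for u D
      using that by (simp add: lonely_pairs_def)
    then have "lonely_pairs H \<subseteq> ?I"
      using lonely_pairs_sub by blast
    then have "(\<Sum>i\<in>?I. of_bool (i \<in> lonely_pairs H)) = real (card (lonely_pairs H))"
      by (subst sum.mono_neutral_right[of ?I "lonely_pairs H"]) auto
    moreover have "(\<Sum>(u, D)\<in>?I. of_bool (H \<in> {H. (u, D) \<in> lonely_pairs H})) = (\<Sum>i\<in>?I. of_bool (i \<in> lonely_pairs H) :: real)"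
      by (intro sum.cong) auto
    ultimately show "t * of_bool (H \<in> {H. t \<le> real (card (lonely_pairs H))}) \<le>
       (\<Sum>(u, D)\<in>?I. of_bool (H \<in> {H. (u, D) \<in> lonely_pairs H}))"
      by simp
  qed
  also have "\<dots> = (\<Sum>(u, D)\<in>?I. measure_pmf.prob (random_subset_pmf (Pow {..<n}) p) {H. (u, D) \<in> lonely_pairs H})"
    unfolding case_prod_beta wexp_sum using p by (simp add: prob_eq_wexp)
  also have "\<dots> \<le> (\<Sum>(u, D)\<in>?I. (1 - p\<^sup>2) ^ (2 ^ (card D - 1) - 1))"
    by (rule sum_mono) (use p prob_lonely_le in auto)
  also have "\<dots> = 2 ^ n * (\<Sum>D\<in>Pow {..<n} - {{}}. (1 - p\<^sup>2) ^ (2 ^ (card D - 1) - 1))"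
    by (simp add: sum.cartesian_product[symmetric] card_Pow)
  finally show ?thesis .
qed

section \<open>Expansion of typical families\<close>

text \<open>\<open>B\<close> collects the bad families, so that only deterministic statements about
  a single family outside \<open>B\<close> remain to be shown.\<close>

lemma prob_cube_ge:
  assumes p: "0 \<le> p" "p \<le> 1"
    and good: "\<And>H. H \<subseteq> Pow {..<n} \<Longrightarrow> H \<notin> B \<Longrightarrow>
      a \<le> edge_expansion H (cube_edges H) \<and> edge_expansion H (cube_edges H) \<le> b"
    and B: "measure_pmf.prob (random_subset_pmf (Pow {..<n}) p) B \<le> e"
  shows "1 - e \<le> measure_pmf.prob (random_subset_pmf (cube n) p)
    {V. a \<le> polytope_expansion (convex hull V) \<and> polytope_expansion (convex hull V) \<le> b}"
proof -
  let ?M = "random_subset_pmf (Pow {..<n}) p"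
  let ?G = "{H. a \<le> polytope_expansion (convex hull (ind ` H)) \<and> polytope_expansion (convex hull (ind ` H)) \<le> b}"
  have "measure_pmf.prob ?M (- ?G) \<le> measure_pmf.prob ?M B"
  proof (rule prob_mono_support)
    fix H assume HP: "H \<subseteq> Pow {..<n}" and HG: "H \<in> - ?G"
    interpret set_family n H by unfold_locales fact
    show "H \<in> B"
      using good[OF HP] HG by (auto simp: polytope_expansion_eq)
  qed (use p in auto)
  moreover have "measure_pmf.prob ?M (- ?G) = 1 - measure_pmf.prob ?M ?G"
    using measure_pmf.prob_compl[of ?G ?M] by (simp add: Compl_eq_Diff_UNIV)
  ultimately have "1 - e \<le> measure_pmf.prob ?M ?G"
    using B by linarith
  then show ?thesis
    unfolding cube_eq using p inj_on_ind by (subst prob_random_subset_image) auto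
qed

text \<open>The dense counting lemma bounds the size of \<open>U\<close> by two terms. The first is
  at most 4 / \<open>\<delta>\<close> times the boundary divided by n. The second also gains a
  factor n, from the patterns of order r^6 against n^5 paths through an edge. The constant is the
  sum of both contributions.\<close>

lemma dense_expansion:
  fixes n t r s :: nat and \<delta> \<rho> q q0 :: real
  assumes H: "H \<subseteq> Pow {..<n}"
    and nbs: "\<And>x. x \<subseteq> {..<n} \<Longrightarrow> \<not> card {i. i < n \<and> x \<triangle> {i} \<in> H} \<le> t"
    and pat: "\<not> few_patterns n 3 r s q H" and star: "z \<subseteq> {..<n}" "star n z \<subseteq> H"
    and par: "6 * s \<le> r" "0 < s" "12 * r + 2 \<le> t + 1" "\<delta> * real n \<le> real t + 1" "\<rho> * real n \<le> real r"
      "q0 \<le> q" "0 < q0" "0 < \<delta>" "0 < \<rho>" "0 < n"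
  shows "real n / (4 / \<delta> + 4 * (4 + 14 * 4 ^ 7) / (q0 * \<rho> ^ 6)) \<le> edge_expansion H (cube_edges H)"
    and "edge_expansion H (cube_edges H) \<le> real n"
proof -
  interpret set_family n H by unfold_locales fact
  show "edge_expansion H (cube_edges H) \<le> real n"
    using star(2) par(10) unfolding star_def by (intro edge_expansion_star_le[of z]) auto
  define \<kappa> where "\<kappa> = nat \<lceil>q / 4 * real r ^ 6\<rceil>"
  define Ca where "Ca = 4 / \<delta>"
  define Cb where "Cb = 4 * (4 + 14 * 4 ^ 7) / (q0 * \<rho> ^ 6)"
  have C0: "0 < Ca" "0 < Cb"
    using par by (simp_all add: Ca_def Cb_def)
  have "card (star n z) \<le> card H"
    using star(2) by (intro card_mono) auto
  then have H2: "2 \<le> card H"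
    using par(10) by (simp add: card_star)
  have "real n / (Ca + Cb) \<le> edge_expansion H (cube_edges H)"
  proof (rule edge_expansion_ge[OF finite_H H2])
    fix U assume U: "U \<subseteq> H" "2 * card U \<le> card H"
    let ?b = "card (edge_boundary (cube_edges H) U)"
    have "\<exists>a b. card U \<le> a + b \<and> (t + 1) * a \<le> 4 * ?b \<and> \<kappa> * b \<le> 2 * (2 * n ^ 5 + 7 * 4 ^ 7) * ?b"
    proof (rule card_le_boundary_dense[OF U])
      fix x assume "x \<subseteq> {..<n}"
      then show "t + 1 \<le> card {i. i < n \<and> x \<triangle> {i} \<in> H}"
        using nbs[of x] by simp
    next
      fix z j X1 X2 assume *: "z \<subseteq> {..<n}" "j < n" "X1 \<subseteq> {..<n} - {j}" "X2 \<subseteq> {..<n} - {j}"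
        "t + 1 \<le> 2 * (card X1 + 1)" "t + 1 \<le> 2 * (card X2 + 1)"
      have "q / 4 * real r ^ (2 * 3) \<le> real (card (patterns H 3 z {j} X1 X2))"
        by (rule card_patterns_ge[OF pat]) (use * par in auto)
      then show "\<kappa> \<le> card (patterns H 3 z {j} X1 X2)"
        by (simp add: \<kappa>_def nat_ceiling_le_eq)
    qed
    then obtain a b where ab: "card U \<le> a + b" "(t + 1) * a \<le> 4 * ?b" "\<kappa> * b \<le> 2 * (2 * n ^ 5 + 7 * 4 ^ 7) * ?b"
      by blast
    have "real ((t + 1) * a) \<le> real (4 * ?b)"
      using ab(2) by (rule of_nat_mono)
    moreover have "\<delta> * real n * real a \<le> (real t + 1) * real a"
      using par(4) by (intro mult_right_mono) auto
    ultimately have "\<delta> * real n * real a \<le> 4 * real ?b"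
      by (simp add: algebra_simps)
    then have a: "real n * real a \<le> Ca * real ?b"
      using par(8) by (simp add: Ca_def field_simps)
    have n5: "1 \<le> real n ^ 5"
      using par(10) by simp
    have "real (\<kappa> * b) \<le> real (2 * (2 * n ^ 5 + 7 * 4 ^ 7) * ?b)"
      using ab(3) by (rule of_nat_mono)
    then have "real \<kappa> * real b \<le> (4 * real n ^ 5 + 14 * 4 ^ 7) * real ?b"
      by (simp add: algebra_simps)
    also have "\<dots> \<le> ((4 + 14 * 4 ^ 7) * real n ^ 5) * real ?b"
      using n5 by (intro mult_right_mono) auto
    finally have 1: "real \<kappa> * real b \<le> ((4 + 14 * 4 ^ 7) * real n ^ 5) * real ?b" .
    have "q0 / 4 * (\<rho> * real n) ^ 6 \<le> q / 4 * real r ^ 6"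
      using par by (intro mult_mono power_mono) auto
    also have "\<dots> \<le> real \<kappa>"
      by (simp add: \<kappa>_def real_nat_ceiling_ge)
    finally have "q0 / 4 * (\<rho> * real n) ^ 6 * real b \<le> real \<kappa> * real b"
      by (intro mult_right_mono) auto
    then have "q0 / 4 * (\<rho> * real n) ^ 6 * real b \<le> ((4 + 14 * 4 ^ 7) * real n ^ 5) * real ?b"
      using 1 by linarith
    then have "real n ^ 5 * (q0 * \<rho> ^ 6 * (real n * real b)) \<le> real n ^ 5 * (4 * (4 + 14 * 4 ^ 7) * real ?b)"
      by (simp add: power_mult_distrib eval_nat_numeral field_simps)
    then have "q0 * \<rho> ^ 6 * (real n * real b) \<le> 4 * (4 + 14 * 4 ^ 7) * real ?b"
      using par(10) by (subst (asm) mult_le_cancel_left_pos) auto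
    then have b: "real n * real b \<le> Cb * real ?b"
      using par(7,9) by (simp add: Cb_def field_simps)
    have "real (card U) \<le> real a + real b"
      using ab(1) by (metis of_nat_add of_nat_le_iff)
    then have "real n * real (card U) \<le> real n * (real a + real b)"
      by (intro mult_left_mono) auto
    also have "\<dots> \<le> (Ca + Cb) * real ?b"
      using a b by (simp add: algebra_simps)
    finally show "real n / (Ca + Cb) * real (card U) \<le> real ?b"
      using C0 by (simp add: field_simps)
  qed
  then show "real n / (4 / \<delta> + 4 * (4 + 14 * 4 ^ 7) / (q0 * \<rho> ^ 6)) \<le> edge_expansion H (cube_edges H)"
    by (simp add: Ca_def Cb_def)
qed

text \<open>\<open>lo\<close> is bounded by the number of patterns divided by the number of paths
  through an edge, and \<open>up\<close> bounds the number of lonely pairs per vertex of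
  \<open>H\<close>.\<close>

lemma sparse_expansion:
  fixes n t r s d :: nat and q lo up T :: real
  assumes H: "H \<subseteq> Pow {..<n}"
    and far: "\<And>x. x \<subseteq> {..<n} \<Longrightarrow> \<not> (\<forall>y\<in>H. \<not> card (x \<triangle> y) \<le> 2)"
    and missing: "\<And>x. x \<subseteq> {..<n} \<Longrightarrow> \<not> card {i. i < n \<and> x \<triangle> {i} \<notin> H} \<le> t"
    and pat: "\<not> few_patterns n d r s q H"
    and cardH: "\<not> real (card H) \<le> p * 2 ^ n / 4" and lonely: "\<not> T \<le> real (card (lonely_pairs H))"
    and par: "2 \<le> d" "2 * d * s \<le> r" "0 < s" "2 * d * r + 5 \<le> t + 1" "4 \<le> p * 2 ^ n" "0 < n"
    and lo: "lo * (2 * (2 * ((real n + 1)\<^sup>2 * real n * real n ^ d) + (real n + 1)\<^sup>2 * real n * 4 ^ (2 * d + 5))) \<le> q / 4 * real r ^ (2 * d)"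
    and up: "T \<le> up * (p * 2 ^ n / 4)" "0 \<le> up"
  shows "lo \<le> edge_expansion H (cube_edges H)" "edge_expansion H (cube_edges H) \<le> up"
proof -
  interpret set_family n H by unfold_locales fact
  have H2: "2 \<le> card H"
    using cardH par(5) by linarith
  define \<kappa> where "\<kappa> = nat \<lceil>q / 4 * real r ^ (2 * d)\<rceil>"
  define M where "M = 2 * (2 * ((real n + 1)\<^sup>2 * real n * real n ^ d) + (real n + 1)\<^sup>2 * real n * 4 ^ (2 * d + 5))"
  have M0: "0 < M"
    using par(6) by (simp add: M_def add_pos_pos)
  show "lo \<le> edge_expansion H (cube_edges H)"
  proof (rule edge_expansion_ge[OF finite_H H2])
    fix U assume U: "U \<subseteq> H" "2 * card U \<le> card H"
    let ?b = "card (edge_boundary (cube_edges H) U)"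
    have "\<kappa> * card U \<le> 2 * (2 * ((n + 1)\<^sup>2 * n * n ^ d) + (n + 1)\<^sup>2 * n * 4 ^ (2 * d + 5)) * ?b"
    proof (rule card_le_boundary_sparse[OF U par(1)])
      fix x assume x: "x \<subseteq> {..<n}"
      show "\<exists>y\<in>H. card (x \<triangle> y) \<le> 2"
        using far[OF x] by blast
      show "t + 1 \<le> card {i. i < n \<and> x \<triangle> {i} \<notin> H}"
        using missing[OF x] by simp
    next
      fix z \<Delta> X1 X2 assume *: "z \<subseteq> {..<n}" "\<Delta> \<subseteq> {..<n}" "card \<Delta> \<le> 5" "X1 \<subseteq> {..<n} - \<Delta>" "X2 \<subseteq> {..<n} - \<Delta>"
        "t + 1 \<le> card X1 + 5" "t + 1 \<le> card X2 + 5"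
      have "q / 4 * real r ^ (2 * d) \<le> real (card (patterns H d z \<Delta> X1 X2))"
        by (rule card_patterns_ge[OF pat]) (use * par in auto)
      then show "\<kappa> \<le> card (patterns H d z \<Delta> X1 X2)"
        by (simp add: \<kappa>_def nat_ceiling_le_eq)
    qed
    then have "real (\<kappa> * card U) \<le> real (2 * (2 * ((n + 1)\<^sup>2 * n * n ^ d) + (n + 1)\<^sup>2 * n * 4 ^ (2 * d + 5)) * ?b)"
      by (rule of_nat_mono)
    then have "real \<kappa> * real (card U) \<le> M * real ?b"
      by (simp add: M_def add.commute)
    moreover have "lo * M \<le> real \<kappa>"
      using lo real_nat_ceiling_ge[of "q / 4 * real r ^ (2 * d)"] unfolding M_def[symmetric] \<kappa>_def by linarith
    then have "lo * M * real (card U) \<le> real \<kappa> * real (card U)"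
      by (intro mult_right_mono) auto
    ultimately have "M * (lo * real (card U)) \<le> M * real ?b"
      by (simp add: mult_ac)
    then show "lo * real (card U) \<le> real ?b"
      using M0 by (subst (asm) mult_le_cancel_left_pos) auto
  qed
  have "edge_expansion H (cube_edges H) * real (card H) \<le> T"
    using edge_expansion_le_lonely_pairs[OF H2] lonely by linarith
  also have "T \<le> up * real (card H)"
    using up cardH mult_left_mono[of "p * 2 ^ n / 4" "real (card H)" up] by linarith
  finally show "edge_expansion H (cube_edges H) \<le> up"
    using H2 by (subst (asm) mult_le_cancel_right_pos) auto
qed

text \<open>\<open>P\<close> stands for p or 1 - p, whichever exceeds 1/2. For
  \<open>\<theta> = 1 - e\<close> the numerator with the factor 2^n is at most (1 - e/2)^n, and
  \<open>\<delta>\<close> is chosen such that (1/e)^\<open>\<delta>\<close> = 1 + e/2. The product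
  \<open>\<eta>\<close> of both bases is 1 - e^2/4.\<close>

lemma half_constants:
  fixes e :: real
  assumes e: "0 < e" "e \<le> 1/4"
  obtains \<delta> \<eta> :: real where "0 < \<delta>" "\<delta> < 1" "0 < \<eta>" "\<eta> < 1"
    "\<And>P n t. 1/2 + e \<le> P \<Longrightarrow> P \<le> 1 \<Longrightarrow> real t \<le> \<delta> * real n \<Longrightarrow> 2 ^ n * ((1 - (1 - e) * P) ^ n / (1 - (1 - e)) ^ t) \<le> \<eta> ^ n"
proof -
  define \<delta> where "\<delta> = ln (1 + e / 2) / ln (1 / e)"
  define \<eta> where "\<eta> = (1 - e / 2) * (1 + e / 2)"
  have l: "0 < ln (1 / e)" "0 < ln (1 + e / 2)"
    using e by (simp_all add: ln_gt_zero)
  have "1 + e / 2 < 1 / e"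
  proof -
    have "4 \<le> 1 / e"
      using e by (simp add: field_simps)
    then show ?thesis using e by linarith
  qed
  then have "ln (1 + e / 2) < ln (1 / e)"
    using e by (subst ln_less_cancel_iff) auto
  then have \<delta>: "0 < \<delta>" "\<delta> < 1"
    using l by (simp_all add: \<delta>_def)
  have "\<eta> = 1 - e\<^sup>2 / 4"
    by (simp add: \<eta>_def algebra_simps power2_eq_square)
  moreover have "0 < e\<^sup>2" "e\<^sup>2 < 1"
    using e by (auto simp: power_less_one_iff)
  ultimately have \<eta>: "0 < \<eta>" "\<eta> < 1"
    by simp_all
  have "\<delta> * ln e = - ln (1 + e / 2)"
    using e l by (simp add: \<delta>_def ln_div)
  moreover have "e powr \<delta> = exp (\<delta> * ln e)"
    using e by (simp add: powr_def)
  moreover have "exp (- ln (1 + e / 2)) = 1 / (1 + e / 2)"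
    using e by (subst exp_minus, subst exp_ln) (auto simp: inverse_eq_divide)
  ultimately have pw: "e powr \<delta> = 1 / (1 + e / 2)"
    by (simp only:)
  have "2 ^ n * ((1 - (1 - e) * P) ^ n / (1 - (1 - e)) ^ t) \<le> \<eta> ^ n"
    if P: "1/2 + e \<le> P" "P \<le> 1" and t: "real t \<le> \<delta> * real n" for P n t
  proof -
    have "(e powr \<delta>) ^ n = e powr (\<delta> * real n)"
      using e by (simp add: powr_powr flip: powr_realpow)
    also have "\<dots> \<le> e powr real t"
      using e t by (intro powr_mono') auto
    also have "\<dots> = e ^ t"
      using e by (simp add: powr_realpow)
    finally have et: "(1 / (1 + e / 2)) ^ n \<le> e ^ t"
      by (simp only: pw)
    have "(1 - e) * (1/2 + e) \<le> (1 - e) * P"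
      using e P by (intro mult_left_mono) auto
    moreover have "e\<^sup>2 \<le> e / 4"
      using mult_left_mono[of e "1/4" e] e by (simp add: power2_eq_square)
    moreover have "(1 - e) * (1/2 + e) = 1/2 + e / 2 - e\<^sup>2"
      by (simp add: field_simps power2_eq_square)
    ultimately have "1/2 + e / 4 \<le> (1 - e) * P"
      by linarith
    then have "2 * (1 - (1 - e) * P) \<le> 1 - e / 2"
      by argo
    moreover have "0 \<le> 1 - (1 - e) * P"
      using e P by (simp add: mult_le_one)
    ultimately have num: "(2 * (1 - (1 - e) * P)) ^ n \<le> (1 - e / 2) ^ n"
      by (intro power_mono) auto
    have "2 ^ n * ((1 - (1 - e) * P) ^ n / (1 - (1 - e)) ^ t) = (2 * (1 - (1 - e) * P)) ^ n / e ^ t"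
      unfolding power_mult_distrib by simp
    also have "\<dots> \<le> (1 - e / 2) ^ n / (1 / (1 + e / 2)) ^ n"
      using e et num by (intro frac_le) auto
    also have "\<dots> = \<eta> ^ n"
      unfolding \<eta>_def power_mult_distrib power_one_over by simp
    finally show ?thesis .
  qed
  then show ?thesis
    using that \<delta> \<eta> by blast
qed

section \<open>The dense regime\<close>

lemma tendsto_prob_1I:
  assumes "\<forall>\<^sub>F n in sequentially. 1 - e n \<le> measure_pmf.prob (M n) (S n)" "e \<longlonglongrightarrow> (0 :: real)"
  shows "(\<lambda>n. measure_pmf.prob (M n) (S n)) \<longlonglongrightarrow> 1"
proof (rule tendsto_sandwich[OF assms(1)])
  have "(\<lambda>n. 1 - e n) \<longlonglongrightarrow> 1 - 0"
    by (intro tendsto_intros assms(2))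
  then show "(\<lambda>n. 1 - e n) \<longlonglongrightarrow> 1" by simp
  show "(\<lambda>n. 1 :: real) \<longlonglongrightarrow> 1" by simp
  show "\<forall>\<^sub>F n in sequentially. measure_pmf.prob (M n) (S n) \<le> 1" by simp
qed

lemma measure_pmf_Un_le3:
  "measure_pmf.prob M (A \<union> B \<union> C) \<le> measure_pmf.prob M A + measure_pmf.prob M B + measure_pmf.prob M C"
  using measure_Un_le[of "A \<union> B" "measure_pmf M" C] measure_Un_le[of A "measure_pmf M" B] by simp

lemma dense_whp:
  fixes \<epsilon> :: real
  assumes "\<epsilon> > 0"
  shows "\<exists>c C. 0 < c \<and> 0 < C \<and>
       (\<forall>p :: nat \<Rightarrow> real.
          (\<forall>\<^sub>F n in sequentially. p n \<in> {1/2 + \<epsilon> <..< 1 - \<epsilon>}) \<longrightarrow>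
          (\<lambda>n. measure_pmf.prob (random_subset_pmf (cube n) (p n))
                 {V. c * real n \<le> polytope_expansion (convex hull V) \<and>
                     polytope_expansion (convex hull V) \<le> C * real n}) \<longlonglongrightarrow> 1)"
proof -
  \<comment> \<open>Capping at 1/4 only enlarges the range of p and makes
    \<open>half_constants\<close> applicable.\<close>
  define e where "e = min \<epsilon> (1/4)"
  have e: "0 < e" "e \<le> 1/4" "e \<le> \<epsilon>"
    using assms by (auto simp: e_def)
  obtain \<delta> \<eta> where de: "0 < \<delta>" "\<delta> < 1" "0 < \<eta>" "\<eta> < 1"
    "\<And>P n t. 1/2 + e \<le> P \<Longrightarrow> P \<le> 1 \<Longrightarrow> real t \<le> \<delta> * real n \<Longrightarrow> 2 ^ n * ((1 - (1 - e) * P) ^ n / (1 - (1 - e)) ^ t) \<le> \<eta> ^ n"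
    using half_constants[OF e(1,2)] by metis
  \<comment> \<open>A lower bound for p^2 (1 - p)^(2^11), from p \<ge> 1/2 and 1 - p \<ge> e; the
    exponent is 2 * 3 + 5 = 11.\<close>
  define q0 where "q0 = 1/4 * e ^ (2 ^ 11)"
  have q0: "0 < q0"
    using e by (simp add: q0_def)
  define \<rho> where "\<rho> = \<delta> / 48"
  have \<rho>: "0 < \<rho>"
    using de by (simp add: \<rho>_def)
  define c where "c = 1 / (4 / \<delta> + 4 * (4 + 14 * 4 ^ 7) / (q0 * \<rho> ^ 6))"
  have c: "0 < c"
    using de q0 \<rho> by (auto simp: c_def intro!: add_pos_pos divide_pos_pos)
  have "(\<lambda>n. measure_pmf.prob (random_subset_pmf (cube n) (p n))
                 {V. c * real n \<le> polytope_expansion (convex hull V) \<and>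
                     polytope_expansion (convex hull V) \<le> 1 * real n}) \<longlonglongrightarrow> 1"
    if ev: "\<forall>\<^sub>F n in sequentially. p n \<in> {1/2 + \<epsilon> <..< 1 - \<epsilon>}" for p
  proof (rule tendsto_prob_1I)
    \<comment> \<open>Few neighbours, few patterns, no full star. In the second term exp (-c n^2)
      beats n^n because a grid has quadratically many lines.\<close>
    define err where "err n = \<eta> ^ n + 4 ^ n * real n ^ n * exp (- (q0 * (\<delta> * real n / 600)\<^sup>2 / 4)) +
      exp (- (1/2 * (1 + 2 * e) ^ n / (real n + 1)\<^sup>2))" for n
    show "err \<longlonglongrightarrow> 0"
    proof -
      have "(\<lambda>n. \<eta> ^ n) \<longlonglongrightarrow> 0"
        using de by (intro LIMSEQ_power_zero) auto
      moreover have "(\<lambda>n. 4 ^ n * real n ^ n * exp (- (q0 * (\<delta> * real n / 600)\<^sup>2 / 4))) \<longlonglongrightarrow> 0"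
        using q0 de(1) by real_asymp
      moreover have "1 < 1 + 2 * e"
        using e by simp
      then have "(\<lambda>n. exp (- (1/2 * (1 + 2 * e) ^ n / (real n + 1)\<^sup>2))) \<longlonglongrightarrow> 0"
        by real_asymp
      ultimately have "(\<lambda>n. \<eta> ^ n + 4 ^ n * real n ^ n * exp (- (q0 * (\<delta> * real n / 600)\<^sup>2 / 4)) +
        exp (- (1/2 * (1 + 2 * e) ^ n / (real n + 1)\<^sup>2))) \<longlonglongrightarrow> 0 + 0 + 0"
        by (intro tendsto_add)
      then show ?thesis
        unfolding err_def[abs_def] by simp
    qed
    have "\<forall>\<^sub>F n in sequentially. 5000 / \<delta> \<le> real n"
      by real_asymp
    with ev show "\<forall>\<^sub>F n in sequentially. 1 - err n \<le> measure_pmf.prob (random_subset_pmf (cube n) (p n))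
                 {V. c * real n \<le> polytope_expansion (convex hull V) \<and>
                     polytope_expansion (convex hull V) \<le> 1 * real n}"
    proof eventually_elim
      fix n assume pn: "p n \<in> {1/2 + \<epsilon> <..< 1 - \<epsilon>}" and n: "5000 / \<delta> \<le> real n"
      define P where "P = p n"
      have P: "1/2 + e \<le> P" "e \<le> 1 - P" "0 < P" "P < 1" "P \<le> 1" "0 \<le> P" "1/2 \<le> P"
        using pn e by (auto simp: P_def)
      have dn: "5000 \<le> \<delta> * real n"
        using n de(1) by (simp add: field_simps)
      moreover have "\<delta> * real n \<le> real n"
        using de(2) by (simp add: mult_left_le_one_le de(1) less_imp_le)
      ultimately have n5: "5000 \<le> real n" "0 < n"
        by auto
      define t where "t = nat \<lfloor>\<delta> * real n\<rfloor>"
      \<comment> \<open>12r is at most half of \<open>\<delta> * n\<close>, so a grid with 6 columns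
        fits into the at least (t - 1)/2 directions that a majority provides. The bound 5000 absorbs
        all rounding in \<open>r\<close> and \<open>s\<close>.\<close>
      define r where "r = nat \<lfloor>\<delta> * real n / 24\<rfloor>"
      define s where "s = r div 6"
      define q where "q = P ^ 2 * (1 - P) ^ (2 ^ (2 * 3 + 5))"
      have t: "real t \<le> \<delta> * real n" "\<delta> * real n \<le> real t + 1"
        using dn unfolding t_def by linarith+
      have r: "real r \<le> \<delta> * real n / 24" "\<delta> * real n / 24 - 1 \<le> real r"
        using dn unfolding r_def by linarith+
      have s: "6 * s \<le> r" "r \<le> 6 * s + 5"
        unfolding s_def by simp_all
      have s': "\<delta> * real n / 600 \<le> real s"
        using s(2) r(2) dn by linarith
      have "0 < s"
        using s' dn by (cases "s = 0") auto
      have rt: "12 * r + 2 \<le> t + 1"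
        using r(1) t(2) dn by linarith
      have rn: "2 * 3 * r \<le> n"
        using r(1) \<open>\<delta> * real n \<le> real n\<close> by linarith
      have \<rho>r: "\<rho> * real n \<le> real r"
        using r(2) dn unfolding \<rho>_def by linarith
      have "q0 \<le> (1/2)\<^sup>2 * (1 - P) ^ (2 ^ 11)"
        unfolding q0_def using P e by (intro mult_mono power_mono) (auto simp: power2_eq_square)
      also have "\<dots> \<le> q"
        unfolding q_def using P by (intro mult_mono power_mono) auto
      finally have q: "q0 \<le> q" .
      let ?M = "random_subset_pmf (Pow {..<n}) P"
      define B1 where "B1 = {H. \<exists>x\<in>Pow {..<n}. H \<in> {H. card {i. i < n \<and> x \<triangle> {i} \<in> H} \<le> t}}"
      define B2 where "B2 = {H. few_patterns n 3 r s q H}"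
      define B3 where "B3 = {H. \<forall>z\<in>Pow {..<n}. \<not> star n z \<subseteq> H}"
      have b1: "measure_pmf.prob ?M B1 \<le> \<eta> ^ n"
        using prob_few_neighbors_le[of P "1 - e" n t] de(5)[OF P(1,5) t(1)] P e unfolding B1_def by linarith
      have b2: "measure_pmf.prob ?M B2 \<le> 4 ^ n * real n ^ n * exp (- (q0 * (\<delta> * real n / 600)\<^sup>2 / 4))"
      proof -
        have "measure_pmf.prob ?M B2 \<le> 4 ^ n * real n ^ n * exp (- (q * real (s * s) / 4))"
          unfolding B2_def by (rule prob_few_patterns_le[OF P(3,4)]) (use s(1) rn n5 q_def in auto)
        also have "\<dots> \<le> 4 ^ n * real n ^ n * exp (- (q0 * (\<delta> * real n / 600)\<^sup>2 / 4))"
        proof -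
          have "q0 * (\<delta> * real n / 600)\<^sup>2 \<le> q * (real s)\<^sup>2"
            using q q0 s' dn by (intro mult_mono power_mono) auto
          then have "q0 * (\<delta> * real n / 600)\<^sup>2 / 4 \<le> q * real (s * s) / 4"
            by (simp only: power2_eq_square[of "real s"] of_nat_mult)
          then have "exp (- (q * real (s * s) / 4)) \<le> exp (- (q0 * (\<delta> * real n / 600)\<^sup>2 / 4))"
            by (simp only: exp_le_cancel_iff neg_le_iff_le)
          then show ?thesis
            by (intro mult_left_mono) auto
        qed
        finally show ?thesis .
      qed
      have b3: "measure_pmf.prob ?M B3 \<le> exp (- (1/2 * (1 + 2 * e) ^ n / (real n + 1)\<^sup>2))"
      proof -
        have "(1 + 2 * e) ^ n \<le> (2 * P) ^ n"
          using P(1) e by (intro power_mono) auto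
        then have "1/2 * (1 + 2 * e) ^ n \<le> P * (2 * P) ^ n"
          using P e by (intro mult_mono) auto
        then have "1/2 * (1 + 2 * e) ^ n / (real n + 1)\<^sup>2 \<le> P * (2 * P) ^ n / (real n + 1)\<^sup>2"
          by (intro divide_right_mono) auto
        also have "\<dots> = P ^ (n + 1) * (2 ^ n / (real n + 1)\<^sup>2)"
          by (simp add: power_mult_distrib)
        finally show ?thesis
          using prob_no_star_le[OF P(6,5), of n] unfolding B3_def by (smt (verit) exp_le_cancel_iff)
      qed
      have "measure_pmf.prob ?M (B1 \<union> B2 \<union> B3) \<le> err n"
        using measure_pmf_Un_le3[of ?M B1 B2 B3] b1 b2 b3 unfolding err_def by linarith
      then have "1 - err n \<le> measure_pmf.prob (random_subset_pmf (cube n) P)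
        {V. c * real n \<le> polytope_expansion (convex hull V) \<and> polytope_expansion (convex hull V) \<le> 1 * real n}"
      proof (rule prob_cube_ge[OF P(6,5), rotated])
        fix H assume H: "H \<subseteq> Pow {..<n}" "H \<notin> B1 \<union> B2 \<union> B3"
        then obtain z where z: "z \<subseteq> {..<n}" "star n z \<subseteq> H"
          unfolding B3_def by blast
        have nb: "\<not> card {i. i < n \<and> x \<triangle> {i} \<in> H} \<le> t" if "x \<subseteq> {..<n}" for x
          using H(2) that unfolding B1_def by blast
        have fp: "\<not> few_patterns n 3 r s q H"
          using H(2) unfolding B2_def by blast
        show "c * real n \<le> edge_expansion H (cube_edges H) \<and> edge_expansion H (cube_edges H) \<le> 1 * real n"
          using dense_expansion[OF H(1) nb fp z s(1) \<open>0 < s\<close> rt t(2) \<rho>r q q0 de(1) \<rho> n5(2)]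
          by (simp add: c_def)
      qed
      then show "1 - err n \<le> measure_pmf.prob (random_subset_pmf (cube n) (p n))
        {V. c * real n \<le> polytope_expansion (convex hull V) \<and> polytope_expansion (convex hull V) \<le> 1 * real n}"
        by (simp add: P_def)
    qed
  qed
  then show ?thesis
    using c by (intro exI[of _ c] exI[of _ 1]) auto
qed

section \<open>Estimates for the sparse regime\<close>

lemma exponent_choice:
  fixes R :: real
  assumes "512 \<le> R"
  obtains d :: nat where "2 \<le> d" "2 ^ (2 * d + 5) \<le> R" "R < 2 ^ (2 * d + 7)"
proof -
  define y where "y = log 2 R"
  have R: "R = 2 powr y"
    using assms by (simp add: y_def)
  have "log 2 (2 ^ 9) \<le> y"
    unfolding y_def using assms by (intro log_mono) auto
  then have y9: "9 \<le> y"
    by (simp only: log_pow_cancel[of 2 9] of_nat_numeral)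
  \<comment> \<open>Exponents in steps of 2 confine \<open>R\<close> to a window of ratio 4, and
    \<open>y \<ge> 9\<close>, that is R \<ge> 2^9 = 512, gives d \<ge> 2.\<close>
  define d where "d = nat \<lfloor>(y - 5) / 2\<rfloor>"
  have "0 \<le> \<lfloor>(y - 5) / 2\<rfloor>"
    using y9 by simp
  then have rd: "real d = of_int \<lfloor>(y - 5) / 2\<rfloor>"
    unfolding d_def by simp
  have "real d \<le> (y - 5) / 2" "(y - 5) / 2 < real d + 1"
    unfolding rd by linarith+
  then have d: "2 * real d + 5 \<le> y" "y < 2 * real d + 7"
    by (simp_all add: field_simps)
  have "1 < real d"
    using d(2) y9 by linarith
  then have "2 \<le> d" by simp
  moreover have "(2::real) ^ (2 * d + 5) = 2 powr (2 * real d + 5)"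
    by (subst powr_realpow[symmetric]) auto
  then have "2 ^ (2 * d + 5) \<le> R"
    using d(1) powr_mono[of "2 * real d + 5" y 2] unfolding R by simp
  moreover have "(2::real) ^ (2 * d + 7) = 2 powr (2 * real d + 7)"
    by (subst powr_realpow[symmetric]) auto
  then have "R < 2 ^ (2 * d + 7)"
    using d(2) powr_less_mono[of y "2 * real d + 7" 2] unfolding R by simp
  ultimately show ?thesis
    using that by blast
qed

text \<open>Up to dimension 6x the trivial bound 1 for the probability suffices. Beyond it, (ln n /
  p)^2 = exp (2x) is below exp (k/3), and 2^k \<ge> exp (2k/3) leaves another exp (k/3) to absorb
  the factor 4k. So p^2 * 2^k / 4 is at least k * ln n, and the probability cancels n^k.\<close>

lemma lonely_term_le:
  fixes n k :: nat and p x :: real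
  assumes n: "1 \<le> ln (real n)" "1 < real n" and p: "0 < p" "p < 1"
    and x: "x = ln (ln (real n)) + ln (1 / p)" "100 \<le> x" and k: "1 \<le> k"
  shows "real n ^ k * (1 - p\<^sup>2) ^ (2 ^ (k - 1) - 1) \<le> real n powr (6 * x)"
proof (cases "real k \<le> 6 * x")
  case True
  have p2: "p\<^sup>2 \<le> 1"
    using p by (simp add: power_le_one)
  have "real n ^ k * (1 - p\<^sup>2) ^ (2 ^ (k - 1) - 1) \<le> real n ^ k * 1"
    using p2 by (intro mult_left_mono power_le_one) auto
  also have "\<dots> = real n powr real k"
    using n by (simp add: powr_realpow)
  also have "\<dots> \<le> real n powr (6 * x)"
    using n True by (intro powr_mono) auto
  finally show ?thesis .
next
  case False
  have k600: "600 \<le> real k"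
    using False x(2) by linarith
  have "exp (real k / 3) \<ge> 1 + real k / 3 + (real k / 3)\<^sup>2 / 2"
    by (rule exp_lower_Taylor_quadratic) simp
  moreover have "(real k / 3)\<^sup>2 / 2 = real k * real k / 18"
    by (simp add: power2_eq_square)
  moreover have "4 * real k \<le> real k * real k / 18"
    using k600 by (simp add: field_simps)
  ultimately have e1: "4 * real k \<le> exp (real k / 3)"
    using k600 by linarith
  have "exp (2 * x) \<le> exp (real k / 3)"
    using False by simp
  moreover have "exp x = ln (real n) / p"
    using n p unfolding x by (simp add: exp_add ln_div exp_diff exp_minus inverse_eq_divide)
  moreover have "exp (2 * x) = exp x * exp x"
    by (simp flip: exp_add)
  ultimately have "exp (2 * x) \<le> exp (real k / 3)" "exp (2 * x) = (ln (real n) / p)\<^sup>2"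
    by (simp_all only: power2_eq_square)
  then have e2: "(ln (real n) / p)\<^sup>2 \<le> exp (real k / 3)"
    by simp
  have "real k * (2/3) \<le> real k * ln 2"
    using ln2_ge_two_thirds by (intro mult_left_mono) auto
  then have "exp (real k * (2/3)) \<le> exp (real k * ln 2)"
    by (simp only: exp_le_cancel_iff)
  also have "exp (real k * ln 2) = 2 ^ k"
    by (simp add: exp_of_nat_mult)
  also have "exp (real k * (2/3)) = exp (real k / 3) * exp (real k / 3)"
    by (simp flip: exp_add)
  finally have "exp (real k / 3) * exp (real k / 3) \<le> 2 ^ k" .
  moreover have "4 * real k * (ln (real n) / p)\<^sup>2 \<le> exp (real k / 3) * exp (real k / 3)"
    using e1 e2 by (intro mult_mono) auto
  ultimately have big: "4 * real k * (ln (real n) / p)\<^sup>2 \<le> 2 ^ k"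
    by linarith
  obtain k' where k': "k = Suc (Suc k')"
    using k600 by (cases k; cases "k - 1") auto
  have "(2::nat) ^ k' \<le> 2 ^ (k - 1) - 1"
    unfolding k' by simp
  then have "real (2 ^ k') \<le> real (2 ^ (k - 1) - 1)"
    by (rule of_nat_mono)
  then have N: "2 ^ k / 4 \<le> real (2 ^ (k - 1) - 1)"
    unfolding k' by simp
  have "real k * ln (real n) \<le> real k * (ln (real n))\<^sup>2"
    using n by (intro mult_left_mono) (auto simp: power2_eq_square)
  also have "\<dots> = p\<^sup>2 * (4 * real k * (ln (real n) / p)\<^sup>2 / 4)"
    using p by (simp add: power_divide)
  also have "\<dots> \<le> p\<^sup>2 * (2 ^ k / 4)"
    using big by (intro mult_left_mono) auto
  also have "\<dots> \<le> p\<^sup>2 * real (2 ^ (k - 1) - 1)"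
    using N by (intro mult_left_mono) auto
  finally have key: "real k * ln (real n) \<le> p\<^sup>2 * real (2 ^ (k - 1) - 1)" .
  have "p\<^sup>2 \<le> 1"
    using p by (simp add: power_le_one)
  then have "(1 - p\<^sup>2) ^ (2 ^ (k - 1) - 1) \<le> exp (- (p\<^sup>2)) ^ (2 ^ (k - 1) - 1)"
    using exp_ge_add_one_self[of "- (p\<^sup>2)"] by (intro power_mono) auto
  also have "\<dots> = exp (- (p\<^sup>2 * real (2 ^ (k - 1) - 1)))"
    by (subst exp_of_nat_mult[symmetric]) (simp add: mult.commute)
  finally have f: "(1 - p\<^sup>2) ^ (2 ^ (k - 1) - 1) \<le> exp (- (p\<^sup>2 * real (2 ^ (k - 1) - 1)))" .
  have "real n ^ k = exp (real k * ln (real n))"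
    using n by (simp add: exp_of_nat_mult)
  then have "real n ^ k * (1 - p\<^sup>2) ^ (2 ^ (k - 1) - 1) \<le>
      exp (real k * ln (real n)) * exp (- (p\<^sup>2 * real (2 ^ (k - 1) - 1)))"
    using f by (simp add: mult_left_mono)
  also have "\<dots> = exp (real k * ln (real n) - p\<^sup>2 * real (2 ^ (k - 1) - 1))"
    by (simp add: exp_diff exp_minus divide_inverse)
  also have "\<dots> \<le> 1"
    using key by simp
  also have "1 \<le> real n powr (6 * x)"
    using n x(2) by (intro ge_one_powr_ge_zero) auto
  finally show ?thesis .
qed

text \<open>Group by dimension: there are at most n^k direction sets of size \<open>k\<close>, and
  the extra factor n counts the dimensions.\<close>

lemma lonely_sum_le:
  fixes n :: nat and p x :: real
  assumes n: "1 \<le> ln (real n)" "1 < real n" and p: "0 < p" "p < 1"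
    and x: "x = ln (ln (real n)) + ln (1 / p)" "100 \<le> x"
  shows "(\<Sum>D\<in>Pow {..<n} - {{}}. (1 - p\<^sup>2) ^ (2 ^ (card D - 1) - 1)) \<le> real n * real n powr (6 * x)"
proof -
  let ?f = "\<lambda>k. (1 - p\<^sup>2) ^ (2 ^ (k - 1) - 1)"
  have p2: "0 \<le> 1 - p\<^sup>2"
    using p by (simp add: power_le_one)
  have "(\<Sum>D\<in>Pow {..<n} - {{}}. ?f (card D)) = (\<Sum>k\<in>{1..n}. \<Sum>D\<in>{D \<in> Pow {..<n} - {{}}. card D = k}. ?f (card D))"
  proof (rule sum.group[symmetric])
    show "card ` (Pow {..<n} - {{}}) \<subseteq> {1..n}"
    proof (rule image_subsetI)
      fix D assume D: "D \<in> Pow {..<n} - {{}}"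
      then have "finite D" using finite_subset by blast
      then show "card D \<in> {1..n}"
        using D card_mono[of "{..<n}" D] by (auto simp: Suc_le_eq card_gt_0_iff)
    qed
  qed auto
  also have "\<dots> \<le> (\<Sum>k\<in>{1..n}. real n powr (6 * x))"
  proof (rule sum_mono)
    fix k assume k: "k \<in> {1..n}"
    have "(\<Sum>D\<in>{D \<in> Pow {..<n} - {{}}. card D = k}. ?f (card D)) = real (card {D \<in> Pow {..<n} - {{}}. card D = k}) * ?f k"
      by (subst sum.cong[OF refl, of _ _ "\<lambda>_. ?f k"]) auto
    also have "\<dots> \<le> real n ^ k * ?f k"
    proof (rule mult_right_mono)
      have "card {D \<in> Pow {..<n} - {{}}. card D = k} \<le> card {K. K \<subseteq> {..<n} \<and> card K = k}"
        by (rule card_mono) (auto intro: finite_subset[of _ "Pow {..<n}"])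
      then have "card {D \<in> Pow {..<n} - {{}}. card D = k} \<le> n ^ k"
        using card_subsets_le_power[of n k] by linarith
      then show "real (card {D \<in> Pow {..<n} - {{}}. card D = k}) \<le> real n ^ k"
        by (simp flip: of_nat_power)
    qed (use p2 in simp)
    also have "\<dots> \<le> real n powr (6 * x)"
      using k by (intro lonely_term_le[OF n p x]) auto
    finally show "(\<Sum>D\<in>{D \<in> Pow {..<n} - {{}}. card D = k}. ?f (card D)) \<le> real n powr (6 * x)" .
  qed
  also have "\<dots> = real n * real n powr (6 * x)"
    by simp
  finally show ?thesis .
qed

text \<open>A comparison of exponents: the coefficient is at most n^(d + 4), the right side at least
  n^(-1 - 1/4 + 9d/5), where n^(-1) stands for the factor 1/4. So 4d/5 has to be at least x/4 +
  21/4. By d \<ge> x/2 - 13 this holds once 0.15 x \<ge> 15.65, in particular for x \<ge>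
  110.\<close>

lemma sparse_lower_constant:
  fixes n d r :: nat and q x :: real
  assumes n: "16384 \<le> real n" and d: "2 \<le> d" "x - 26 \<le> 2 * real d" and x: "110 \<le> x"
    and q: "real n powr (-1/4) \<le> q" and r: "real n powr (9/10) \<le> real r"
  shows "real n powr (1/4 * x) * (2 * (2 * ((real n + 1)\<^sup>2 * real n * real n ^ d) + (real n + 1)\<^sup>2 * real n * 4 ^ (2 * d + 5)))
    \<le> q / 4 * real r ^ (2 * d)"
proof -
  have n1: "1 \<le> real n" "0 < real n" using n by auto
  have "(real n + 1)\<^sup>2 \<le> (2 * real n)\<^sup>2"
    using n1 by (intro power_mono) auto
  then have n2: "(real n + 1)\<^sup>2 * real n \<le> 4 * real n ^ 3"
    using mult_right_mono[of "(real n + 1)\<^sup>2" "(2 * real n)\<^sup>2" "real n"] n1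
    by (simp add: power2_eq_square power3_eq_cube)
  \<comment> \<open>Origin of the bound on \<open>n\<close>: 1024 * 16 = 16384.\<close>
  have "(4::real) ^ (2 * d + 5) = 1024 * 16 ^ d"
    by (simp add: power_add power_mult)
  also have "\<dots> \<le> 1024 ^ d * 16 ^ d"
    using d power_increasing[of 1 d "1024::real"] by (intro mult_right_mono) auto
  also have "\<dots> = 16384 ^ d"
    by (simp flip: power_mult_distrib)
  also have "\<dots> \<le> real n ^ d"
    using n by (intro power_mono) auto
  finally have four: "4 ^ (2 * d + 5) \<le> real n ^ d" .
  have "2 * (2 * ((real n + 1)\<^sup>2 * real n * real n ^ d) + (real n + 1)\<^sup>2 * real n * 4 ^ (2 * d + 5))
      \<le> 2 * (2 * (4 * real n ^ 3 * real n ^ d) + 4 * real n ^ 3 * real n ^ d)"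
  proof -
    have "(real n + 1)\<^sup>2 * real n * real n ^ d \<le> 4 * real n ^ 3 * real n ^ d"
      using n2 by (rule mult_right_mono) simp
    moreover have "(real n + 1)\<^sup>2 * real n * 4 ^ (2 * d + 5) \<le> 4 * real n ^ 3 * real n ^ d"
      using n2 four by (rule mult_mono) auto
    moreover have "2 * (2 * a + b) \<le> 2 * (2 * c + c)" if "a \<le> c" "b \<le> c" for a b c :: real
      using that by simp
    ultimately show ?thesis
      by blast
  qed
  also have "\<dots> = 24 * (real n ^ 3 * real n ^ d)"
    by simp
  also have "\<dots> \<le> real n * (real n ^ 3 * real n ^ d)"
    using n by (intro mult_right_mono) auto
  also have "\<dots> = real n ^ (d + 4)"
    by (simp add: power_add eval_nat_numeral mult_ac)
  also have "\<dots> = real n powr (real d + 4)"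
    using n1 by (subst powr_realpow[symmetric]) auto
  finally have M: "2 * (2 * ((real n + 1)\<^sup>2 * real n * real n ^ d) + (real n + 1)\<^sup>2 * real n * 4 ^ (2 * d + 5))
      \<le> real n powr (real d + 4)" .
  have "real n powr (1/4 * x) * (2 * (2 * ((real n + 1)\<^sup>2 * real n * real n ^ d) + (real n + 1)\<^sup>2 * real n * 4 ^ (2 * d + 5)))
     \<le> real n powr (1/4 * x) * real n powr (real d + 4)"
    using M by (intro mult_left_mono) auto
  also have "\<dots> = real n powr (1/4 * x + real d + 4)"
    by (simp add: powr_add mult.assoc)
  also have "\<dots> \<le> real n powr (-1 + (-1/4) + 9/10 * (2 * real d))"
    using n1 d x by (intro powr_mono) linarith+
  also have "\<dots> = real n powr (-1) * (real n powr (-1/4) * (real n powr (9/10 * (2 * real d))))"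
    by (simp only: powr_add mult.assoc)
  also have "real n powr (9/10 * (2 * real d)) = (real n powr (9/10)) ^ (2 * d)"
    using n1 by (subst powr_realpow[symmetric]) (auto simp: powr_powr)
  also have "real n powr (-1) * (real n powr (-1/4) * (real n powr (9/10)) ^ (2 * d)) \<le> 1/4 * (q * real r ^ (2 * d))"
  proof (rule mult_mono)
    show "real n powr (-1) \<le> 1/4"
      using n by (simp add: powr_minus field_simps)
    show "real n powr (-1/4) * (real n powr (9/10)) ^ (2 * d) \<le> q * real r ^ (2 * d)"
      using q r by (intro mult_mono power_mono) (auto intro: order_trans[OF powr_ge_zero])
  qed auto
  finally show ?thesis by simp
qed

lemma sparse_whp:
  fixes \<epsilon> :: real
  assumes "\<epsilon> > 0"
  shows "\<exists>c C. 0 < c \<and> 0 < C \<and>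
       (\<forall>p :: nat \<Rightarrow> real.
          (\<forall>\<^sub>F n in sequentially. p n \<in> {real n powr (- 0.05) <..< 1/2 - \<epsilon>}) \<longrightarrow>
          (\<lambda>n. measure_pmf.prob (random_subset_pmf (cube n) (p n))
                 {V. real n powr (c * (ln (ln (real n)) + ln (1 / p n)))
                       \<le> polytope_expansion (convex hull V) \<and>
                     polytope_expansion (convex hull V)
                       \<le> real n powr (C * (ln (ln (real n)) + ln (1 / p n)))}) \<longlonglongrightarrow> 1)"
proof -
  define e where "e = min \<epsilon> (1/4)"
  have e: "0 < e" "e \<le> 1/4" "e \<le> \<epsilon>"
    using assms by (auto simp: e_def)
  obtain \<delta> \<eta> where de: "0 < \<delta>" "\<delta> < 1" "0 < \<eta>" "\<eta> < 1"
    "\<And>P n t. 1/2 + e \<le> P \<Longrightarrow> P \<le> 1 \<Longrightarrow> real t \<le> \<delta> * real n \<Longrightarrow> 2 ^ n * ((1 - (1 - e) * P) ^ n / (1 - (1 - e)) ^ t) \<le> \<eta> ^ n"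
    using half_constants[OF e(1,2)] by metis
  have "(\<lambda>n. measure_pmf.prob (random_subset_pmf (cube n) (p n))
                 {V. real n powr (1/4 * (ln (ln (real n)) + ln (1 / p n)))
                       \<le> polytope_expansion (convex hull V) \<and>
                     polytope_expansion (convex hull V)
                       \<le> real n powr (10 * (ln (ln (real n)) + ln (1 / p n)))}) \<longlonglongrightarrow> 1"
    if ev: "\<forall>\<^sub>F n in sequentially. p n \<in> {real n powr (- 0.05) <..< 1/2 - \<epsilon>}" for p
  proof (rule tendsto_prob_1I)
    \<comment> \<open>\<open>q\<close> will be at least n^(-1/4) and \<open>s\<close> at least
      n^(9/10), so the exponent has order n^(31/20) and beats n^n. The lower end n^(-0.05) of the
      range of p enters through the bound on \<open>q\<close>.\<close>
    define err1 where "err1 n = 4 ^ n * real n ^ n * exp (- (real n powr (-1/4) * (real n powr (9/10))\<^sup>2 / 4))" for n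
    define err2 where "err2 n = 2 ^ n * exp (- (real n powr (- 0.05) * (real n * (real n - 1) / 2)))" for n
    define err3 where "err3 n = exp (- (real n powr (- 0.05) * 2 ^ n / 4))" for n
    define err where "err n = \<eta> ^ n + err1 n + err2 n + (err3 n + 1 / real n)" for n
    have lims: "err1 \<longlonglongrightarrow> 0" "err2 \<longlonglongrightarrow> 0" "err3 \<longlonglongrightarrow> 0"
      unfolding err1_def err2_def err3_def by real_asymp+
    have "(\<lambda>n. \<eta> ^ n) \<longlonglongrightarrow> 0"
      using de by (intro LIMSEQ_power_zero) auto
    then have "err \<longlonglongrightarrow> 0 + 0 + 0 + (0 + 0)"
      unfolding err_def by (intro tendsto_add lims lim_1_over_n)
    then show "err \<longlonglongrightarrow> 0"
      by simp
    have ev1: "\<forall>\<^sub>F n in sequentially. 110 \<le> ln (ln (real n))"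
      by real_asymp
    have ev2: "\<forall>\<^sub>F n in sequentially. 5120 \<le> ln (real n)"
      by real_asymp
    have ev3: "\<forall>\<^sub>F n in sequentially. ln (real n) * real n powr 0.05 \<le> real n"
      by real_asymp
    have ev4: "\<forall>\<^sub>F n in sequentially. real n powr (9/10) \<le> (\<delta> * real n / (4 * ln (real n)) - 1) / (2 * ln (real n)) - 1"
      using de(1) by real_asymp
    have ev5: "\<forall>\<^sub>F n in sequentially. 4 \<le> real n powr (- 0.05) * 2 ^ n"
      by real_asymp
    have ev6: "\<forall>\<^sub>F n in sequentially. 20 / \<delta> \<le> real n \<and> 16384 \<le> real n"
      by (intro eventually_conj; real_asymp)
    show "\<forall>\<^sub>F n in sequentially. 1 - err n \<le> measure_pmf.prob (random_subset_pmf (cube n) (p n))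
                 {V. real n powr (1/4 * (ln (ln (real n)) + ln (1 / p n)))
                       \<le> polytope_expansion (convex hull V) \<and>
                     polytope_expansion (convex hull V)
                       \<le> real n powr (10 * (ln (ln (real n)) + ln (1 / p n)))}"
      using ev ev1 ev2 ev3 ev4 ev5 ev6
    proof eventually_elim
      fix n assume pn: "p n \<in> {real n powr (- 0.05) <..< 1/2 - \<epsilon>}" and n1: "110 \<le> ln (ln (real n))"
        and n2: "5120 \<le> ln (real n)" and n3: "ln (real n) * real n powr 0.05 \<le> real n"
        and n4: "real n powr (9/10) \<le> (\<delta> * real n / (4 * ln (real n)) - 1) / (2 * ln (real n)) - 1"
        and n5: "4 \<le> real n powr (- 0.05) * 2 ^ n" and n6: "20 / \<delta> \<le> real n \<and> 16384 \<le> real n"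
      define P where "P = p n"
      define x where "x = ln (ln (real n)) + ln (1 / P)"
      define l where "l = ln (real n)"
      have n0: "0 < real n" "1 < real n" "0 < n"
        using n6 by auto
      have l: "5120 \<le> l" "0 < l"
        using n2 by (simp_all add: l_def)
      have P: "real n powr (- 0.05) < P" "0 < P" "P < 1/2" "P < 1" "0 \<le> P" "P \<le> 1" "1/2 + e \<le> 1 - P" "1 - P \<le> 1"
      proof -
        show P1: "real n powr (- 0.05) < P"
          using pn by (simp add: P_def)
        show "0 < P" "0 \<le> P" "1 - P \<le> 1"
          using P1 powr_ge_zero[of "real n" "- 0.05"] by linarith+
        have "P < 1/2 - \<epsilon>"
          using pn by (simp add: P_def)
        then show "P < 1/2" "P < 1" "P \<le> 1" "1/2 + e \<le> 1 - P"
          using assms e by linarith+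
      qed
      have lnP: "0 < ln (1 / P)"
        using P by (intro ln_gt_zero) (simp add: field_simps)
      have x: "110 \<le> x" "100 \<le> x"
        using n1 lnP by (simp_all add: x_def)
      \<comment> \<open>With 2^(2d + 5) \<le> \<open>R\<close>, the expected number of points of
        \<open>H\<close> among 2^(2d + 5) is at most (ln n)/20. As ln (1 - P) \<ge> -2P, all of them
        are absent with probability at least n^(-1/10).\<close>
      define R where "R = l / (20 * P)"
      have "512 \<le> R"
      proof -
        have "512 * (20 * P) \<le> l"
          using P(3) l(1) by linarith
        then show ?thesis
          using P(2) by (simp add: R_def pos_le_divide_eq)
      qed
      then obtain d where d: "2 \<le> d" "2 ^ (2 * d + 5) \<le> R" "R < 2 ^ (2 * d + 7)"
        using exponent_choice by blast
      have lnR: "ln R = x - ln 20"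
        using P l unfolding R_def x_def l_def by (simp add: ln_div ln_mult)
      \<comment> \<open>Crude constants: ln 2 < 1 and ln 20 \<le> 19, hence 26 = 7 + 19.\<close>
      have dx: "x - 26 \<le> 2 * real d"
      proof -
        have "ln R < ln (2 ^ (2 * d + 7))"
          using d(3) \<open>512 \<le> R\<close> by (subst ln_less_cancel_iff) auto
        also have "ln ((2::real) ^ (2 * d + 7)) = (2 * real d + 7) * ln 2"
          by (subst ln_realpow) auto
        also have "\<dots> \<le> (2 * real d + 7) * 1"
          using ln_2_less_1 by (intro mult_left_mono) auto
        finally have "x - ln 20 < 2 * real d + 7"
          by (simp add: lnR)
        moreover have "ln (20::real) \<le> 20 - 1"
          by (rule ln_le_minus_one) simp
        ultimately show ?thesis by linarith
      qed
      have P_inv: "1 / P \<le> real n powr 0.05"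
      proof -
        have "1 \<le> P * real n powr 0.05"
          using mult_right_mono[OF less_imp_le[OF P(1)], of "real n powr 0.05"] n0 by (simp flip: powr_add)
        then show ?thesis
          using P(2) by (simp add: pos_divide_le_eq mult.commute)
      qed
      have dl: "real d \<le> l"
      proof -
        have "R \<le> l * (1 / P)"
          using P l by (simp add: R_def field_simps)
        also have "\<dots> \<le> l * real n powr 0.05"
          using P_inv l by (intro mult_left_mono) auto
        also have "\<dots> \<le> real n"
          using n3 by (simp add: l_def)
        finally have "2 ^ (2 * d + 5) \<le> real n"
          using d(2) by linarith
        then have "ln (2 ^ (2 * d + 5)) \<le> l"
          unfolding l_def by (subst ln_le_cancel_iff) (use n0 in auto)
        moreover have "ln ((2::real) ^ (2 * d + 5)) = (2 * real d + 5) * ln 2"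
          by (subst ln_realpow) auto
        moreover have "(2 * real d + 5) * (2/3) \<le> (2 * real d + 5) * ln 2"
          using ln2_ge_two_thirds by (intro mult_left_mono) auto
        ultimately have "(2 * real d + 5) * (2/3) \<le> l"
          by linarith
        moreover have "0 \<le> real d" by simp
        ultimately show ?thesis by argo
      qed
      have d0: "0 < real d"
        using d(1) by simp
      define t where "t = nat \<lfloor>\<delta> * real n\<rfloor>"
      \<comment> \<open>Then 2dr is at most half of \<open>\<delta> * n\<close>, which leaves room
        for the five directions lost to \<open>\<Delta>\<close>.\<close>
      define r where "r = nat \<lfloor>\<delta> * real n / (4 * real d)\<rfloor>"
      define s where "s = r div (2 * d)"
      define q where "q = P ^ 2 * (1 - P) ^ (2 ^ (2 * d + 5))"
      have dn: "20 \<le> \<delta> * real n"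
        using n6 de(1) by (simp add: field_simps)
      have dnn: "\<delta> * real n \<le> real n"
        using de(2) by (simp add: mult_left_le_one_le de(1) less_imp_le)
      have t: "real t \<le> \<delta> * real n" "\<delta> * real n \<le> real t + 1"
        using dn unfolding t_def by linarith+
      have "0 \<le> \<delta> * real n / (4 * real d)"
        using dn d0 by simp
      then have r: "real r \<le> \<delta> * real n / (4 * real d)" "\<delta> * real n / (4 * real d) - 1 \<le> real r"
        unfolding r_def by linarith+
      have rd: "4 * (real d * real r) \<le> \<delta> * real n"
        using r(1) d0 by (simp add: pos_le_divide_eq mult_ac)
      have rt: "2 * d * r + 5 \<le> t + 1"
      proof -
        have "real (2 * d * r + 5) \<le> real (t + 1)"
          using rd t(2) dn by simp
        then show ?thesis
          by (simp only: of_nat_le_iff)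
      qed
      have rn: "2 * d * r \<le> n"
      proof -
        have "0 \<le> real d * real r" by simp
        then have "2 * (real d * real r) \<le> real n"
          using rd dnn by linarith
        then have "real (2 * d * r) \<le> real n"
          by simp
        then show ?thesis
          by (simp only: of_nat_le_iff)
      qed
      have r': "\<delta> * real n / (4 * l) - 1 \<le> real r"
      proof -
        have "\<delta> * real n / (4 * l) \<le> \<delta> * real n / (4 * real d)"
          using dl d0 dn by (intro divide_left_mono) auto
        then show ?thesis using r(2) by linarith
      qed
      have s1: "2 * d * s \<le> r"
        unfolding s_def by (simp add: mult.commute)
      have s9: "real n powr (9/10) \<le> real s"
      proof -
        have "real r / (2 * real d) - 1 \<le> real s"
        proof -
          have "r \<le> 2 * d * s + 2 * d"
            using mod_less_divisor[of "2 * d" r] d(1) mult_div_mod_eq[of "2 * d" r] unfolding s_def by linarith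
          then have "real r \<le> real (2 * d * s + 2 * d)"
            by (rule of_nat_mono)
          then have "real r \<le> (real s + 1) * (2 * real d)"
            by (simp add: algebra_simps)
          then have "real r / (2 * real d) \<le> real s + 1"
            using d0 by (simp add: pos_divide_le_eq)
          then show ?thesis by linarith
        qed
        moreover have "real r / (2 * l) \<le> real r / (2 * real d)"
          using dl d0 by (intro divide_left_mono) auto
        moreover have "(\<delta> * real n / (4 * l) - 1) / (2 * l) \<le> real r / (2 * l)"
          using r' l by (intro divide_right_mono) auto
        ultimately show ?thesis
          using n4 unfolding l_def[symmetric] by linarith
      qed
      have s0: "0 < s"
      proof -
        have "0 < real n powr (9/10)"
          using n0 by simp
        then have "0 < real s"
          using s9 by linarith
        then show ?thesis by simp
      qed
      have "s \<le> r"
        unfolding s_def by simp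
      then have r9: "real n powr (9/10) \<le> real r"
        using s9 by linarith
      \<comment> \<open>The absent points and the factor P^2 cost n^(-1/10) each.\<close>
      have q: "real n powr (-1/4) \<le> q"
      proof -
        have ln1: "- 2 * P \<le> ln (1 - P)"
        proof -
          have "- P - 2 * P\<^sup>2 \<le> ln (1 - P)"
            using P by (intro ln_one_minus_pos_lower_bound) auto
          moreover have "P\<^sup>2 \<le> P * (1/2)"
            using P unfolding power2_eq_square by (intro mult_left_mono) auto
          ultimately show ?thesis by linarith
        qed
        have "real (2 ^ (2 * d + 5)) * P \<le> R * P"
          using d(2) P by (intro mult_right_mono) auto
        also have "\<dots> = l / 20"
          using P by (simp add: R_def)
        finally have KP: "real (2 ^ (2 * d + 5)) * P \<le> l / 20" .
        have "real (2 ^ (2 * d + 5)) * (- 2 * P) \<le> real (2 ^ (2 * d + 5)) * ln (1 - P)"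
          using ln1 by (intro mult_left_mono) auto
        then have "- (l / 10) \<le> real (2 ^ (2 * d + 5)) * ln (1 - P)"
          using KP by argo
        then have "exp (- (l / 10)) \<le> exp (real (2 ^ (2 * d + 5)) * ln (1 - P))"
          by (simp only: exp_le_cancel_iff)
        also have "\<dots> = (1 - P) ^ (2 ^ (2 * d + 5))"
          using P by (subst exp_of_nat_mult) simp
        finally have "real n powr (- 1/10) \<le> (1 - P) ^ (2 ^ (2 * d + 5))"
          using n0 by (simp add: powr_def l_def)
        moreover have "(real n powr (- 0.05))\<^sup>2 \<le> P\<^sup>2"
          using P by (intro power_mono) auto
        then have "real n powr (- 1/10) \<le> P\<^sup>2"
          using n0 by (simp add: power2_eq_square flip: powr_add)
        ultimately have "real n powr (- 1/10) * real n powr (- 1/10) \<le> q"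
          unfolding q_def by (intro mult_mono) auto
        moreover have "real n powr (-1/4) \<le> real n powr (- 1/10 + - 1/10)"
          using n0 by (intro powr_mono) auto
        ultimately show ?thesis
          by (simp only: powr_add)
      qed
      define S where "S = (\<Sum>D\<in>Pow {..<n} - {{}}. (1 - P\<^sup>2) ^ (2 ^ (card D - 1) - 1))"
      \<comment> \<open>n times the bound on the mean, so that Markov's inequality leaves the
        probability 1/n.\<close>
      define T where "T = real n * (2 ^ n * S)"
      have S_le: "S \<le> real n * real n powr (6 * x)"
        unfolding S_def using n2 n0 P x by (intro lonely_sum_le) (auto simp: x_def)
      have S0: "0 < S"
      proof -
        have "(1 - P\<^sup>2) ^ (2 ^ (card {0::nat} - 1) - 1) \<le> S"
          unfolding S_def using n0(3) P by (intro member_le_sum) (auto simp: power_le_one)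
        then show ?thesis by simp
      qed
      have T0: "0 < T"
        using S0 n0 by (simp add: T_def)
      have T_le: "T \<le> real n powr (10 * x) * (P * 2 ^ n / 4)"
      proof -
        \<comment> \<open>Origin of the constant 10: the factors 4 and 1/P, the n in
          \<open>T\<close> and the n from the sum over dimensions cost n^4 in total, and 4 + 6x
          \<le> 10x.\<close>
        have "4 * real n * S * (1 / P) \<le> real n * real n * (real n * real n powr (6 * x)) * real n"
        proof (intro mult_mono)
          have "real n powr 0.05 \<le> real n powr 1"
            using n0 by (intro powr_mono) auto
          then show "1 / P \<le> real n"
            using P_inv n0 by simp
          show "S \<le> real n * real n powr (6 * x)"
            by (rule S_le)
        qed (use n6 n0 S0 P in auto)
        also have "\<dots> = real n powr 4 * real n powr (6 * x)"
          using n0 by (simp add: powr_numeral eval_nat_numeral)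
        also have "\<dots> = real n powr (4 + 6 * x)"
          by (simp only: powr_add)
        also have "\<dots> \<le> real n powr (10 * x)"
          using n0 x by (intro powr_mono) auto
        finally have "4 * real n * S * (1 / P) * (P * 2 ^ n / 4) \<le> real n powr (10 * x) * (P * 2 ^ n / 4)"
          using P by (intro mult_right_mono) auto
        moreover have "4 * real n * S * (1 / P) * (P * 2 ^ n / 4) = T"
          using P by (simp add: T_def)
        ultimately show ?thesis by simp
      qed
      have P4: "4 \<le> P * 2 ^ n"
      proof -
        have "real n powr (- 0.05) * 2 ^ n \<le> P * 2 ^ n"
          using P(1) by (intro mult_right_mono) auto
        then show ?thesis using n5 by linarith
      qed
      let ?M = "random_subset_pmf (Pow {..<n}) P"
      define B1 where "B1 = {H. \<exists>x\<in>Pow {..<n}. H \<in> {H. card {i. i < n \<and> x \<triangle> {i} \<notin> H} \<le> t}}"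
      define B2 where "B2 = {H. few_patterns n d r s q H}"
      define B3 where "B3 = {H. \<exists>x\<in>Pow {..<n}. H \<in> {H. \<forall>y\<in>H. \<not> card (x \<triangle> y) \<le> 2}}"
      define B4 where "B4 = {H :: nat set set. real (card H) \<le> P * 2 ^ n / 4}"
      define B5 where "B5 = {H. T \<le> real (card (lonely_pairs H))}"
      have b1: "measure_pmf.prob ?M B1 \<le> \<eta> ^ n"
        using prob_few_missing_le[of P "1 - e" n t] de(5)[OF P(7,8) t(1)] P e unfolding B1_def by linarith
      have b2: "measure_pmf.prob ?M B2 \<le> err1 n"
      proof -
        have "measure_pmf.prob ?M B2 \<le> 4 ^ n * real n ^ n * exp (- (q * real (s * s) / 4))"
          unfolding B2_def by (rule prob_few_patterns_le[OF P(2,4) d(1) s1 rn n0(3) q_def])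
        also have "\<dots> \<le> err1 n"
        proof -
          have "real n powr (-1/4) * (real n powr (9/10))\<^sup>2 \<le> q * (real s)\<^sup>2"
            using q s9 by (intro mult_mono power_mono) (auto intro: order_trans[OF powr_ge_zero])
          then have "real n powr (-1/4) * (real n powr (9/10))\<^sup>2 / 4 \<le> q * real (s * s) / 4"
            by (simp only: power2_eq_square[of "real s"] of_nat_mult)
          then have "exp (- (q * real (s * s) / 4)) \<le> exp (- (real n powr (-1/4) * (real n powr (9/10))\<^sup>2 / 4))"
            by (simp only: exp_le_cancel_iff neg_le_iff_le)
          then show ?thesis
            unfolding err1_def by (intro mult_left_mono) auto
        qed
        finally show ?thesis .
      qed
      have b3: "measure_pmf.prob ?M B3 \<le> err2 n"
      proof -
        have "(1 - P) ^ (n choose 2) \<le> exp (- P) ^ (n choose 2)"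
          using exp_ge_add_one_self[of "- P"] P by (intro power_mono) auto
        also have "\<dots> = exp (- (P * real (n choose 2)))"
          by (subst exp_of_nat_mult[symmetric]) (simp add: mult.commute)
        also have "\<dots> \<le> exp (- (real n powr (- 0.05) * (real n * (real n - 1) / 2)))"
        proof -
          have "real (n choose 2) = real n * (real n - 1) / 2"
          proof -
            have "even (n * (n - 1))" by auto
            then have "2 * (n choose 2) = n * (n - 1)"
              by (simp add: choose_two)
            then have "real (2 * (n choose 2)) = real (n * (n - 1))"
              by (simp only:)
            then show ?thesis
              using n0(3) by (simp add: of_nat_diff)
          qed
          moreover have "real n powr (- 0.05) * (real n * (real n - 1) / 2) \<le> P * (real n * (real n - 1) / 2)"
            using P n0 by (intro mult_right_mono) auto
          ultimately show ?thesis
            by (simp only: exp_le_cancel_iff neg_le_iff_le)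
        qed
        finally have "2 ^ n * (1 - P) ^ (n choose 2) \<le> err2 n"
          unfolding err2_def by (intro mult_left_mono) auto
        then show ?thesis
          using prob_far_le[OF P(5,6), of n] unfolding B3_def by linarith
      qed
      have b4: "measure_pmf.prob ?M B4 \<le> err3 n"
      proof -
        have "real n powr (- 0.05) * 2 ^ n / 4 \<le> P * 2 ^ n / 4"
          using P by (intro divide_right_mono mult_right_mono) auto
        then have "exp (- (P * 2 ^ n / 4)) \<le> err3 n"
          unfolding err3_def by (simp only: exp_le_cancel_iff neg_le_iff_le)
        then show ?thesis
          using prob_card_le[OF P(5,6), of n] unfolding B4_def by linarith
      qed
      have b5: "measure_pmf.prob ?M B5 \<le> 1 / real n"
      proof -
        have "T * measure_pmf.prob ?M B5 \<le> 2 ^ n * S"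
          using prob_many_lonely_le[OF P(5,6), of T n] unfolding B5_def S_def .
        also have "\<dots> = T * (1 / real n)"
          using n0 by (simp add: T_def)
        finally show ?thesis
          using T0 by (subst (asm) mult_le_cancel_left_pos) auto
      qed
      have "measure_pmf.prob ?M (B1 \<union> B2 \<union> B3 \<union> (B4 \<union> B5)) \<le>
          measure_pmf.prob ?M (B1 \<union> B2 \<union> B3) + (measure_pmf.prob ?M B4 + measure_pmf.prob ?M B5)"
        using measure_Un_le[of "B1 \<union> B2 \<union> B3" "measure_pmf ?M" "B4 \<union> B5"] measure_Un_le[of B4 "measure_pmf ?M" B5] by simp
      then have "measure_pmf.prob ?M (B1 \<union> B2 \<union> B3 \<union> (B4 \<union> B5)) \<le> err n"
        using measure_pmf_Un_le3[of ?M B1 B2 B3] b1 b2 b3 b4 b5 unfolding err_def by linarith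
      then have "1 - err n \<le> measure_pmf.prob (random_subset_pmf (cube n) P)
        {V. real n powr (1/4 * x) \<le> polytope_expansion (convex hull V) \<and>
          polytope_expansion (convex hull V) \<le> real n powr (10 * x)}"
      proof (rule prob_cube_ge[OF P(5,6), rotated])
        fix H assume H: "H \<subseteq> Pow {..<n}" "H \<notin> B1 \<union> B2 \<union> B3 \<union> (B4 \<union> B5)"
        have far: "\<not> (\<forall>y\<in>H. \<not> card (x \<triangle> y) \<le> 2)" if "x \<subseteq> {..<n}" for x
          using H(2) that unfolding B3_def by blast
        have missing: "\<not> card {i. i < n \<and> x \<triangle> {i} \<notin> H} \<le> t" if "x \<subseteq> {..<n}" for x
          using H(2) that unfolding B1_def by blast
        have rest: "\<not> few_patterns n d r s q H" "\<not> real (card H) \<le> P * 2 ^ n / 4" "\<not> T \<le> real (card (lonely_pairs H))"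
          using H(2) unfolding B2_def B4_def B5_def by blast+
        have lo: "real n powr (1/4 * x) * (2 * (2 * ((real n + 1)\<^sup>2 * real n * real n ^ d) + (real n + 1)\<^sup>2 * real n * 4 ^ (2 * d + 5)))
          \<le> q / 4 * real r ^ (2 * d)"
          using n6 by (intro sparse_lower_constant d(1) dx x(1) q r9) auto
        show "real n powr (1/4 * x) \<le> edge_expansion H (cube_edges H) \<and> edge_expansion H (cube_edges H) \<le> real n powr (10 * x)"
          using sparse_expansion[OF H(1) far missing rest d(1) s1 s0 rt P4 n0(3) lo T_le powr_ge_zero] by blast
      qed
      then show "1 - err n \<le> measure_pmf.prob (random_subset_pmf (cube n) (p n))
                 {V. real n powr (1/4 * (ln (ln (real n)) + ln (1 / p n)))
                       \<le> polytope_expansion (convex hull V) \<and>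
                     polytope_expansion (convex hull V)
                       \<le> real n powr (10 * (ln (ln (real n)) + ln (1 / p n)))}"
        unfolding x_def P_def .
    qed
  qed
  then show ?thesis
    by (intro exI[of _ "1/4"] exI[of _ 10]) auto
qed

theorem theorem1p1:
  fixes \<epsilon> :: real
  assumes "\<epsilon> > 0"
  shows
    "(\<exists>c C. 0 < c \<and> 0 < C \<and>
       (\<forall>p :: nat \<Rightarrow> real.
          (\<forall>\<^sub>F n in sequentially. p n \<in> {1/2 + \<epsilon> <..< 1 - \<epsilon>}) \<longrightarrow>
          (\<lambda>n. measure_pmf.prob (random_subset_pmf (cube n) (p n))
                 {V. c * real n \<le> polytope_expansion (convex hull V) \<and>
                     polytope_expansion (convex hull V) \<le> C * real n}) \<longlonglongrightarrow> 1)) \<and>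
     (\<exists>c C. 0 < c \<and> 0 < C \<and>
       (\<forall>p :: nat \<Rightarrow> real.
          (\<forall>\<^sub>F n in sequentially. p n \<in> {real n powr (- 0.05) <..< 1/2 - \<epsilon>}) \<longrightarrow>
          (\<lambda>n. measure_pmf.prob (random_subset_pmf (cube n) (p n))
                 {V. real n powr (c * (ln (ln (real n)) + ln (1 / p n)))
                       \<le> polytope_expansion (convex hull V) \<and>
                     polytope_expansion (convex hull V)
                       \<le> real n powr (C * (ln (ln (real n)) + ln (1 / p n)))}) \<longlonglongrightarrow> 1))"
  using dense_whp[OF assms] sparse_whp[OF assms] by (rule conjI)

end
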